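(* Let $M^3$ be an indefinite affine hypersphere of $\mathbb{R}^4$ (with $S=H\,\mathrm{Id}$) which admits a pointwise $\mathbb{Z}_3$-symmetry or a pointwise $SO(2)$-symmetry. Let $a_{22}^2-a_4^2\neq H$ for some $p\in M^3$. Then $M^3$ is affine equivalent to $$\varphi: I\times N^2\to\mathbb{R}^4,\qquad (t,v,w)\mapsto(\gamma_1(t),\gamma_2(t)\,\phi(v,w)),$$ where $\phi:N^2\to\mathbb{R}^3$ is a (positive definite) elliptic or hyperbolic affine sphere and $\gamma=(\gamma_1,\gamma_2):I\to\mathbb{R}^2$ is a curve. Moreover, if $M^3$ admits a pointwise $SO(2)$-symmetry, then $N^2$ is either an ellipsoid or a two-sheeted hyperboloid.
   Context: Affine hyperspheres. $D$ is the flat connection and $\det$ the volume form of $\mathbb{R}^{n+1}$; $M^n$ is connected and oriented. For a nondegenerate immersed hypersurface $\varphi:M^n\to\mathbb{R}^{n+1}$ the affine (Blaschke) normal $\xi$ is the transverse vector field, unique up to sign, such that (identifying tangent vectors with their images under $\varphi_*$) $D_XY=\nabla_XY+h(X,Y)\xi$, $D_X\xi=-SX$ with $SX$ tangential, and the volume form $\det(\varphi_*X_1,\dots,\varphi_*X_n,\xi)$ equals the volume form $|\det h|^{1/2}$ of $h$. $\nabla$ is the induced connection, $h$ the affine metric, $S$ the shape operator, $\widehat\nabla$ the Levi-Civita connection of $h$, and $K(X,Y)=\nabla_XY-\widehat\nabla_XY$ the difference tensor. $\varphi$ is an affine (hyper)sphere if $S=H\,\mathrm{Id}$ with $H$ constant;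 it is proper if $H\ne0$ and improper if $H=0$. A 2-dimensional affine sphere in $\mathbb{R}^3$ is positive definite if (for a suitable sign of $\xi$) $h$ is positive definite, and is then elliptic if $H>0$ and hyperbolic if $H<0$. For $n=3$ and $h$ indefinite, the sign of $\xi$ is fixed so that $h$ has exactly one negative direction. Pointwise symmetry. $M^3$ admits a pointwise $SO(2)$-symmetry (resp. $\mathbb{Z}_3$-symmetry) if at each $p\in M^3$ there is a basis $\{T,V,W\}$ of $T_pM$, orthonormal for $h$ with $h(T,T)=-1$, $h(V,V)=h(W,W)=1$, such that $K(T,T)=-2a_4T$, $K(T,V)=a_4V$, $K(T,W)=a_4W$, $K(V,V)=-a_4T+a_6V$, $K(V,W)=-a_6W$, $K(W,W)=-a_4T-a_6V$, with $a_4>0$ and $a_6=0$ (resp. $a_4>0$ and $a_6>0$). (This is the canonical form of $K$ when its stabilizer in the isometry group $SO(1,2)$ of $(T_pM,h)$ is $SO(2)$, resp. $\mathbb{Z}_3$.) The vector field $T$ and the function $a_4$ are then globally defined and smooth, and $a_{22}:=h(\widehat\nabla_VT,V)$, which does not depend on the choice of the unit vector $V\perp T$. Affine equivalent means equal up to an affine transformation of $\mathbb{R}^4$ and reparametrization; $I$ is an interval and $N^2$ a surface with coordinates $(v,w)$. The statement that $N^2$ is a quadric refers to its immersion $\phi$.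
   Formalization: "Affine equivalent to I×N²→R⁴" is proved locally: every point of M³ has a neighbourhood of this form, with one affine transformation and one type (elliptic or hyperbolic) for all points; globally it fails, e.g. for a product with two points removed. *)

theory Defs
  imports "HOL-Analysis.Analysis"
begin

section \<open>Smooth maps and smooth manifolds\<close>

abbreviation dd :: "('a::real_normed_vector \<Rightarrow> 'b::real_normed_vector) \<Rightarrow> 'a \<Rightarrow> 'a \<Rightarrow> 'b" where
  "dd f x u \<equiv> frechet_derivative f (at x) u"

primrec Ck_on :: "nat \<Rightarrow> 'a::euclidean_space set \<Rightarrow> ('a \<Rightarrow> 'b::real_normed_vector) \<Rightarrow> bool" where
  "Ck_on 0 S f \<longleftrightarrow> continuous_on S f"
| "Ck_on (Suc k) S f \<longleftrightarrow>
     (\<forall>x\<in>S. f differentiable at x) \<and> (\<forall>u. Ck_on k S (\<lambda>x. dd f x u))"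

text \<open>Only meant for open \<open>S\<close>.\<close>

definition smooth_on :: "'a::euclidean_space set \<Rightarrow> ('a \<Rightarrow> 'b::real_normed_vector) \<Rightarrow> bool" where
  "smooth_on S f \<longleftrightarrow> (\<forall>k. Ck_on k S f)"

text \<open>Manifolds are given by local parametrizations \<open>(U, \<psi>)\<close>, the inverses of charts:
  \<open>\<psi>\<close> maps the open set \<open>U\<close> of the model space homeomorphically onto an open set
  of the manifold.\<close>

type_synonym ('e, 'a) param = "'e set \<times> ('e \<Rightarrow> 'a)"

definition local_param :: "'a topology \<Rightarrow> ('e::euclidean_space, 'a) param \<Rightarrow> bool" where
  "local_param X = (\<lambda>(U, \<psi>). open U \<and> openin X (\<psi> ` U) \<and>
     homeomorphic_map (top_of_set U) (subtopology X (\<psi> ` U)) \<psi>)"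

abbreviation transition :: "('d, 'a) param \<Rightarrow> ('e, 'a) param \<Rightarrow> 'd \<Rightarrow> 'e" where
  "transition c d \<equiv> inv_into (fst d) (snd d) \<circ> snd c"

abbreviation transition_dom :: "('d, 'a) param \<Rightarrow> ('e, 'a) param \<Rightarrow> 'd set" where
  "transition_dom c d \<equiv> fst c \<inter> snd c -` (snd d ` fst d)"

definition compatible ::
  "('d::euclidean_space, 'a) param \<Rightarrow> ('e::euclidean_space, 'a) param \<Rightarrow> bool" where
  "compatible c d \<longleftrightarrow> smooth_on (transition_dom c d) (transition c d) \<and>
     smooth_on (transition_dom d c) (transition d c)"

definition smooth_manifold ::
  "'a topology \<Rightarrow> ('e::euclidean_space, 'a) param set \<Rightarrow> bool" where
  "smooth_manifold X \<A> \<longleftrightarrow>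
     Hausdorff_space X \<and>
     (\<exists>\<B>. countable \<B> \<and> (\<forall>B\<in>\<B>. openin X B) \<and>
        (\<forall>G p. openin X G \<and> p \<in> G \<longrightarrow> (\<exists>B\<in>\<B>. p \<in> B \<and> B \<subseteq> G))) \<and>
     (\<forall>c\<in>\<A>. local_param X c) \<and>
     topspace X = (\<Union>(U, \<psi>)\<in>\<A>. \<psi> ` U) \<and>
     (\<forall>c\<in>\<A>. \<forall>d\<in>\<A>. compatible c d)"

definition oriented_atlas :: "(real^'n::finite, 'a) param set \<Rightarrow> bool" where
  "oriented_atlas \<A> \<longleftrightarrow> (\<forall>c\<in>\<A>. \<forall>d\<in>\<A>. \<forall>x\<in>transition_dom c d.
     det (matrix (frechet_derivative (transition c d) (at x))) > 0)"


section \<open>Equiaffine hypersurface theory in a local parametrization\<close>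

text \<open>Throughout this section, \<open>f\<close> maps an open set of \<open>\<real>\<^sup>n\<close> to \<open>\<real>\<^sup>n\<^sup>+\<^sup>1\<close> and
  \<open>\<xi>\<close> is a transverse vector field along \<open>f\<close>. Tangent vectors and vector fields are given by
  their coordinates in \<open>\<real>\<^sup>n\<close>; the push-forward of \<open>Z\<close> at \<open>x\<close> is \<open>dd f x Z\<close>.
  The next two constants are the components of \<open>w = dd f x Z + c \<xi>\<close>.\<close>

definition tangential :: "(real^'n \<Rightarrow> real^'m) \<Rightarrow> (real^'n \<Rightarrow> real^'m) \<Rightarrow> real^'n \<Rightarrow> real^'m \<Rightarrow> real^'n" where
  "tangential f \<xi> x w = (THE Z. \<exists>c. w = dd f x Z + c *\<^sub>R \<xi> x)"

definition transversal :: "(real^'n \<Rightarrow> real^'m) \<Rightarrow> (real^'n \<Rightarrow> real^'m) \<Rightarrow> real^'n \<Rightarrow> real^'m \<Rightarrow> real" where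
  "transversal f \<xi> x w = (THE c. \<exists>Z. w = dd f x Z + c *\<^sub>R \<xi> x)"

text \<open>The formula of Gauss, \<open>D\<^sub>u Y = nabla u Y + h(u,Y) \<xi>\<close>, for a vector field \<open>Y\<close> and a
  tangent vector \<open>u\<close> at \<open>x\<close>. As \<open>h\<close> is tensorial, its second argument is extended to the
  constant coordinate field.\<close>

definition nabla :: "(real^'n \<Rightarrow> real^'m) \<Rightarrow> (real^'n \<Rightarrow> real^'m) \<Rightarrow>
    real^'n \<Rightarrow> real^'n \<Rightarrow> (real^'n \<Rightarrow> real^'n) \<Rightarrow> real^'n" where
  "nabla f \<xi> x u Y = tangential f \<xi> x (dd (\<lambda>y. dd f y (Y y)) x u)"

definition affine_metric :: "(real^'n \<Rightarrow> real^'m) \<Rightarrow> (real^'n \<Rightarrow> real^'m) \<Rightarrow>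
    real^'n \<Rightarrow> real^'n \<Rightarrow> real^'n \<Rightarrow> real" where
  "affine_metric f \<xi> x u v = transversal f \<xi> x (dd (\<lambda>y. dd f y v) x u)"

definition shape_operator :: "(real^'n \<Rightarrow> real^'m) \<Rightarrow> (real^'n \<Rightarrow> real^'m) \<Rightarrow>
    real^'n \<Rightarrow> real^'n \<Rightarrow> real^'n" where
  "shape_operator f \<xi> x u = - tangential f \<xi> x (dd \<xi> x u)"

text \<open>The Levi-Civita connection is the torsion-free metric connection. \<open>christoffel g x u v\<close>
  is its value on the constant coordinate field \<open>v\<close> in direction \<open>u\<close>; such fields commute, so
  torsion-freeness is symmetry.\<close>

definition christoffel :: "(real^'n \<Rightarrow> real^'n \<Rightarrow> real^'n \<Rightarrow> real) \<Rightarrow>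
    real^'n \<Rightarrow> real^'n \<Rightarrow> real^'n \<Rightarrow> real^'n" where
  "christoffel g x = (THE G. bilinear G \<and> (\<forall>u v. G u v = G v u) \<and>
     (\<forall>u v w. dd (\<lambda>y. g y v w) x u = g x (G u v) w + g x v (G u w)))"

definition levi_civita :: "(real^'n \<Rightarrow> real^'n \<Rightarrow> real^'n \<Rightarrow> real) \<Rightarrow>
    real^'n \<Rightarrow> real^'n \<Rightarrow> (real^'n \<Rightarrow> real^'n) \<Rightarrow> real^'n" where
  "levi_civita g x u Y = dd Y x u + christoffel g x u (Y x)"

definition difference_tensor :: "(real^'n \<Rightarrow> real^'m) \<Rightarrow> (real^'n \<Rightarrow> real^'m) \<Rightarrow>
    real^'n \<Rightarrow> real^'n \<Rightarrow> real^'n \<Rightarrow> real^'n" where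
  "difference_tensor f \<xi> x u v =
     nabla f \<xi> x u (\<lambda>_. v) - levi_civita (affine_metric f \<xi>) x u (\<lambda>_. v)"

text \<open>\<open>f\<close> is a nondegenerate immersion with affine normal \<open>\<xi>\<close>. The numeral index types are
  enumerated as \<open>1, \<dots>, n\<close> (with \<open>n = 0\<close> in the type \<open>n\<close>), so the list consists of the
  coordinate fields \<open>\<partial>\<^sub>1 f, \<dots>, \<partial>\<^sub>n f\<close> followed by \<open>\<xi>\<close>. The determinant is taken up to sign,
  as \<open>\<xi>\<close> and \<open>-\<xi>\<close> are both affine normals.\<close>

definition affine_normal :: "(real^'n::{finite,comm_ring_1}) set \<Rightarrow>
    (real^'n::_ \<Rightarrow> real^'m::{finite,comm_ring_1}) \<Rightarrow> (real^'n::_ \<Rightarrow> real^'m::_) \<Rightarrow> bool" where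
  "affine_normal U f \<xi> \<longleftrightarrow>
     open U \<and> smooth_on U f \<and> smooth_on U \<xi> \<and>
     (\<forall>x\<in>U. inj (\<lambda>u. dd f x u) \<and>
        \<xi> x \<notin> range (\<lambda>u. dd f x u) \<and>
        (\<forall>u. dd \<xi> x u \<in> range (\<lambda>v. dd f x v)) \<and>
        det ((\<chi> i j. affine_metric f \<xi> x (axis i 1) (axis j 1)) :: real^'n::_^'n::_) \<noteq> 0 \<and>
        \<bar>det (vector (map (\<lambda>k. dd f x (axis (of_nat k) 1)) [1..<Suc CARD('n)] @ [\<xi> x])
                :: real^'m::_^'m::_)\<bar>
          = sqrt \<bar>det ((\<chi> i j. affine_metric f \<xi> x (axis i 1) (axis j 1)) :: real^'n::_^'n::_)\<bar>)"

definition affine_sphere :: "(real^'n::{finite,comm_ring_1}) set \<Rightarrow>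
    (real^'n::_ \<Rightarrow> real^'m::{finite,comm_ring_1}) \<Rightarrow> (real^'n::_ \<Rightarrow> real^'m::_) \<Rightarrow> real \<Rightarrow> bool" where
  "affine_sphere U f \<xi> H \<longleftrightarrow> affine_normal U f \<xi> \<and>
     (\<forall>x\<in>U. \<forall>u. shape_operator f \<xi> x u = H *\<^sub>R u)"


section \<open>Surfaces in three-space\<close>

definition positive_definite :: "('v::real_vector \<Rightarrow> 'v \<Rightarrow> real) \<Rightarrow> bool" where
  "positive_definite g \<longleftrightarrow> (\<forall>u. u \<noteq> 0 \<longrightarrow> g u u > 0)"

definition elliptic_affine_sphere :: "(real^2) set \<Rightarrow> (real^2 \<Rightarrow> real^3) \<Rightarrow> bool" where
  "elliptic_affine_sphere N f \<longleftrightarrow> (\<exists>\<xi> H. affine_sphere N f \<xi> H \<and>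
     (\<forall>x\<in>N. positive_definite (affine_metric f \<xi> x)) \<and> H > 0)"

definition hyperbolic_affine_sphere :: "(real^2) set \<Rightarrow> (real^2 \<Rightarrow> real^3) \<Rightarrow> bool" where
  "hyperbolic_affine_sphere N f \<longleftrightarrow> (\<exists>\<xi> H. affine_sphere N f \<xi> H \<and>
     (\<forall>x\<in>N. positive_definite (affine_metric f \<xi> x)) \<and> H < 0)"

definition affine_transformation :: "('v::real_vector \<Rightarrow> 'v) \<Rightarrow> bool" where
  "affine_transformation A \<longleftrightarrow> bij A \<and> (\<exists>L b. linear L \<and> A = (\<lambda>x. L x + b))"

definition is_ellipsoid :: "(real^3) set \<Rightarrow> bool" where
  "is_ellipsoid Q \<longleftrightarrow> (\<exists>A. affine_transformation A \<and>
     Q = A ` {x. (x$1)^2 + (x$2)^2 + (x$3)^2 = 1})"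

definition is_two_sheeted_hyperboloid :: "(real^3) set \<Rightarrow> bool" where
  "is_two_sheeted_hyperboloid Q \<longleftrightarrow> (\<exists>A. affine_transformation A \<and>
     Q = A ` {x. (x$1)^2 + (x$2)^2 - (x$3)^2 = -1})"


section \<open>Three-dimensional indefinite affine hyperspheres and their symmetries\<close>

definition lorentz_frame :: "('v \<Rightarrow> 'v \<Rightarrow> real) \<Rightarrow> 'v \<Rightarrow> 'v \<Rightarrow> 'v \<Rightarrow> bool" where
  "lorentz_frame g T V W \<longleftrightarrow> g T T = -1 \<and> g V V = 1 \<and> g W W = 1 \<and>
     g T V = 0 \<and> g T W = 0 \<and> g V W = 0"

text \<open>Existence of a Lorentz frame fixes the sign of \<open>\<xi>\<close>.\<close>

definition indefinite_affine_hypersphere ::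
  "(real^3, 'a) param set \<Rightarrow> ('a \<Rightarrow> real^4) \<Rightarrow> ('a \<Rightarrow> real^4) \<Rightarrow> real \<Rightarrow> bool" where
  "indefinite_affine_hypersphere \<A> \<phi> \<xi> H \<longleftrightarrow> (\<forall>(U, \<psi>)\<in>\<A>.
     affine_sphere U (\<phi> \<circ> \<psi>) (\<xi> \<circ> \<psi>) H \<and>
     (\<forall>x\<in>U. \<exists>T V W. lorentz_frame (affine_metric (\<phi> \<circ> \<psi>) (\<xi> \<circ> \<psi>) x) T V W))"

definition canonical_frame :: "(real^3 \<Rightarrow> real^4) \<Rightarrow> (real^3 \<Rightarrow> real^4) \<Rightarrow> real^3 \<Rightarrow>
    real^3 \<Rightarrow> real^3 \<Rightarrow> real^3 \<Rightarrow> real \<Rightarrow> real \<Rightarrow> bool" where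
  "canonical_frame f \<xi> x T V W \<alpha>4 \<alpha>6 \<longleftrightarrow>
     lorentz_frame (affine_metric f \<xi> x) T V W \<and>
     (let K = difference_tensor f \<xi> x in
        K T T = (-2 * \<alpha>4) *\<^sub>R T \<and>
        K T V = \<alpha>4 *\<^sub>R V \<and>
        K T W = \<alpha>4 *\<^sub>R W \<and>
        K V V = - (\<alpha>4 *\<^sub>R T) + \<alpha>6 *\<^sub>R V \<and>
        K V W = - (\<alpha>6 *\<^sub>R W) \<and>
        K W W = - (\<alpha>4 *\<^sub>R T) - \<alpha>6 *\<^sub>R V)"

definition pointwise_SO2_symmetry ::
  "(real^3, 'a) param set \<Rightarrow> ('a \<Rightarrow> real^4) \<Rightarrow> ('a \<Rightarrow> real^4) \<Rightarrow> bool" where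
  "pointwise_SO2_symmetry \<A> \<phi> \<xi> \<longleftrightarrow> (\<forall>(U, \<psi>)\<in>\<A>. \<forall>x\<in>U. \<exists>T V W \<alpha>4 \<alpha>6.
     canonical_frame (\<phi> \<circ> \<psi>) (\<xi> \<circ> \<psi>) x T V W \<alpha>4 \<alpha>6 \<and> \<alpha>4 > 0 \<and> \<alpha>6 = 0)"

definition pointwise_Z3_symmetry ::
  "(real^3, 'a) param set \<Rightarrow> ('a \<Rightarrow> real^4) \<Rightarrow> ('a \<Rightarrow> real^4) \<Rightarrow> bool" where
  "pointwise_Z3_symmetry \<A> \<phi> \<xi> \<longleftrightarrow> (\<forall>(U, \<psi>)\<in>\<A>. \<forall>x\<in>U. \<exists>T V W \<alpha>4 \<alpha>6.
     canonical_frame (\<phi> \<circ> \<psi>) (\<xi> \<circ> \<psi>) x T V W \<alpha>4 \<alpha>6 \<and> \<alpha>4 > 0 \<and> \<alpha>6 > 0)"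

text \<open>The tensor \<open>K\<close> determines \<open>T\<close> and \<open>a\<^sub>4\<close>, although not \<open>V\<close> and \<open>W\<close>. In \<open>a22\<close>, \<open>V\<close> is a
  unit vector at \<open>x\<close> orthogonal to \<open>T\<close>, on whose choice the value does not depend.\<close>

definition T_field :: "(real^3 \<Rightarrow> real^4) \<Rightarrow> (real^3 \<Rightarrow> real^4) \<Rightarrow> real^3 \<Rightarrow> real^3" where
  "T_field f \<xi> x = (THE T. \<exists>V W \<alpha>4 \<alpha>6. canonical_frame f \<xi> x T V W \<alpha>4 \<alpha>6 \<and> \<alpha>4 > 0 \<and> \<alpha>6 \<ge> 0)"

definition a4 :: "(real^3 \<Rightarrow> real^4) \<Rightarrow> (real^3 \<Rightarrow> real^4) \<Rightarrow> real^3 \<Rightarrow> real" where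
  "a4 f \<xi> x = (THE \<alpha>4. \<exists>T V W \<alpha>6. canonical_frame f \<xi> x T V W \<alpha>4 \<alpha>6 \<and> \<alpha>4 > 0 \<and> \<alpha>6 \<ge> 0)"

definition a22 :: "(real^3 \<Rightarrow> real^4) \<Rightarrow> (real^3 \<Rightarrow> real^4) \<Rightarrow> real^3 \<Rightarrow> real^3 \<Rightarrow> real" where
  "a22 f \<xi> x V =
     affine_metric f \<xi> x (levi_civita (affine_metric f \<xi>) x V (T_field f \<xi>)) V"

text \<open>Around every point, \<open>F\<close> is up to a reparametrization \<open>\<theta>\<close> of the form
  \<open>(t, v) \<mapsto> (\<gamma>\<^sub>1(t), \<gamma>\<^sub>2(t) \<sigma>(v))\<close> with a parametrized surface \<open>\<sigma>\<close> on \<open>N\<close> satisfying \<open>P\<close>.\<close>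

definition locally_curve_times_surface :: "'a topology \<Rightarrow> (real^3, 'a) param set \<Rightarrow>
    ('a \<Rightarrow> real^4) \<Rightarrow> ((real^2) set \<Rightarrow> (real^2 \<Rightarrow> real^3) \<Rightarrow> bool) \<Rightarrow> bool" where
  "locally_curve_times_surface X \<A> F P \<longleftrightarrow>
     (\<forall>p\<in>topspace X. \<exists>(I :: real set) N \<theta> \<gamma>1 \<gamma>2 \<sigma>.
        open I \<and> is_interval I \<and> open N \<and> connected N \<and>
        local_param X (I \<times> N, \<theta>) \<and> (\<forall>c\<in>\<A>. compatible (I \<times> N, \<theta>) c) \<and> p \<in> \<theta> ` (I \<times> N) \<and>
        smooth_on I \<gamma>1 \<and> smooth_on I \<gamma>2 \<and> P N \<sigma> \<and>
        (\<forall>t\<in>I. \<forall>v\<in>N. F (\<theta> (t, v)) =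
           vector [\<gamma>1 t, \<gamma>2 t * \<sigma> v $ 1, \<gamma>2 t * \<sigma> v $ 2, \<gamma>2 t * \<sigma> v $ 3]))"

end

theory Submission
  imports Defs
begin

text \<open>In a frame \<open>(T, V, W)\<close> adapted to \<open>K\<close>, the equations of Gauss and Codazzi force the Levi-Civita
  derivative of \<open>T\<close> in direction \<open>u\<close> to be \<open>n (u + h(u,T) T)\<close> with \<open>n = a\<^sub>2\<^sub>2\<close>, and \<open>n\<close> and \<open>a = a\<^sub>4\<close> to
  vary only in direction \<open>T\<close>. It follows that the derivatives of the vector field \<open>\<nu> = H T + (n + a) \<xi>\<close>
  and of the covector field \<open>\<lambda>\<close> with \<open>\<lambda>(u) = h(u,T)\<close> and \<open>\<lambda>(\<xi>) = n - a\<close> are multiples of \<open>\<nu>\<close> and \<open>\<lambda>\<close>.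
  Here \<open>\<lambda>(\<nu>) = q = n\<^sup>2 - a\<^sup>2 - H\<close>, and \<open>q / \<surd>a\<close> is constant; so \<open>q\<close>, not zero at one point, has no zeros, and \<open>\<real>\<^sup>4\<close> is the direct
  sum of the constant line of \<open>\<nu>\<close> and the constant kernel of \<open>\<lambda>\<close>. The vector \<open>\<eta> = (n - a) T + \<xi>\<close> lies in
  this kernel, and \<open>f - \<eta>/q - (\<lambda>(f)/q) \<nu>\<close> is a constant centre \<open>C\<close>. The component of \<open>f - C\<close> along the line
  serves as the coordinate \<open>t\<close>; the other component is \<open>\<eta>/q\<close>, which moves along a ray when only \<open>t\<close>
  changes, at a logarithmic speed depending only on \<open>t\<close>, and so has the form \<open>\<gamma>(t) \<sigma>(v)\<close>. The surface \<open>\<sigma>\<close>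
  is an affine sphere about the origin, with metric a constant multiple of \<open>h\<close>, elliptic for \<open>q < 0\<close> and
  hyperbolic for \<open>q > 0\<close>. If \<open>a\<^sub>6 = 0\<close>, then \<open>V \<otimes> V + W \<otimes> W - \<eta> \<otimes> \<eta> / q\<close> is constant on the
  slices of fixed \<open>t\<close>, which puts \<open>\<sigma>\<close> on a quadric.\<close>

section \<open>Calculus of smooth maps\<close>

text \<open>The vectors \<open>\<eta>\<close> and \<open>\<nu>\<close> are found on the planes
  orthogonal to \<open>T\<close>. There \<open>D_V V\<close> has \<open>T\<close>-component
  \<open>n\<close> from the Levi-Civita connection and \<open>- a\<close> from \<open>K\<close>, and
  \<open>\<xi>\<close>-component 1, so derivatives of \<open>V, W\<close> leave the plane of
  \<open>V, W\<close> only along \<open>(n - a) T + \<xi>\<close>; \<open>\<lambda>\<close> is the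
  covector that kills \<open>V, W, \<eta>\<close>. Further \<open>D_V T = (n + a) V\<close> and
  \<open>D_V \<xi> = - H V\<close>, which makes \<open>H T + (n + a) \<xi>\<close> constant in these
  directions. Two obstacles shape the proof. The Codazzi equations alone force \<open>T\<close> to
  be geodesic except where \<open>a6 = 2 a4\<close>; that case is excluded only by combining three
  Gauss equations. And \<open>T\<close>, \<open>a4\<close> and the frames are given merely
  pointwise, so before anything can be differentiated their smoothness has to be extracted from
  tensors that are smooth by construction; for \<open>a6 > 0\<close> the direction \<open>V\<close>
  is one of three, and is reached by a rotation through a third of an angle.\<close>

lemma dd_eqI: "(f has_derivative f') (at x) \<Longrightarrow> dd f x u = f' u"
  using frechet_derivative_at by metis

lemma has_derivative_cong_open:
  assumes "open S" "x \<in> S" "\<And>y. y \<in> S \<Longrightarrow> f y = g y" "(f has_derivative f') (at x)"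
  shows "(g has_derivative f') (at x)"
  by (rule has_derivative_transform_within_open[OF assms(4) assms(1,2)]) (rule assms(3))

lemma dd_cong:
  assumes "open S" "x \<in> S" "\<And>y. y \<in> S \<Longrightarrow> f y = g y"
  shows "frechet_derivative f (at x) = frechet_derivative g (at x)"
proof -
  have "(f has_derivative f') (at x) \<longleftrightarrow> (g has_derivative f') (at x)" for f'
    using has_derivative_cong_open[of S x f g f', OF assms]
      has_derivative_cong_open[of S x g f f', OF assms(1,2) assms(3)[symmetric]] by blast
  then show ?thesis
    unfolding frechet_derivative_def by simp
qed

lemma differentiable_has_dd:
  "f differentiable at x \<Longrightarrow> (f has_derivative frechet_derivative f (at x)) (at x)"
  by (simp add: frechet_derivative_works)

lemma Ck_on_cong:
  assumes "open S" "\<And>y. y \<in> S \<Longrightarrow> f y = g y" "Ck_on k S f"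
  shows "Ck_on k S g"
  using assms(2,3)
proof (induction k arbitrary: f g)
  case 0
  then show ?case
    using continuous_on_eq[of S f g] by simp
next
  case (Suc k)
  have "g differentiable at x" if "x \<in> S" for x
  proof -
    have "(f has_derivative frechet_derivative f (at x)) (at x)"
      using Suc that by (simp add: frechet_derivative_works)
    then show ?thesis
      using has_derivative_cong_open[of S x f g] assms(1) that Suc(2)
      unfolding differentiable_def by metis
  qed
  moreover have "Ck_on k S (\<lambda>x. dd g x u)" for u
  proof (rule Suc.IH[of "\<lambda>x. dd f x u"])
    show "dd f y u = dd g y u" if "y \<in> S" for y
      using dd_cong[OF assms(1) that Suc(2)] by simp
  qed (use Suc in auto)
  ultimately show ?case by simp
qed

section \<open>Closure properties of the classes \<open>Ck_on\<close>\<close>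

lemma Ck_on_subset: "Ck_on k S f \<Longrightarrow> T \<subseteq> S \<Longrightarrow> Ck_on k T f"
  by (induction k arbitrary: f) (auto intro: continuous_on_subset)

lemma Ck_on_Suc_imp: "open S \<Longrightarrow> Ck_on (Suc k) S f \<Longrightarrow> Ck_on k S f"
proof (induction k arbitrary: f)
  case 0
  then show ?case
    by (auto simp: continuous_on_eq_continuous_at differentiable_imp_continuous_within)
next
  case (Suc k)
  from Suc.prems have 1: "\<forall>x\<in>S. f differentiable at x"
    and 2: "\<And>u. Ck_on (Suc k) S (\<lambda>x. dd f x u)" by simp_all
  have "Ck_on k S (\<lambda>x. dd f x u)" for u
    using Suc.IH[OF Suc.prems(1) 2] .
  with 1 show ?case by simp
qed

lemma Ck_on_SucI:
  assumes S: "open S" and "\<And>x. x \<in> S \<Longrightarrow> (f has_derivative f' x) (at x)"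
    and "\<And>u. Ck_on k S (\<lambda>x. f' x u)"
  shows "Ck_on (Suc k) S f"
proof -
  have "Ck_on k S (\<lambda>x. dd f x u)" for u
    by (rule Ck_on_cong[OF S _ assms(3)]) (simp add: dd_eqI[OF assms(2)])
  then show ?thesis
    using assms(2) by (auto simp: differentiable_def)
qed

lemma Ck_on_const: "open S \<Longrightarrow> Ck_on k S (\<lambda>x. c)"
  by (induction k arbitrary: c) (auto simp: frechet_derivative_const)

lemma Ck_on_add: "open S \<Longrightarrow> Ck_on k S f \<Longrightarrow> Ck_on k S g \<Longrightarrow> Ck_on k S (\<lambda>x. f x + g x)"
proof (induction k arbitrary: f g)
  case 0
  then show ?case by (simp add: continuous_on_add)
next
  case (Suc k)
  show ?case
    by (rule Ck_on_SucI[OF Suc(2), where f' = "\<lambda>x u. dd f x u + dd g x u"])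
      (use Suc in \<open>auto intro!: has_derivative_add differentiable_has_dd\<close>)
qed

lemma Ck_on_sum:
  assumes "open S" "\<And>i. i \<in> I \<Longrightarrow> Ck_on k S (f i)"
  shows "Ck_on k S (\<lambda>x. \<Sum>i\<in>I. f i x)"
  using assms(2)
  by (induction I rule: infinite_finite_induct)
    (auto intro!: Ck_on_const Ck_on_add assms(1))

lemma Ck_on_bilinear:
  assumes B: "bounded_bilinear B" and S: "open S"
  shows "Ck_on k S f \<Longrightarrow> Ck_on k S g \<Longrightarrow> Ck_on k S (\<lambda>x. B (f x) (g x))"
proof (induction k arbitrary: f g)
  case 0
  then show ?case
    by (simp add: bounded_bilinear.continuous_on[OF B])
next
  case (Suc k)
  have "Ck_on k S f" "Ck_on k S g"
    using Ck_on_Suc_imp[OF S] Suc by blast+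
  then show ?case
    using Suc
    by (intro Ck_on_SucI[OF S, where f' = "\<lambda>x u. B (f x) (dd g x u) + B (dd f x u) (g x)"])
      (auto intro!: bounded_bilinear.FDERIV[OF B] differentiable_has_dd Ck_on_add S)
qed

lemma Ck_on_bounded_linear:
  assumes L: "bounded_linear L" and S: "open S"
  shows "Ck_on k S f \<Longrightarrow> Ck_on k S (\<lambda>x. L (f x))"
proof (induction k arbitrary: f)
  case 0
  then show ?case
    by (simp add: bounded_linear.continuous_on[OF L])
next
  case (Suc k)
  then show ?case
    by (intro Ck_on_SucI[OF S, where f' = "\<lambda>x u. L (dd f x u)"])
      (auto intro!: bounded_linear.has_derivative[OF L] differentiable_has_dd S)
qed

text \<open>\<open>Ck_on\<close> speaks only of derivatives in fixed directions; this expansion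
  reduces a direction that varies with the point to finitely many fixed ones.\<close>

lemma linear_Basis_sum:
  assumes "linear L"
  shows "L v = (\<Sum>b\<in>Basis. (v \<bullet> b) *\<^sub>R L b)"
proof -
  have "L v = L (\<Sum>b\<in>Basis. (v \<bullet> b) *\<^sub>R b)"
    by (simp add: euclidean_representation)
  also have "\<dots> = (\<Sum>b\<in>Basis. (v \<bullet> b) *\<^sub>R L b)"
    using assms by (simp add: linear_sum linear_scale)
  finally show ?thesis .
qed

text \<open>Induction on \<open>k\<close> by the chain rule. The direction \<open>dd g x u\<close>
  varies with \<open>x\<close>, so the derivative is expanded in the basis: the induction hypothesis
  then applies to each \<open>dd f y b\<close>, and the coefficients are components of derivatives
  of \<open>g\<close>.\<close>

lemma Ck_on_compose:
  fixes g :: "'a::euclidean_space \<Rightarrow> 'b::euclidean_space"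
  assumes S: "open S" and T: "open T" and gS: "g ` S \<subseteq> T"
  shows "Ck_on k T f \<Longrightarrow> Ck_on k S g \<Longrightarrow> Ck_on k S (\<lambda>x. f (g x))"
proof (induction k arbitrary: f)
  case 0
  then show ?case
    using continuous_on_compose2 gS by auto
next
  case (Suc k)
  have g: "Ck_on k S g" "\<And>x. x \<in> S \<Longrightarrow> g differentiable at x"
    using Ck_on_Suc_imp[OF S] Suc by auto
  have fT: "f differentiable at (g x)" if "x \<in> S" for x
    using Suc gS that by auto
  show ?case
  proof (rule Ck_on_SucI[OF S, where f' = "\<lambda>x u. \<Sum>b\<in>Basis. (dd g x u \<bullet> b) *\<^sub>R dd f (g x) b"])
    fix x assume x: "x \<in> S"
    have "((\<lambda>x. f (g x)) has_derivative (\<lambda>u. dd f (g x) (dd g x u))) (at x)"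
      using has_derivative_compose[OF differentiable_has_dd[OF g(2)[OF x]] differentiable_has_dd[OF fT[OF x]]]
      by simp
    moreover have "dd f (g x) (dd g x u) = (\<Sum>b\<in>Basis. (dd g x u \<bullet> b) *\<^sub>R dd f (g x) b)" for u
      by (rule linear_Basis_sum) (simp add: fT x linear_frechet_derivative)
    ultimately show "((\<lambda>x. f (g x)) has_derivative
        (\<lambda>u. \<Sum>b\<in>Basis. (dd g x u \<bullet> b) *\<^sub>R dd f (g x) b)) (at x)"
      by simp
  next
    fix u
    have "Ck_on k S (\<lambda>x. dd f (g x) b)" for b
      using Suc.IH[of "\<lambda>y. dd f y b"] Suc.prems g by simp
    moreover have "Ck_on k S (\<lambda>x. dd g x u \<bullet> b)" for b
      using Suc by (intro Ck_on_bounded_linear[OF bounded_linear_inner_left S]) auto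
    ultimately show "Ck_on k S (\<lambda>x. \<Sum>b\<in>Basis. (dd g x u \<bullet> b) *\<^sub>R dd f (g x) b)"
      by (intro Ck_on_sum S Ck_on_bilinear[OF bounded_bilinear_scaleR S])
  qed
qed

lemma smooth_on_differentiable: "smooth_on S f \<Longrightarrow> x \<in> S \<Longrightarrow> f differentiable at x"
  unfolding smooth_on_def by (metis Ck_on.simps(2))

lemma smooth_on_has_dd:
  "smooth_on S f \<Longrightarrow> x \<in> S \<Longrightarrow> (f has_derivative frechet_derivative f (at x)) (at x)"
  by (simp add: smooth_on_differentiable differentiable_has_dd)

lemma smooth_on_linear_dd: "smooth_on S f \<Longrightarrow> x \<in> S \<Longrightarrow> linear (frechet_derivative f (at x))"
  by (simp add: linear_frechet_derivative smooth_on_differentiable)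

lemma smooth_on_dd: "smooth_on S f \<Longrightarrow> smooth_on S (\<lambda>x. dd f x u)"
  unfolding smooth_on_def by (metis Ck_on.simps(2))

lemma smooth_on_continuous: "smooth_on S f \<Longrightarrow> continuous_on S f"
  unfolding smooth_on_def by (metis Ck_on.simps(1))

lemma smooth_on_cong:
  assumes "open S" "\<And>y. y \<in> S \<Longrightarrow> f y = g y" "smooth_on S f"
  shows "smooth_on S g"
  using Ck_on_cong[OF assms(1,2)] assms(3) unfolding smooth_on_def by simp

lemma smooth_on_subset: "smooth_on S f \<Longrightarrow> T \<subseteq> S \<Longrightarrow> smooth_on T f"
  unfolding smooth_on_def using Ck_on_subset by blast

lemma smooth_on_const: "open S \<Longrightarrow> smooth_on S (\<lambda>x. c)"
  by (simp add: smooth_on_def Ck_on_const)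

lemma smooth_on_add:
  "open S \<Longrightarrow> smooth_on S f \<Longrightarrow> smooth_on S g \<Longrightarrow> smooth_on S (\<lambda>x. f x + g x)"
  by (simp add: smooth_on_def Ck_on_add)

lemma smooth_on_sum:
  "open S \<Longrightarrow> (\<And>i. i \<in> I \<Longrightarrow> smooth_on S (f i)) \<Longrightarrow> smooth_on S (\<lambda>x. \<Sum>i\<in>I. f i x)"
  by (simp add: smooth_on_def Ck_on_sum)

lemma smooth_on_bilinear:
  "bounded_bilinear B \<Longrightarrow> open S \<Longrightarrow> smooth_on S f \<Longrightarrow> smooth_on S g \<Longrightarrow> smooth_on S (\<lambda>x. B (f x) (g x))"
  by (simp add: smooth_on_def Ck_on_bilinear)

lemma smooth_on_bounded_linear:
  "bounded_linear L \<Longrightarrow> open S \<Longrightarrow> smooth_on S f \<Longrightarrow> smooth_on S (\<lambda>x. L (f x))"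
  by (simp add: smooth_on_def Ck_on_bounded_linear)

lemma smooth_on_linear:
  fixes L :: "'b::euclidean_space \<Rightarrow> 'c::real_normed_vector"
  shows "linear L \<Longrightarrow> open S \<Longrightarrow> smooth_on S f \<Longrightarrow> smooth_on S (\<lambda>x. L (f x))"
  by (simp add: smooth_on_bounded_linear linear_conv_bounded_linear)

lemma smooth_on_compose:
  fixes g :: "'a::euclidean_space \<Rightarrow> 'b::euclidean_space"
  shows "open S \<Longrightarrow> open T \<Longrightarrow> g ` S \<subseteq> T \<Longrightarrow> smooth_on T f \<Longrightarrow> smooth_on S g \<Longrightarrow>
    smooth_on S (\<lambda>x. f (g x))"
  unfolding smooth_on_def by (simp add: Ck_on_compose)

lemma smooth_on_id: "open S \<Longrightarrow> smooth_on S (\<lambda>x. x)"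
proof -
  assume S: "open S"
  have "Ck_on k S (\<lambda>x. x)" for k
    by (cases k) (auto simp: Ck_on_const S frechet_derivative_ident)
  then show ?thesis
    by (simp add: smooth_on_def)
qed

lemma smooth_on_uminus: "open S \<Longrightarrow> smooth_on S f \<Longrightarrow> smooth_on S (\<lambda>x. - f x)"
  using smooth_on_bounded_linear[OF bounded_linear_minus[OF bounded_linear_ident]] .

lemma smooth_on_diff:
  "open S \<Longrightarrow> smooth_on S f \<Longrightarrow> smooth_on S g \<Longrightarrow> smooth_on S (\<lambda>x. f x - g x)"
  using smooth_on_add[of S f "\<lambda>x. - g x"] smooth_on_uminus[of S g] by simp

lemma smooth_on_scaleR:
  "open S \<Longrightarrow> smooth_on S f \<Longrightarrow> smooth_on S g \<Longrightarrow> smooth_on S (\<lambda>x. f x *\<^sub>R g x)"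
  by (rule smooth_on_bilinear[OF bounded_bilinear_scaleR])

lemma smooth_on_mult:
  fixes f g :: "'a::euclidean_space \<Rightarrow> real"
  shows "open S \<Longrightarrow> smooth_on S f \<Longrightarrow> smooth_on S g \<Longrightarrow> smooth_on S (\<lambda>x. f x * g x)"
  by (rule smooth_on_bilinear[OF bounded_bilinear_mult])

lemma smooth_on_inner:
  "open S \<Longrightarrow> smooth_on S f \<Longrightarrow> smooth_on S g \<Longrightarrow> smooth_on S (\<lambda>x. f x \<bullet> g x)"
  by (rule smooth_on_bilinear[OF bounded_bilinear_inner])

lemma smooth_on_power:
  fixes f :: "'a::euclidean_space \<Rightarrow> real"
  shows "open S \<Longrightarrow> smooth_on S f \<Longrightarrow> smooth_on S (\<lambda>x. f x ^ n)"
  by (induction n) (auto intro: smooth_on_const smooth_on_mult)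

lemma smooth_on_vec_nth:
  "open S \<Longrightarrow> smooth_on S f \<Longrightarrow> smooth_on S (\<lambda>x. f x $ i)"
  using smooth_on_bounded_linear[OF bounded_linear_vec_nth] .

lemma Ck_on_vec_lambda:
  fixes f :: "'i::finite \<Rightarrow> 'a::euclidean_space \<Rightarrow> real"
  assumes S: "open S" and f: "\<And>i. Ck_on k S (f i)"
  shows "Ck_on k S (\<lambda>x. \<chi> i. f i x)"
proof -
  have eq: "(\<lambda>x. \<chi> i. f i x) = (\<lambda>x. \<Sum>i\<in>UNIV. f i x *\<^sub>R axis i 1)"
    by (auto simp: vec_eq_iff fun_eq_iff axis_def if_distrib cong: if_cong)
  show ?thesis
    unfolding eq by (intro Ck_on_sum S Ck_on_bilinear[OF bounded_bilinear_scaleR] Ck_on_const f)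
qed

lemma smooth_on_Pair:
  assumes "open S" "smooth_on S f" "smooth_on S g"
  shows "smooth_on S (\<lambda>x. (f x, g x))"
proof -
  have "bounded_linear (\<lambda>y. (y, 0))" "bounded_linear (\<lambda>y. (0, y))"
    by (intro bounded_linear_Pair bounded_linear_ident bounded_linear_zero)+
  then have "smooth_on S (\<lambda>x. (f x, 0) + (0, g x))"
    by (intro smooth_on_add smooth_on_bounded_linear[of "\<lambda>y. (y, 0)"]
        smooth_on_bounded_linear[of "\<lambda>y. (0, y)"] assms)
  then show ?thesis by simp
qed

lemma smooth_on_dd_var:
  fixes f :: "'a::euclidean_space \<Rightarrow> 'b::real_normed_vector"
  assumes S: "open S" and f: "smooth_on S f" and u: "smooth_on S u"
  shows "smooth_on S (\<lambda>x. dd f x (u x))"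
proof (rule smooth_on_cong[OF S])
  show "smooth_on S (\<lambda>x. \<Sum>b\<in>Basis. (u x \<bullet> b) *\<^sub>R dd f x b)"
    by (intro smooth_on_sum S smooth_on_scaleR smooth_on_inner smooth_on_const u smooth_on_dd f)
  show "(\<Sum>b\<in>Basis. (u y \<bullet> b) *\<^sub>R dd f y b) = dd f y (u y)" if "y \<in> S" for y
    using linear_Basis_sum[OF smooth_on_linear_dd[OF f that]] by metis
qed

section \<open>Elementary real functions\<close>

lemma Ck_on_realI:
  fixes f :: "real \<Rightarrow> real"
  assumes S: "open S" and "\<And>x. x \<in> S \<Longrightarrow> (f has_real_derivative f' x) (at x)" "Ck_on k S f'"
  shows "Ck_on (Suc k) S f"
  using assms
  by (intro Ck_on_SucI[OF S, where f' = "\<lambda>x u. f' x * u"])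
    (auto simp: has_field_derivative_def intro!: Ck_on_bilinear[OF bounded_bilinear_mult S] Ck_on_const)

text \<open>The derivative is a polynomial in the function itself, so the induction feeds on its own
  hypothesis.\<close>

lemma Ck_on_inverse_real: "Ck_on k (- {0}) (inverse :: real \<Rightarrow> real)"
proof (induction k)
  case 0
  then show ?case by (auto intro!: continuous_intros)
next
  case (Suc k)
  have S: "open (- {0::real})" by auto
  have "Ck_on k (- {0}) (\<lambda>x::real. - (inverse x * inverse x))"
    by (rule Ck_on_bounded_linear[OF bounded_linear_minus[OF bounded_linear_ident] S],
        rule Ck_on_bilinear[OF bounded_bilinear_mult S Suc Suc])
  then have *: "Ck_on k (- {0}) (\<lambda>x::real. - (inverse x ^ Suc (Suc 0)))"
    by simp
  show ?case
    by (rule Ck_on_realI[OF S DERIV_inverse *]) simp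
qed

lemma smooth_on_inverse:
  fixes f :: "'a::euclidean_space \<Rightarrow> real"
  assumes "open S" "smooth_on S f" "\<And>x. x \<in> S \<Longrightarrow> f x \<noteq> 0"
  shows "smooth_on S (\<lambda>x. inverse (f x))"
  by (rule smooth_on_compose[OF assms(1) _ _ _ assms(2), where T = "- {0}"])
    (use assms(3) in \<open>auto simp: smooth_on_def Ck_on_inverse_real\<close>)

lemma smooth_on_divide:
  fixes f :: "'a::euclidean_space \<Rightarrow> real"
  assumes "open S" "smooth_on S f" "smooth_on S g" "\<And>x. x \<in> S \<Longrightarrow> g x \<noteq> 0"
  shows "smooth_on S (\<lambda>x. f x / g x)"
  unfolding divide_inverse using assms by (intro smooth_on_mult smooth_on_inverse)

lemma smooth_on_sqrt_real: "smooth_on {0<..} (sqrt :: real \<Rightarrow> real)"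
proof -
  have S: "open {0::real<..}" by auto
  have "Ck_on k {0<..} (sqrt :: real \<Rightarrow> real)" for k
  proof (induction k)
    case 0
    then show ?case by (auto intro!: continuous_intros)
  next
    case (Suc k)
    have "Ck_on k {0<..} (\<lambda>x. inverse (sqrt x))"
      by (rule Ck_on_compose[OF S _ _ Ck_on_inverse_real Suc]) auto
    then have "Ck_on k {0<..} (\<lambda>x. inverse (sqrt x) * (1 / 2))"
      by (intro Ck_on_bilinear[OF bounded_bilinear_mult S] Ck_on_const S)
    then have *: "Ck_on k {0<..} (\<lambda>x. inverse (sqrt x) / 2)"
      by simp
    show ?case
      by (rule Ck_on_realI[OF S DERIV_real_sqrt *]) simp
  qed
  then show ?thesis by (simp add: smooth_on_def)
qed

lemma smooth_on_sqrt:
  fixes f :: "'a::euclidean_space \<Rightarrow> real"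
  assumes "open S" "smooth_on S f" "\<And>x. x \<in> S \<Longrightarrow> f x > 0"
  shows "smooth_on S (\<lambda>x. sqrt (f x))"
  by (rule smooth_on_compose[OF assms(1) _ _ smooth_on_sqrt_real assms(2)]) (use assms(3) in auto)

lemma smooth_on_arctan_real: "smooth_on UNIV (arctan :: real \<Rightarrow> real)"
proof -
  have "1 + x\<^sup>2 \<noteq> 0" for x :: real
    by (smt (verit) zero_le_power2)
  then have "smooth_on UNIV (\<lambda>x::real. inverse (1 + x\<^sup>2))"
    by (intro smooth_on_inverse smooth_on_add smooth_on_power smooth_on_const smooth_on_id open_UNIV)
  then have inv: "Ck_on k UNIV (\<lambda>x::real. inverse (1 + x\<^sup>2))" for k
    by (simp add: smooth_on_def)
  have "Ck_on (Suc k) UNIV (arctan :: real \<Rightarrow> real)" for k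
    by (rule Ck_on_realI[OF open_UNIV DERIV_arctan inv])
  then have "Ck_on k UNIV (arctan :: real \<Rightarrow> real)" for k
    by (rule Ck_on_Suc_imp[OF open_UNIV])
  then show ?thesis
    by (simp add: smooth_on_def)
qed

lemma smooth_on_sin_cos_real: "smooth_on UNIV (sin :: real \<Rightarrow> real) \<and> smooth_on UNIV (cos :: real \<Rightarrow> real)"
proof -
  have "Ck_on k UNIV (sin :: real \<Rightarrow> real) \<and> Ck_on k UNIV (cos :: real \<Rightarrow> real)" for k
  proof (induction k)
    case 0
    then show ?case by (auto intro!: continuous_intros)
  next
    case (Suc k)
    then have "Ck_on k UNIV (\<lambda>x::real. - sin x)"
      by (intro Ck_on_bounded_linear[OF bounded_linear_minus[OF bounded_linear_ident]]) auto
    with Suc have "Ck_on (Suc k) UNIV (sin :: real \<Rightarrow> real)" "Ck_on (Suc k) UNIV (cos :: real \<Rightarrow> real)"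
      using Ck_on_realI[OF open_UNIV DERIV_sin, of k] Ck_on_realI[OF open_UNIV DERIV_cos, of k] by simp_all
    then show ?case by simp
  qed
  then show ?thesis by (simp add: smooth_on_def)
qed

lemma smooth_on_arctan:
  "open S \<Longrightarrow> smooth_on S f \<Longrightarrow> smooth_on S (\<lambda>x::'a::euclidean_space. arctan (f x))"
  by (erule smooth_on_compose[OF _ open_UNIV _ smooth_on_arctan_real]) simp_all

lemma smooth_on_sin:
  "open S \<Longrightarrow> smooth_on S f \<Longrightarrow> smooth_on S (\<lambda>x::'a::euclidean_space. sin (f x :: real))"
  by (erule smooth_on_compose[OF _ open_UNIV _ conjunct1[OF smooth_on_sin_cos_real]]) simp_all

lemma smooth_on_cos:
  "open S \<Longrightarrow> smooth_on S f \<Longrightarrow> smooth_on S (\<lambda>x::'a::euclidean_space. cos (f x :: real))"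
  by (erule smooth_on_compose[OF _ open_UNIV _ conjunct2[OF smooth_on_sin_cos_real]]) simp_all

lemmas smooth_intros =
  smooth_on_const smooth_on_id smooth_on_add smooth_on_diff smooth_on_uminus smooth_on_scaleR
  smooth_on_mult smooth_on_inner smooth_on_power smooth_on_sum smooth_on_vec_nth
  smooth_on_Pair smooth_on_dd smooth_on_dd_var smooth_on_divide smooth_on_sqrt

section \<open>Determinants and linear systems with parameters\<close>

lemma Ck_on_mult:
  fixes f g :: "'a::euclidean_space \<Rightarrow> real"
  shows "open S \<Longrightarrow> Ck_on k S f \<Longrightarrow> Ck_on k S g \<Longrightarrow> Ck_on k S (\<lambda>x. f x * g x)"
  by (rule Ck_on_bilinear[OF bounded_bilinear_mult])

lemma Ck_on_det:
  fixes A :: "'a::euclidean_space \<Rightarrow> real^'n^'n"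
  assumes S: "open S" and A: "\<And>i j. Ck_on k S (\<lambda>x. A x $ i $ j)"
  shows "Ck_on k S (\<lambda>x. det (A x))"
proof -
  have prod: "Ck_on k S (\<lambda>x. \<Prod>i\<in>I. A x $ i $ p i)" for p I
    by (induction I rule: infinite_finite_induct) (simp_all add: Ck_on_const Ck_on_mult S A)
  show ?thesis
    unfolding det_def by (intro Ck_on_sum Ck_on_mult Ck_on_const S prod)
qed

text \<open>By Cramer's rule the solution is a rational expression in the entries of
  \<open>A\<close> and \<open>w\<close>. Objects defined by a unique linear decomposition become
  smooth in this way; the version with fixed \<open>k\<close> is what the bootstrap for inverse
  functions needs.\<close>

lemma Ck_on_linear_solve:
  fixes A :: "'a::euclidean_space \<Rightarrow> real^'n^'n"
  assumes S: "open S" and A: "\<And>i j. Ck_on k S (\<lambda>x. A x $ i $ j)" and w: "\<And>i. Ck_on k S (\<lambda>x. w x $ i)"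
    and det: "\<And>x. x \<in> S \<Longrightarrow> det (A x) \<noteq> 0" and eq: "\<And>x. x \<in> S \<Longrightarrow> A x *v z x = w x"
  shows "Ck_on k S z"
proof (rule Ck_on_cong[OF S])
  show "(\<chi> m. det (\<chi> i j. if j = m then w y $ i else A y $ i $ j) * inverse (det (A y))) = z y"
    if "y \<in> S" for y
    using cramer[OF det[OF that]] eq[OF that] by (simp add: divide_inverse)
  have "Ck_on k S (\<lambda>x. det (\<chi> i j. if j = m then w x $ i else A x $ i $ j))" for m
  proof (rule Ck_on_det[OF S])
    fix i j
    show "Ck_on k S (\<lambda>x. (\<chi> i j. if j = m then w x $ i else A x $ i $ j) $ i $ j)"
      by (cases "j = m") (auto simp: A w)
  qed
  moreover have "Ck_on k S (\<lambda>x. inverse (det (A x)))"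
    by (rule Ck_on_compose[OF S _ _ Ck_on_inverse_real]) (use det in \<open>auto intro!: Ck_on_det S A\<close>)
  ultimately show "Ck_on k S (\<lambda>y. \<chi> m. det (\<chi> i j. if j = m then w y $ i else A y $ i $ j) * inverse (det (A y)))"
    by (intro Ck_on_vec_lambda S Ck_on_mult)
qed

lemma smooth_on_linear_solve:
  fixes A :: "'a::euclidean_space \<Rightarrow> real^'n^'n"
  assumes "open S" "\<And>i j. smooth_on S (\<lambda>x. A x $ i $ j)" "\<And>i. smooth_on S (\<lambda>x. w x $ i)"
    and "\<And>x. x \<in> S \<Longrightarrow> det (A x) \<noteq> 0" "\<And>x. x \<in> S \<Longrightarrow> A x *v z x = w x"
  shows "smooth_on S z"
  unfolding smooth_on_def
proof
  show "Ck_on k S z" for k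
    by (rule Ck_on_linear_solve[where A = A and w = w]) (use assms in \<open>auto simp: smooth_on_def\<close>)
qed

lemma has_derivative_chain:
  assumes "(g has_derivative g') (at x)" "(f has_derivative f') (at y)" "g x = y"
  shows "((\<lambda>x. f (g x)) has_derivative (\<lambda>u. f' (g' u))) (at x)"
  using has_derivative_compose[of g g' x UNIV f f'] assms by simp

lemma dd_bounded_linear:
  assumes "bounded_linear L" "smooth_on S f" "x \<in> S"
  shows "dd (\<lambda>y. L (f y)) x u = L (dd f x u)"
  by (rule dd_eqI[OF bounded_linear.has_derivative[OF assms(1) smooth_on_has_dd[OF assms(2,3)]]])

section \<open>Symmetry of second derivatives\<close>

lemma mvt_along_segment:
  fixes f :: "'a::euclidean_space \<Rightarrow> real"
  assumes f: "smooth_on S f" and h: "h > 0" and seg: "\<And>s. 0 \<le> s \<Longrightarrow> s \<le> h \<Longrightarrow> x + s *\<^sub>R w \<in> S"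
  obtains s where "0 < s" "s < h" "f (x + h *\<^sub>R w) - f x = h * dd f (x + s *\<^sub>R w) w"
proof -
  have d: "((\<lambda>s. f (x + s *\<^sub>R w)) has_real_derivative dd f (x + s *\<^sub>R w) w) (at s)"
    if "0 \<le> s" "s \<le> h" for s
  proof -
    have "((\<lambda>s. f (x + s *\<^sub>R w)) has_derivative (\<lambda>t. dd f (x + s *\<^sub>R w) (t *\<^sub>R w))) (at s)"
      by (rule has_derivative_chain[OF _ smooth_on_has_dd[OF f seg[OF that]]])
        (auto intro!: derivative_eq_intros)
    then show ?thesis
      using linear_scale[OF smooth_on_linear_dd[OF f seg[OF that]]]
      by (simp add: has_field_derivative_def mult.commute[of _ "dd f (x + s *\<^sub>R w) w"])
  qed
  obtain s where "0 < s" "s < h"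
    "f (x + h *\<^sub>R w) - f (x + 0 *\<^sub>R w) = (h - 0) * dd f (x + s *\<^sub>R w) w"
    using MVT2[OF h, of "\<lambda>s. f (x + s *\<^sub>R w)" "\<lambda>s. dd f (x + s *\<^sub>R w) w"] d by blast
  then show ?thesis
    using that by simp
qed

text \<open>Two applications of the mean value theorem to the second difference over a small
  parallelogram express it by either mixed derivative at a nearby point; continuity of both at
  \<open>x\<close> then excludes different values.\<close>

lemma symmetric_second_derivative_real:
  fixes f :: "'a::euclidean_space \<Rightarrow> real"
  assumes S: "open S" and f: "smooth_on S f" and x: "x \<in> S"
  shows "dd (\<lambda>y. dd f y v) x u = dd (\<lambda>y. dd f y u) x v"
proof (rule ccontr)
  let ?F = "\<lambda>u v x. dd (\<lambda>y. dd f y v) x u"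
  have sm: "smooth_on S (?F u v)" for u v
    by (intro smooth_on_dd f)
  obtain r where r: "r > 0" "ball x r \<subseteq> S"
    using S x openE by blast
  have square: "\<exists>y \<in> ball x (h * (norm u + norm v + 1)).
      f (x + h *\<^sub>R u + h *\<^sub>R v) - f (x + h *\<^sub>R v) - f (x + h *\<^sub>R u) + f x = h * h * ?F v u y"
    if h: "h > 0" "h * (norm u + norm v + 1) < r" for h u v
  proof -
    have inb: "x + s *\<^sub>R u + t *\<^sub>R v \<in> ball x (h * (norm u + norm v + 1))"
      if "0 \<le> s" "s \<le> h" "0 \<le> t" "t \<le> h" for s t
    proof -
      have "norm (s *\<^sub>R u + t *\<^sub>R v) \<le> s * norm u + t * norm v"
        using norm_triangle_ineq[of "s *\<^sub>R u" "t *\<^sub>R v"] that by simp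
      also have "\<dots> \<le> h * norm u + h * norm v"
        using that by (intro add_mono mult_right_mono) auto
      also have "\<dots> < h * (norm u + norm v + 1)"
        using h by (simp add: algebra_simps)
      finally have "dist x (x + (s *\<^sub>R u + t *\<^sub>R v)) < h * (norm u + norm v + 1)"
        by (metis add_diff_cancel_left' dist_commute dist_norm)
      then show ?thesis
        by (simp add: add.assoc)
    qed
    have inS: "x + s *\<^sub>R u + t *\<^sub>R v \<in> S" if "0 \<le> s" "s \<le> h" "0 \<le> t" "t \<le> h" for s t
      using inb[OF that] r h by auto
    \<comment> \<open>On this set both \<open>y\<close> and its translate lie in \<open>S\<close>,
      so the first difference is smooth there.\<close>
    let ?S = "S \<inter> (\<lambda>y. y + h *\<^sub>R v) -` S"
    have oS: "open ?S"
      by (intro open_Int S open_vimage) (auto intro!: continuous_intros)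
    have "smooth_on ?S (\<lambda>y. y + h *\<^sub>R v)"
      by (intro smooth_on_add oS smooth_on_const smooth_on_id)
    then have sh: "smooth_on ?S (\<lambda>y. f (y + h *\<^sub>R v))"
      by (rule smooth_on_compose[OF oS S _ f, rotated]) auto
    have g: "smooth_on ?S (\<lambda>y. f (y + h *\<^sub>R v) - f y)"
      by (intro smooth_on_diff oS sh smooth_on_subset[OF f]) auto
    obtain s where s: "0 < s" "s < h"
      "(f (x + h *\<^sub>R u + h *\<^sub>R v) - f (x + h *\<^sub>R u)) - (f (x + h *\<^sub>R v) - f x)
        = h * dd (\<lambda>y. f (y + h *\<^sub>R v) - f y) (x + s *\<^sub>R u) u"
      by (rule mvt_along_segment[OF g h(1), of x u])
        (use inS[of _ 0] inS[of _ h] h in auto)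
    let ?y = "x + s *\<^sub>R u"
    have y: "?y \<in> S" "?y + h *\<^sub>R v \<in> S"
      using inS[of s 0] inS[of s h] s by auto
    have "((\<lambda>y. f (y + h *\<^sub>R v)) has_derivative (\<lambda>w. dd f (?y + h *\<^sub>R v) w)) (at ?y)"
      by (rule has_derivative_chain[OF _ smooth_on_has_dd[OF f y(2)]])
        (auto intro!: derivative_eq_intros)
    then have "dd (\<lambda>y. f (y + h *\<^sub>R v) - f y) ?y u = dd f (?y + h *\<^sub>R v) u - dd f ?y u"
      by (rule dd_eqI[OF has_derivative_diff[OF _ smooth_on_has_dd[OF f y(1)]]])
    moreover obtain t where t: "0 < t" "t < h"
      "dd f (?y + h *\<^sub>R v) u - dd f ?y u = h * ?F v u (?y + t *\<^sub>R v)"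
      by (rule mvt_along_segment[OF smooth_on_dd[OF f] h(1), of ?y v u])
        (use inS[of s] s in auto)
    ultimately show ?thesis
      using s(3) inb[of s t] s(1,2) t by (intro bexI[of _ "?y + t *\<^sub>R v"]) auto
  qed
  assume ne: "?F u v x \<noteq> ?F v u x"
  \<comment> \<open>Half the gap: values within \<open>e\<close> of the two mixed derivatives cannot
    coincide.\<close>
  define e where "e = \<bar>?F u v x - ?F v u x\<bar> / 2"
  have e: "e > 0" using ne by (simp add: e_def)
  have near: "\<exists>d>0. \<forall>y. dist y x < d \<longrightarrow> \<bar>?F u v y - ?F u v x\<bar> < e" for u v
  proof -
    have "continuous (at x) (?F u v)"
      using smooth_on_continuous[OF sm] S x continuous_on_eq_continuous_at by blast
    then show ?thesis
      using e unfolding continuous_at_eps_delta by (simp add: dist_real_def)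
  qed
  obtain d1 d2 where d: "d1 > 0" "\<And>y. dist y x < d1 \<Longrightarrow> \<bar>?F u v y - ?F u v x\<bar> < e"
    "d2 > 0" "\<And>y. dist y x < d2 \<Longrightarrow> \<bar>?F v u y - ?F v u x\<bar> < e"
    using near by metis
  define m where "m = Min {r, d1, d2} / 2"
  have m: "m > 0" "m < r" "m < d1" "m < d2"
    using r d by (auto simp: m_def)
  \<comment> \<open>With this side length the parallelogram stays in the ball of radius
    \<open>m\<close>, where both continuity estimates hold.\<close>
  define h where "h = m / (norm u + norm v + 1)"
  have pos: "norm u + norm v + 1 > 0"
    by (smt (verit) norm_ge_zero)
  have h: "h > 0" "h * (norm u + norm v + 1) = m"
    using m pos by (auto simp: h_def)
  obtain y where y: "y \<in> ball x m"
    "f (x + h *\<^sub>R u + h *\<^sub>R v) - f (x + h *\<^sub>R v) - f (x + h *\<^sub>R u) + f x = h * h * ?F v u y"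
    using square[of h u v] h m by auto
  obtain z where z: "z \<in> ball x m"
    "f (x + h *\<^sub>R v + h *\<^sub>R u) - f (x + h *\<^sub>R u) - f (x + h *\<^sub>R v) + f x = h * h * ?F u v z"
    using square[of h v u] h m by (auto simp: add.commute)
  have "h * h * ?F v u y = h * h * ?F u v z"
    unfolding y(2)[symmetric] z(2)[symmetric] by (simp add: algebra_simps)
  then have "?F v u y = ?F u v z"
    using h by simp
  moreover have "\<bar>?F u v z - ?F u v x\<bar> < e" "\<bar>?F v u y - ?F v u x\<bar> < e"
    using y(1) z(1) m d(2)[of z] d(4)[of y] by (auto simp: dist_commute)
  ultimately show False
    using e unfolding e_def by (smt (verit) field_sum_of_halves)
qed

lemma symmetric_second_derivative:
  fixes f :: "'a::euclidean_space \<Rightarrow> 'b::euclidean_space"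
  assumes S: "open S" and f: "smooth_on S f" and x: "x \<in> S"
  shows "dd (\<lambda>y. dd f y v) x u = dd (\<lambda>y. dd f y u) x v"
proof (rule euclidean_eqI)
  fix b :: 'b
  have fb: "smooth_on S (\<lambda>y. f y \<bullet> b)"
    by (intro smooth_on_inner S f smooth_on_const)
  have 1: "dd (\<lambda>y. f y \<bullet> b) y w = dd f y w \<bullet> b" if "y \<in> S" for y w
    by (rule dd_bounded_linear[OF bounded_linear_inner_left f that])
  have 2: "dd (\<lambda>y. dd (\<lambda>y. f y \<bullet> b) y v) x u = dd (\<lambda>y. dd f y v) x u \<bullet> b" for u v
  proof -
    have "dd (\<lambda>y. dd (\<lambda>y. f y \<bullet> b) y v) x u = dd (\<lambda>y. dd f y v \<bullet> b) x u"
      by (rule fun_cong[OF dd_cong[OF S x 1]])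
    also have "\<dots> = dd (\<lambda>y. dd f y v) x u \<bullet> b"
      by (rule dd_bounded_linear[OF bounded_linear_inner_left smooth_on_dd[OF f] x])
    finally show ?thesis .
  qed
  show "dd (\<lambda>y. dd f y v) x u \<bullet> b = dd (\<lambda>y. dd f y u) x v \<bullet> b"
    using symmetric_second_derivative_real[OF S fb x, of v u] by (simp only: 2)
qed

section \<open>Smooth inverse functions\<close>

lemma continuous_on_blinfun_dd:
  fixes f :: "'a::euclidean_space \<Rightarrow> 'b::real_normed_vector"
  assumes S: "open S" and f: "smooth_on S f"
  shows "continuous_on S (\<lambda>x. Blinfun (frechet_derivative f (at x)))"
proof (rule continuous_on_blinfun_componentwise)
  fix i :: 'a assume "i \<in> Basis"
  show "continuous_on S (\<lambda>x. blinfun_apply (Blinfun (frechet_derivative f (at x))) i)"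
    by (rule continuous_on_eq[OF smooth_on_continuous[OF smooth_on_dd[OF f, of i]]])
      (simp add: bounded_linear_Blinfun_apply has_derivative_bounded_linear[OF smooth_on_has_dd[OF f]])
qed

text \<open>Bootstrap: \<open>g'\<close> solves the linear system with matrix
  \<open>?A (g y)\<close>, so if \<open>g\<close> is \<open>k\<close> times continuously
  differentiable then so is \<open>g'\<close> by \<open>Ck_on_linear_solve\<close>, and
  \<open>g\<close> gains one order.\<close>

lemma smooth_on_inverse_function:
  fixes F :: "real^'n \<Rightarrow> real^'n"
  assumes S: "open S" and F: "smooth_on S F" and T: "open T"
    and g: "continuous_on T g" "g ` T \<subseteq> S" "\<And>y. y \<in> T \<Longrightarrow> F (g y) = y"
    and der: "\<And>y. y \<in> T \<Longrightarrow> (g has_derivative g' y) (at y)"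
    and inj: "\<And>y. y \<in> T \<Longrightarrow> inj (frechet_derivative F (at (g y)))"
  shows "smooth_on T g"
proof -
  let ?A = "\<lambda>x. matrix (frechet_derivative F (at x))"
  have chain: "dd F (g y) (g' y u) = u" if y: "y \<in> T" for y u
  proof -
    have "((\<lambda>y. F (g y)) has_derivative (\<lambda>u. dd F (g y) (g' y u))) (at y)"
      by (rule has_derivative_chain[OF der[OF y] smooth_on_has_dd[OF F]]) (use g y in auto)
    moreover have "((\<lambda>y. F (g y)) has_derivative (\<lambda>u. u)) (at y)"
      using has_derivative_transform_within_open[OF has_derivative_ident T y] g by metis
    ultimately show ?thesis
      using has_derivative_unique by metis
  qed
  have lin: "linear (frechet_derivative F (at (g y)))" if "y \<in> T" for y
    using g that by (intro smooth_on_linear_dd[OF F]) auto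
  have det: "det (?A (g y)) \<noteq> 0" if "y \<in> T" for y
    using det_nz_iff_inj[OF lin[OF that]] inj[OF that] by blast
  have "Ck_on k T g" for k
  proof (induction k)
    case 0
    then show ?case using g by simp
  next
    case (Suc k)
    show ?case
    proof (rule Ck_on_SucI[OF T der])
      fix u
      have "Ck_on k T (\<lambda>y. dd F (g y) (axis j 1) $ i)" for i j
      proof (rule Ck_on_bounded_linear[OF bounded_linear_vec_nth T])
        show "Ck_on k T (\<lambda>y. dd F (g y) (axis j 1))"
          using smooth_on_dd[OF F] by (intro Ck_on_compose[OF T S g(2) _ Suc]) (auto simp: smooth_on_def)
      qed
      then have A: "Ck_on k T (\<lambda>y. ?A (g y) $ i $ j)" for i j
        by (simp add: matrix_def)
      show "Ck_on k T (\<lambda>y. g' y u)"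
        by (rule Ck_on_linear_solve[where w = "\<lambda>y. u", OF T A _ det])
          (simp_all add: matrix_works lin chain Ck_on_const T)
    qed
  qed
  then show ?thesis by (simp add: smooth_on_def)
qed

theorem smooth_inverse_function_theorem:
  fixes F :: "real^'n \<Rightarrow> real^'n"
  assumes S: "open S" and F: "smooth_on S F" and x0: "x0 \<in> S"
    and inj: "inj (frechet_derivative F (at x0))"
  obtains S' T g where "open S'" "S' \<subseteq> S" "x0 \<in> S'" "open T" "homeomorphism S' T F g"
    "smooth_on T g" "\<And>x. x \<in> S' \<Longrightarrow> inj (frechet_derivative F (at x))"
proof -
  let ?f' = "\<lambda>x. Blinfun (frechet_derivative F (at x))"
  have app: "blinfun_apply (?f' x) = frechet_derivative F (at x)" if "x \<in> S" for x
    by (simp add: bounded_linear_Blinfun_apply has_derivative_bounded_linear[OF smooth_on_has_dd[OF F that]])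
  obtain L where L: "linear L" "L \<circ> frechet_derivative F (at x0) = id"
    using linear_injective_left_inverse[OF smooth_on_linear_dd[OF F x0] inj] by blast
  have L': "blinfun_apply (Blinfun L) = L"
    using L by (simp add: bounded_linear_Blinfun_apply linear_conv_bounded_linear)
  have inv: "Blinfun L o\<^sub>L ?f' x0 = id_blinfun"
    using L by (intro blinfun_eqI) (simp add: L' app x0 fun_eq_iff)
  obtain S' T g g' where *: "open S'" "S' \<subseteq> S" "x0 \<in> S'" "open T" "homeomorphism S' T F g"
    "\<And>y. y \<in> T \<Longrightarrow> (g has_derivative (g' y)) (at y)"
    "\<And>y. y \<in> T \<Longrightarrow> bij (blinfun_apply (?f' (g y)))"
  proof (rule inverse_function_theorem[of S F ?f', OF S _ continuous_on_blinfun_dd[OF S F] x0 inv])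
    show "(F has_derivative blinfun_apply (?f' x)) (at x)" if "x \<in> S" for x
      using smooth_on_has_dd[OF F that] app[OF that] by simp
  qed blast
  have g: "g y \<in> S'" "F (g y) = y" if "y \<in> T" for y
    using *(5) that by (auto simp: homeomorphism_def)
  have injT: "inj (frechet_derivative F (at (g y)))" if "y \<in> T" for y
    using *(7)[OF that] app[of "g y"] g(1)[OF that] *(2) by (auto simp: bij_def)
  have "smooth_on T g"
    by (rule smooth_on_inverse_function[OF S F *(4) _ _ g(2) *(6) injT])
      (use *(5) g *(2) in \<open>auto simp: homeomorphism_def\<close>)
  moreover have "inj (frechet_derivative F (at x))" if "x \<in> S'" for x
    using injT[of "F x"] *(5) that by (auto simp: homeomorphism_def)
  ultimately show ?thesis
    using that * by blast
qed

text \<open>The product rule for a linear map and its argument varying together. The hypothesis on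
  \<open>L\<close> concerns fixed arguments only, which suffices in finite dimension; it is applied
  to \<open>df\<close>, to the metric and to projections built from \<open>lamf\<close>.\<close>

lemma linear_family_has_derivative:
  fixes L :: "'a::real_normed_vector \<Rightarrow> 'b::euclidean_space \<Rightarrow> 'c::real_normed_vector"
  assumes S: "open S" "x \<in> S" and lin: "\<And>y. y \<in> S \<Longrightarrow> linear (L y)"
    and L: "\<And>v. ((\<lambda>y. L y v) has_derivative L' v) (at x)"
    and X: "(X has_derivative X') (at x)"
  shows "((\<lambda>y. L y (X y)) has_derivative (\<lambda>u. L' (X x) u + L x (X' u))) (at x)"
proof -
  \<comment> \<open>Linearity of \<open>L'\<close> in \<open>v\<close> is not assumed; it follows
    from that of \<open>L\<close> because derivatives are unique.\<close>
  have 1: "L' v u = (\<Sum>b\<in>Basis. (v \<bullet> b) *\<^sub>R L' b u)" for v u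
  proof -
    have "((\<lambda>y. \<Sum>b\<in>Basis. (v \<bullet> b) *\<^sub>R L y b) has_derivative (\<lambda>u. \<Sum>b\<in>Basis. (v \<bullet> b) *\<^sub>R L' b u)) (at x)"
      by (intro has_derivative_sum has_derivative_scaleR_right L)
    then have "((\<lambda>y. L y v) has_derivative (\<lambda>u. \<Sum>b\<in>Basis. (v \<bullet> b) *\<^sub>R L' b u)) (at x)"
      by (rule has_derivative_cong_open[OF S, rotated]) (metis linear_Basis_sum lin)
    then show ?thesis
      using has_derivative_unique[OF L[of v]] by metis
  qed
  have 2: "L x (X' u) = (\<Sum>b\<in>Basis. (X' u \<bullet> b) *\<^sub>R L x b)" for u
    by (rule linear_Basis_sum[OF lin[OF S(2)]])
  have 3: "(\<Sum>b\<in>Basis. ((X x \<bullet> b) *\<^sub>R L' b u + (X' u \<bullet> b) *\<^sub>R L x b)) = L' (X x) u + L x (X' u)" for u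
    unfolding sum.distrib using 1[of "X x" u] 2[of u] by simp
  have "((\<lambda>y. \<Sum>b\<in>Basis. (X y \<bullet> b) *\<^sub>R L y b) has_derivative
      (\<lambda>u. \<Sum>b\<in>Basis. ((X x \<bullet> b) *\<^sub>R L' b u + (X' u \<bullet> b) *\<^sub>R L x b))) (at x)"
    by (intro has_derivative_sum has_derivative_scaleR has_derivative_inner_left L X)
  then have "((\<lambda>y. \<Sum>b\<in>Basis. (X y \<bullet> b) *\<^sub>R L y b) has_derivative
      (\<lambda>u. L' (X x) u + L x (X' u))) (at x)"
    unfolding 3 .
  then show ?thesis
    by (rule has_derivative_cong_open[OF S, rotated]) (metis linear_Basis_sum lin)
qed

lemma smooth_on_linear_family:
  fixes L :: "'a::euclidean_space \<Rightarrow> 'b::euclidean_space \<Rightarrow> 'c::real_normed_vector"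
  assumes S: "open S" and lin: "\<And>y. y \<in> S \<Longrightarrow> linear (L y)"
    and L: "\<And>v. smooth_on S (\<lambda>y. L y v)" and X: "smooth_on S X"
  shows "smooth_on S (\<lambda>y. L y (X y))"
proof (rule smooth_on_cong[OF S])
  show "smooth_on S (\<lambda>y. \<Sum>b\<in>Basis. (X y \<bullet> b) *\<^sub>R L y b)"
    by (intro smooth_on_sum smooth_on_scaleR smooth_on_inner smooth_on_const S L X)
qed (metis linear_Basis_sum lin)

lemma linear_eq_if_eq_on_axes:
  fixes L L' :: "real^'n \<Rightarrow> 'b::real_vector"
  assumes "linear L" "linear L'" "\<And>i. L (axis i 1) = L' (axis i 1)"
  shows "L v = L' v"
proof -
  have "L = L'"
    using assms by (intro linear_eq_stdbasis) (auto simp: Basis_vec_def)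
  then show ?thesis by simp
qed

lemma linear_axis_sum:
  fixes L :: "real^'n \<Rightarrow> 'b::real_vector"
  assumes "linear L"
  shows "L u = (\<Sum>j\<in>UNIV. u $ j *\<^sub>R L (axis j 1))"
proof -
  have "L u = L (\<Sum>j\<in>UNIV. u $ j *\<^sub>R axis j 1)"
    using basis_expansion[of u] by (simp add: scalar_mult_eq_scaleR)
  then show ?thesis
    by (simp add: linear_sum[OF assms] linear_scale[OF assms])
qed

lemma matrix_mult_linear:
  fixes L :: "real^'n \<Rightarrow> real^'m"
  shows "linear L \<Longrightarrow> matrix L *v u = L u"
  by (simp add: matrix_works)

lemma matrix_inv_right:
  fixes M :: "real^'n^'n"
  assumes "det M \<noteq> 0"
  shows "M ** matrix_inv M = mat 1"
proof -
  have "\<exists>N. M ** N = mat 1 \<and> N ** M = mat 1"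
    using assms invertible_det_nz invertible_def by blast
  then show ?thesis
    unfolding matrix_inv_def by (rule someI2_ex) simp
qed

lemma vector_4 [simp]:
  "(vector [a, b, c, d] :: 'b::zero^4) $ 1 = a" "(vector [a, b, c, d] :: 'b^4) $ 2 = b"
  "(vector [a, b, c, d] :: 'b^4) $ 3 = c" "(vector [a, b, c, d] :: 'b^4) $ 4 = d"
  unfolding vector_def by simp_all

lemma linear_compose2: "linear f \<Longrightarrow> linear g \<Longrightarrow> linear (\<lambda>x. g (f x))"
  using linear_compose[of f g] by (simp add: o_def)

definition vec3 :: "real^4 \<Rightarrow> real^3" where
  "vec3 z = vector [z $ 1, z $ 2, z $ 3]"

lemma vec3_nth [simp]: "vec3 z $ 1 = z $ 1" "vec3 z $ 2 = z $ 2" "vec3 z $ 3 = z $ 3"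
  by (simp_all add: vec3_def vector_3)

lemma linear_vec3: "linear vec3"
  by (rule linearI) (simp_all add: vec_eq_iff forall_3)

lemma vec3_eq_0: "vec3 z = 0 \<Longrightarrow> z $ 4 = 0 \<Longrightarrow> z = 0"
  by (auto simp: vec_eq_iff forall_3 forall_4)


section \<open>Indefinite affine spheres in a chart\<close>

locale affine_sphere_chart =
  fixes U :: "(real^3) set" and f \<xi> :: "real^3 \<Rightarrow> real^4" and H :: real
  assumes sphere: "affine_sphere U f \<xi> H"
begin

lemma open_U: "open U" and smooth_f: "smooth_on U f" and smooth_xi: "smooth_on U \<xi>"
  using sphere by (auto simp: affine_sphere_def affine_normal_def)

lemma inj_df: "x \<in> U \<Longrightarrow> inj (frechet_derivative f (at x))"
  and xi_transverse: "x \<in> U \<Longrightarrow> \<xi> x \<notin> range (frechet_derivative f (at x))"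
  and dxi_tangent: "x \<in> U \<Longrightarrow> dd \<xi> x u \<in> range (frechet_derivative f (at x))"
  and metric_det: "x \<in> U \<Longrightarrow> det (\<chi> i j. affine_metric f \<xi> x (axis i 1) (axis j 1)) \<noteq> 0"
  and shape: "x \<in> U \<Longrightarrow> shape_operator f \<xi> x u = H *\<^sub>R u"
  using sphere by (auto simp: affine_sphere_def affine_normal_def)

lemma linear_df: "x \<in> U \<Longrightarrow> linear (frechet_derivative f (at x))"
  by (rule smooth_on_linear_dd[OF smooth_f])

text \<open>Pairs of a tangent vector and a coefficient of \<open>\<xi>\<close> are packed into
  \<open>real^4\<close>, so that the decomposition of the ambient space along \<open>f\<close>
  becomes a square linear system, to which determinants apply.\<close>

definition frame_map :: "real^3 \<Rightarrow> real^4 \<Rightarrow> real^4" where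
  "frame_map x z = dd f x (vec3 z) + (z $ 4) *\<^sub>R \<xi> x"

lemma linear_frame_map:
  assumes "x \<in> U"
  shows "linear (frame_map x)"
proof -
  have "linear (\<lambda>z. dd f x (vec3 z))"
    using linear_compose[OF linear_vec3 linear_df[OF assms]] by (simp add: o_def)
  moreover have "linear (\<lambda>z::real^4. (z $ 4) *\<^sub>R \<xi> x)"
    by (rule linearI) (simp_all add: algebra_simps)
  ultimately show ?thesis
    unfolding frame_map_def[abs_def] by (rule linear_compose_add)
qed

lemma frame_unique:
  assumes x: "x \<in> U" and eq: "dd f x Z + c *\<^sub>R \<xi> x = dd f x Z' + c' *\<^sub>R \<xi> x"
  shows "Z = Z'" "c = c'"
proof -
  have d: "(c - c') *\<^sub>R \<xi> x = dd f x (Z' - Z)"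
    using eq by (simp add: linear_diff[OF linear_df[OF x]] algebra_simps)
  show c: "c = c'"
  proof (rule ccontr)
    assume "c \<noteq> c'"
    then have "\<xi> x = (1 / (c - c')) *\<^sub>R dd f x (Z' - Z)"
      by (simp add: d[symmetric])
    also have "\<dots> = dd f x ((1 / (c - c')) *\<^sub>R (Z' - Z))"
      by (simp only: linear_scale[OF linear_df[OF x]])
    finally show False
      using xi_transverse[OF x] by blast
  qed
  show "Z = Z'"
    using eq c injD[OF inj_df[OF x]] by simp
qed

lemma inj_frame_map: "x \<in> U \<Longrightarrow> inj (frame_map x)"
proof (subst linear_injective_0[OF linear_frame_map], simp, intro allI impI)
  fix z assume x: "x \<in> U" and "frame_map x z = 0"
  then have "dd f x (vec3 z) + (z $ 4) *\<^sub>R \<xi> x = dd f x 0 + 0 *\<^sub>R \<xi> x"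
    by (simp add: frame_map_def linear_0[OF linear_df])
  from frame_unique[OF x this] show "z = 0"
    by (rule vec3_eq_0)
qed

lemma det_frame_map: "x \<in> U \<Longrightarrow> det (matrix (frame_map x)) \<noteq> 0"
  using det_nz_iff_inj[OF linear_frame_map] inj_frame_map by blast

lemma tangential_transversal_eq:
  assumes "x \<in> U" "w = dd f x Z + c *\<^sub>R \<xi> x"
  shows "tangential f \<xi> x w = Z" "transversal f \<xi> x w = c"
  unfolding tangential_def transversal_def
  using assms frame_unique[OF assms(1)] by (blast intro!: the_equality)+

lemma frame_decomposition:
  assumes x: "x \<in> U"
  shows "w = dd f x (tangential f \<xi> x w) + transversal f \<xi> x w *\<^sub>R \<xi> x"
proof -
  have "surj (frame_map x)"
    by (rule linear_injective_imp_surjective[OF linear_frame_map[OF x] inj_frame_map[OF x]]) (rule refl)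
  then obtain z where "w = frame_map x z"
    by blast
  then have "w = dd f x (vec3 z) + (z $ 4) *\<^sub>R \<xi> x"
    by (simp add: frame_map_def)
  then show ?thesis
    using tangential_transversal_eq[OF x, of w] by metis
qed

text \<open>The components are defined by description, but they solve the linear system with matrix
  \<open>frame_map x\<close>, whose entries are smooth; Cramer's rule does the rest.\<close>

lemma smooth_components:
  assumes w: "smooth_on U w"
  shows "smooth_on U (\<lambda>x. tangential f \<xi> x (w x))" "smooth_on U (\<lambda>x. transversal f \<xi> x (w x))"
proof -
  define z :: "real^3 \<Rightarrow> real^4" where
    "z x = vector [tangential f \<xi> x (w x) $ 1, tangential f \<xi> x (w x) $ 2,
      tangential f \<xi> x (w x) $ 3, transversal f \<xi> x (w x)]" for x
  have z: "vec3 (z x) = tangential f \<xi> x (w x)" "z x $ 4 = transversal f \<xi> x (w x)" for x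
    by (simp_all add: z_def vec_eq_iff forall_3 vector_4)
  have A: "smooth_on U (\<lambda>x. matrix (frame_map x) $ i $ j)" for i j
    unfolding matrix_def frame_map_def
    by (simp, intro smooth_intros open_U smooth_f smooth_xi)
  have eq: "matrix (frame_map x) *v z x = w x" if "x \<in> U" for x
    using frame_decomposition[OF that, of "w x"]
    by (simp add: matrix_mult_linear[OF linear_frame_map[OF that]]) (simp add: frame_map_def z)
  have sz: "smooth_on U z"
    by (rule smooth_on_linear_solve[where w = w and A = "\<lambda>x. matrix (frame_map x)"])
      (simp_all add: open_U A det_frame_map eq smooth_on_vec_nth w)
  show "smooth_on U (\<lambda>x. tangential f \<xi> x (w x))"
    unfolding z(1)[symmetric] by (rule smooth_on_linear[OF linear_vec3 open_U sz])
  show "smooth_on U (\<lambda>x. transversal f \<xi> x (w x))"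
    unfolding z(2)[symmetric] by (rule smooth_on_vec_nth[OF open_U sz])
qed

section \<open>Induced connection, affine metric and difference tensor\<close>

abbreviation "h \<equiv> affine_metric f \<xi>"

text \<open>The Christoffel symbols of the induced connection: its value on the constant field
  \<open>v\<close>.\<close>

definition conn :: "real^3 \<Rightarrow> real^3 \<Rightarrow> real^3 \<Rightarrow> real^3" where
  "conn x u v = tangential f \<xi> x (dd (\<lambda>y. dd f y v) x u)"

lemma gauss_const:
  "x \<in> U \<Longrightarrow> dd (\<lambda>y. dd f y v) x u = dd f x (conn x u v) + h x u v *\<^sub>R \<xi> x"
  unfolding conn_def affine_metric_def by (rule frame_decomposition)

lemma gauss_eqI:
  "x \<in> U \<Longrightarrow> dd (\<lambda>y. dd f y v) x u = dd f x Z + c *\<^sub>R \<xi> x \<Longrightarrow> conn x u v = Z \<and> h x u v = c"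
  unfolding conn_def affine_metric_def using tangential_transversal_eq by blast

lemma conn_metric_sym:
  assumes "x \<in> U"
  shows "conn x u v = conn x v u" "h x u v = h x v u"
  unfolding conn_def affine_metric_def
  using symmetric_second_derivative[OF open_U smooth_f assms, of v u] by simp_all

lemma smooth_conn: "smooth_on U (\<lambda>x. conn x u v)" and smooth_metric: "smooth_on U (\<lambda>x. h x u v)"
  unfolding conn_def affine_metric_def by (intro smooth_components smooth_on_dd smooth_f)+

lemma conn_metric_linear:
  assumes x: "x \<in> U"
  shows "linear (\<lambda>u. conn x u v)" "linear (\<lambda>u. h x u v)"
proof -
  let ?D = "\<lambda>u. dd (\<lambda>y. dd f y v) x u"
  have lin: "linear ?D"
    by (rule smooth_on_linear_dd[OF smooth_on_dd[OF smooth_f] x])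
  note df = linear_df[OF x]
  have add: "conn x (u + u') v = conn x u v + conn x u' v \<and> h x (u + u') v = h x u v + h x u' v" for u u'
    by (rule gauss_eqI[OF x], subst linear_add[OF lin])
      (simp add: gauss_const[OF x] linear_add[OF df] algebra_simps)
  have scale: "conn x (c *\<^sub>R u) v = c *\<^sub>R conn x u v \<and> h x (c *\<^sub>R u) v = c *\<^sub>R h x u v" for c u
    by (rule gauss_eqI[OF x], subst linear_scale[OF lin])
      (simp add: gauss_const[OF x] linear_scale[OF df] algebra_simps)
  show "linear (\<lambda>u. conn x u v)" "linear (\<lambda>u. h x u v)"
    using add scale by (auto intro!: linearI)
qed

lemma bilinear_conn: "x \<in> U \<Longrightarrow> bilinear (conn x)" and bilinear_metric: "x \<in> U \<Longrightarrow> bilinear (h x)"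
proof -
  assume x: "x \<in> U"
  have "conn x u = (\<lambda>v. conn x v u)" "h x u = (\<lambda>v. h x v u)" for u
    using conn_metric_sym[OF x, of u] by blast+
  then have "linear (conn x u)" "linear (h x u)" for u
    using conn_metric_linear[OF x, of u] by metis+
  then show "bilinear (conn x)" "bilinear (h x)"
    unfolding bilinear_def using conn_metric_linear[OF x] by blast+
qed

lemma linear_metric: "x \<in> U \<Longrightarrow> linear (h x u)"
  using bilinear_metric by (simp add: bilinear_def)

lemma dxi: "x \<in> U \<Longrightarrow> dd \<xi> x u = - (H *\<^sub>R dd f x u)"
proof -
  assume x: "x \<in> U"
  obtain Z where Z: "dd \<xi> x u = dd f x Z"
    using dxi_tangent[OF x, of u] by blast
  then have "tangential f \<xi> x (dd \<xi> x u) = Z"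
    by (intro tangential_transversal_eq(1)[OF x, of _ _ 0]) simp
  then have "- Z = H *\<^sub>R u"
    using shape[OF x, of u] by (simp add: shape_operator_def)
  then have "Z = - (H *\<^sub>R u)"
    by (metis minus_minus)
  then show ?thesis
    by (simp add: Z linear_neg[OF linear_df[OF x]] linear_scale[OF linear_df[OF x]])
qed

lemma metric_nondegenerate:
  assumes x: "x \<in> U" and "\<And>v. h x u v = 0"
  shows "u = 0"
proof -
  let ?M = "\<chi> i j. h x (axis i 1) (axis j 1)"
  have "?M *v u = 0"
  proof (rule vec_eq_iff[THEN iffD2], intro allI)
    fix i
    have "h x (axis i 1) u = (\<Sum>j\<in>UNIV. u $ j *\<^sub>R h x (axis i 1) (axis j 1))"
      by (rule linear_axis_sum[OF linear_metric[OF x]])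
    moreover have "h x (axis i 1) u = 0"
      unfolding conn_metric_sym(2)[OF x, of "axis i 1" u] by (rule assms(2))
    ultimately show "(?M *v u) $ i = 0 $ i"
      by (simp add: matrix_vector_mult_def mult.commute)
  qed
  moreover have "inj ((*v) ?M)"
    using metric_det[OF x] invertible_det_nz inj_matrix_vector_mult by blast
  ultimately show ?thesis
    using injD[of "(*v) ?M" u 0] by simp
qed

lemma metric_eqI:
  assumes x: "x \<in> U" and "\<And>w. h x u w = h x v w"
  shows "u = v"
  using metric_nondegenerate[OF x, of "u - v"] assms(2)
  by (simp add: bilinear_lsub[OF bilinear_metric[OF x]])

text \<open>The cubic form \<open>(\<nabla>_u h)(v, w)\<close>, evaluated on constant
  fields.\<close>

definition cubic :: "real^3 \<Rightarrow> real^3 \<Rightarrow> real^3 \<Rightarrow> real^3 \<Rightarrow> real" where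
  "cubic x u v w = dd (\<lambda>y. h y v w) x u - h x (conn x u v) w - h x v (conn x u w)"

lemma smooth_cubic: "smooth_on U (\<lambda>x. cubic x u v w)"
proof -
  have "smooth_on U (\<lambda>x. h x (conn x u v) w)" for u v w
    by (rule smooth_on_linear_family[where L = "\<lambda>x u. h x u w", OF open_U _ smooth_metric smooth_conn])
      (rule conn_metric_linear)
  moreover have "h x v (conn x u w) = h x (conn x u w) v" if "x \<in> U" for x
    by (rule conn_metric_sym[OF that])
  ultimately have "smooth_on U (\<lambda>x. h x v (conn x u w))"
    by (metis (no_types, lifting) smooth_on_cong[OF open_U])
  then show ?thesis
    unfolding cubic_def
    by (intro smooth_on_diff open_U smooth_on_dd smooth_metric \<open>smooth_on U (\<lambda>x. h x (conn x u v) w)\<close>)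
qed

lemma cubic_linear: "x \<in> U \<Longrightarrow> linear (\<lambda>u. cubic x u v w)"
  unfolding cubic_def
proof (intro linear_compose_sub)
  assume x: "x \<in> U"
  note b = bilinear_metric[OF x]
  show "linear (\<lambda>u. dd (\<lambda>y. h y v w) x u)"
    by (rule smooth_on_linear_dd[OF smooth_metric x])
  have *: "linear (\<lambda>u. h x (conn x u v) w)" for v w
    using linear_compose[OF conn_metric_linear(1)[OF x] conn_metric_linear(2)[OF x]]
    by (simp add: o_def)
  show "linear (\<lambda>u. h x (conn x u v) w)"
    by (rule *)
  show "linear (\<lambda>u. h x v (conn x u w))"
    using *[of w v] conn_metric_sym(2)[OF x] by simp
qed

lemma cubic_sym23: "x \<in> U \<Longrightarrow> cubic x u v w = cubic x u w v"
proof -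
  assume x: "x \<in> U"
  have "dd (\<lambda>y. h y v w) x u = dd (\<lambda>y. h y w v) x u"
    using dd_cong[OF open_U x, of "\<lambda>y. h y v w" "\<lambda>y. h y w v"] conn_metric_sym(2) by simp
  then show ?thesis
    using conn_metric_sym(2)[OF x] by (simp add: cubic_def)
qed

text \<open>The equation of Codazzi for the metric is the \<open>\<xi>\<close>-component of the symmetry of the third
  derivatives of \<open>f\<close>.\<close>

lemma cubic_sym12:
  assumes x: "x \<in> U"
  shows "cubic x u v w = cubic x v u w"
proof -
  have third: "dd (\<lambda>y. dd (\<lambda>z. dd f z w) y v) x u =
      dd f x (conn x u (conn x v w) + dd (\<lambda>y. conn y v w) x u - (h x v w * H) *\<^sub>R u) +
      (h x u (conn x v w) + dd (\<lambda>y. h y v w) x u) *\<^sub>R \<xi> x" for u v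
  proof -
    have "((\<lambda>y. dd f y (conn y v w)) has_derivative
        (\<lambda>u. dd (\<lambda>y. dd f y (conn x v w)) x u + dd f x (dd (\<lambda>y. conn y v w) x u))) (at x)"
      by (rule linear_family_has_derivative[OF open_U x linear_df
            smooth_on_has_dd[OF smooth_on_dd[OF smooth_f] x] smooth_on_has_dd[OF smooth_conn x]])
    moreover have "((\<lambda>y. h y v w *\<^sub>R \<xi> y) has_derivative
        (\<lambda>u. h x v w *\<^sub>R dd \<xi> x u + dd (\<lambda>y. h y v w) x u *\<^sub>R \<xi> x)) (at x)"
      by (intro has_derivative_scaleR smooth_on_has_dd[OF _ x] smooth_metric smooth_xi)
    ultimately have "((\<lambda>y. dd f y (conn y v w) + h y v w *\<^sub>R \<xi> y) has_derivative
        (\<lambda>u. (dd (\<lambda>y. dd f y (conn x v w)) x u + dd f x (dd (\<lambda>y. conn y v w) x u)) +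
         (h x v w *\<^sub>R dd \<xi> x u + dd (\<lambda>y. h y v w) x u *\<^sub>R \<xi> x))) (at x)"
      by (rule has_derivative_add)
    then have "((\<lambda>y. dd (\<lambda>z. dd f z w) y v) has_derivative
        (\<lambda>u. (dd (\<lambda>y. dd f y (conn x v w)) x u + dd f x (dd (\<lambda>y. conn y v w) x u)) +
         (h x v w *\<^sub>R dd \<xi> x u + dd (\<lambda>y. h y v w) x u *\<^sub>R \<xi> x))) (at x)"
      by (rule has_derivative_cong_open[OF open_U x, rotated]) (simp add: gauss_const)
    then have "dd (\<lambda>y. dd (\<lambda>z. dd f z w) y v) x u =
        (dd (\<lambda>y. dd f y (conn x v w)) x u + dd f x (dd (\<lambda>y. conn y v w) x u)) +
         (h x v w *\<^sub>R dd \<xi> x u + dd (\<lambda>y. h y v w) x u *\<^sub>R \<xi> x)"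
      by (rule dd_eqI)
    also have "\<dots> = dd f x (conn x u (conn x v w) + dd (\<lambda>y. conn y v w) x u - (h x v w * H) *\<^sub>R u) +
      (h x u (conn x v w) + dd (\<lambda>y. h y v w) x u) *\<^sub>R \<xi> x"
      using linear_df[OF x]
      by (simp add: gauss_const[OF x] dxi[OF x] linear_add linear_diff linear_scale algebra_simps)
    finally show ?thesis .
  qed
  have "dd (\<lambda>y. dd (\<lambda>z. dd f z w) y v) x u = dd (\<lambda>y. dd (\<lambda>z. dd f z w) y u) x v"
    by (rule symmetric_second_derivative[OF open_U smooth_on_dd[OF smooth_f] x])
  then have "h x u (conn x v w) + dd (\<lambda>y. h y v w) x u = h x v (conn x u w) + dd (\<lambda>y. h y u w) x v"
    unfolding third by (rule frame_unique(2)[OF x])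
  then show ?thesis
    using conn_metric_sym[OF x] by (simp add: cubic_def)
qed

text \<open>The difference tensor in the form \<open>h(K(u,v), w) = - C(u,v,w) / 2\<close>, with
  \<open>C\<close> the cubic form, solved for \<open>K\<close> by inverting the Gram matrix. Unlike
  \<open>difference_tensor\<close> it does not presuppose a Levi-Civita connection; on the contrary,
  \<open>conn\<close> minus \<open>ktensor\<close> will be shown to be that connection.\<close>

definition ktensor :: "real^3 \<Rightarrow> real^3 \<Rightarrow> real^3 \<Rightarrow> real^3" where
  "ktensor x u v = matrix_inv (\<chi> i j. h x (axis i 1) (axis j 1)) *v (\<chi> i. - cubic x u v (axis i 1) / 2)"

lemma metric_ktensor:
  assumes x: "x \<in> U"
  shows "h x (ktensor x u v) w = - cubic x u v w / 2"
proof -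
  let ?M = "\<chi> i j. h x (axis i 1) (axis j 1)" and ?k = "ktensor x u v"
  have M: "?M *v ?k = (\<chi> i. - cubic x u v (axis i 1) / 2)"
    by (simp add: ktensor_def matrix_vector_mul_assoc matrix_inv_right metric_det[OF x])
  have e: "h x ?k (axis i 1) = - cubic x u v (axis i 1) / 2" for i
  proof -
    have "h x (axis i 1) ?k = (?M *v ?k) $ i"
      by (simp add: linear_axis_sum[OF linear_metric[OF x], of _ ?k] matrix_vector_mult_def mult.commute)
    then show ?thesis
      by (simp add: M conn_metric_sym(2)[OF x, of ?k])
  qed
  have "cubic x u v w = cubic x w u v" for w
    using cubic_sym23[OF x] cubic_sym12[OF x] by metis
  then have "linear (\<lambda>w. cubic x u v w)"
    using cubic_linear[OF x] by simp
  then have "linear (\<lambda>w. (- 1 / 2) *\<^sub>R cubic x u v w)"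
    by (rule linear_compose_scale_right)
  then have "linear (\<lambda>w. - cubic x u v w / 2)"
    by simp
  then show ?thesis
    using linear_eq_if_eq_on_axes[OF linear_metric[OF x]] e by blast
qed

lemma smooth_ktensor: "smooth_on U (\<lambda>x. ktensor x u v)"
proof (rule smooth_on_linear_solve[where A = "\<lambda>x. \<chi> i j. h x (axis i 1) (axis j 1)"
      and w = "\<lambda>x. \<chi> i. - cubic x u v (axis i 1) / 2"])
  show "smooth_on U (\<lambda>x. (\<chi> i. - cubic x u v (axis i 1) / 2) $ i)" for i
  proof -
    have "smooth_on U (\<lambda>x. - cubic x u v (axis i 1) * (1 / 2))"
      by (intro smooth_intros open_U smooth_cubic)
    then show ?thesis by simp
  qed
  show "(\<chi> i j. h x (axis i 1) (axis j 1)) *v ktensor x u v = (\<chi> i. - cubic x u v (axis i 1) / 2)"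
    if "x \<in> U" for x
    by (simp add: ktensor_def matrix_vector_mul_assoc matrix_inv_right metric_det[OF that])
qed (simp_all add: open_U smooth_metric metric_det)

lemma metric_ktensor_right: "x \<in> U \<Longrightarrow> h x v (ktensor x u w) = - cubic x u v w / 2"
  using metric_ktensor[of x u w v] cubic_sym23[of x u w v] conn_metric_sym(2)[of x v "ktensor x u w"]
  by simp

lemma ktensor_sym:
  assumes "x \<in> U"
  shows "ktensor x u v = ktensor x v u"
  by (rule metric_eqI[OF assms]) (simp add: metric_ktensor[OF assms] cubic_sym12[OF assms, of u v])

lemma ktensor_metric_sym:
  "x \<in> U \<Longrightarrow> h x (ktensor x u v) w = h x (ktensor x u w) v"
  by (simp add: metric_ktensor cubic_sym23[of x u v])

lemma bilinear_ktensor: "x \<in> U \<Longrightarrow> bilinear (ktensor x)"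
proof -
  assume x: "x \<in> U"
  note b = bilinear_metric[OF x]
  have "linear (\<lambda>u. ktensor x u v)" for v
  proof (rule linearI)
    show "ktensor x (u + u') v = ktensor x u v + ktensor x u' v" for u u'
      by (rule metric_eqI[OF x])
        (simp add: metric_ktensor[OF x] bilinear_ladd[OF b] linear_add[OF cubic_linear[OF x]] field_simps)
    show "ktensor x (c *\<^sub>R u) v = c *\<^sub>R ktensor x u v" for c u
      by (rule metric_eqI[OF x])
        (simp add: metric_ktensor[OF x] bilinear_lmul[OF b] linear_scale[OF cubic_linear[OF x]])
  qed
  moreover have "ktensor x u = (\<lambda>v. ktensor x v u)" for u
    using ktensor_sym[OF x, of u] by blast
  ultimately show ?thesis
    by (metis bilinear_def)
qed

text \<open>Subtracting \<open>K\<close> from the induced connection keeps it torsion-free, and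
  makes it metric because \<open>K\<close> absorbs half of the cubic form in either argument.
  Existence of the Levi-Civita connection thus needs no Koszul formula.\<close>

lemma christoffel_eq:
  assumes x: "x \<in> U"
  shows "christoffel h x = (\<lambda>u v. conn x u v - ktensor x u v)"
  unfolding christoffel_def
proof (rule the_equality)
  note b = bilinear_metric[OF x]
  let ?G = "\<lambda>u v. conn x u v - ktensor x u v"
  have metric: "dd (\<lambda>y. h y v w) x u = h x (?G u v) w + h x v (?G u w)" for u v w
  proof -
    have "h x (?G u v) w + h x v (?G u w) =
        h x (conn x u v) w + h x v (conn x u w) + cubic x u v w"
      by (simp add: bilinear_lsub[OF b] bilinear_rsub[OF b] metric_ktensor[OF x] metric_ktensor_right[OF x])
    then show ?thesis
      by (simp add: cubic_def)
  qed
  have "bilinear ?G"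
    using bilinear_conn[OF x] bilinear_ktensor[OF x]
    by (auto simp: bilinear_def intro!: linear_compose_sub)
  then show G: "bilinear ?G \<and> (\<forall>u v. ?G u v = ?G v u) \<and>
     (\<forall>u v w. dd (\<lambda>y. h y v w) x u = h x (?G u v) w + h x v (?G u w))"
    using metric conn_metric_sym(1)[OF x] ktensor_sym[OF x] by simp
  fix G'
  assume G': "bilinear G' \<and> (\<forall>u v. G' u v = G' v u) \<and>
     (\<forall>u v w. dd (\<lambda>y. h y v w) x u = h x (G' u v) w + h x v (G' u w))"
  define d where "d u v w = h x (G' u v) w - h x (?G u v) w" for u v w
  have d1: "d u v w = d v u w" for u v w
    using G G' by (simp add: d_def)
  have d2: "d u v w = - d u w v" for u v w
  proof -
    have "h x (?G u v) w + h x v (?G u w) = h x (G' u v) w + h x v (G' u w)"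
      using metric[of v w u] G' by metis
    then show ?thesis
      by (simp add: d_def conn_metric_sym(2)[OF x, of v])
  qed
  \<comment> \<open>Symmetric in the first two arguments and skew in the last two: six alternating
    exchanges, three of them skew, return the same expression with the opposite sign.\<close>
  have "d u v w = 0" for u v w
    using d1 d2 by (smt (verit))
  then show "G' = ?G"
    by (intro ext metric_eqI[OF x]) (simp add: d_def)
qed

lemma difference_tensor_eq: "x \<in> U \<Longrightarrow> difference_tensor f \<xi> x u v = ktensor x u v"
  by (simp add: difference_tensor_def nabla_def levi_civita_def christoffel_eq conn_def[symmetric])

lemma levi_civita_eq:
  "x \<in> U \<Longrightarrow> levi_civita h x u X = dd X x u + (conn x u (X x) - ktensor x u (X x))"
  by (simp add: levi_civita_def christoffel_eq)

lemma gauss: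
  assumes x: "x \<in> U" and X: "(X has_derivative X') (at x)"
  shows "((\<lambda>y. dd f y (X y)) has_derivative
    (\<lambda>u. dd f x (levi_civita h x u X + ktensor x u (X x)) + h x u (X x) *\<^sub>R \<xi> x)) (at x)"
proof -
  have "((\<lambda>y. dd f y (X y)) has_derivative (\<lambda>u. dd (\<lambda>y. dd f y (X x)) x u + dd f x (X' u))) (at x)"
    by (rule linear_family_has_derivative[OF open_U x linear_df smooth_on_has_dd[OF smooth_on_dd[OF smooth_f] x] X])
  then show ?thesis
    using dd_eqI[OF X]
    by (simp add: gauss_const[OF x] levi_civita_eq[OF x] linear_add[OF linear_df[OF x]] algebra_simps)
qed

lemma metric_derivative:
  assumes x: "x \<in> U" and X: "(X has_derivative X') (at x)" and Y: "(Y has_derivative Y') (at x)"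
  shows "((\<lambda>y. h y (X y) (Y y)) has_derivative
    (\<lambda>u. h x (levi_civita h x u X) (Y x) + h x (X x) (levi_civita h x u Y))) (at x)"
proof -
  note b = bilinear_metric[OF x]
  have 1: "((\<lambda>y. h y (X y) w) has_derivative (\<lambda>u. dd (\<lambda>y. h y (X x) w) x u + h x (X' u) w)) (at x)" for w
    by (rule linear_family_has_derivative[where L = "\<lambda>y u. h y u w",
          OF open_U x conn_metric_linear(2) smooth_on_has_dd[OF smooth_metric x] X])
  have "((\<lambda>y. h y (X y) (Y y)) has_derivative
      (\<lambda>u. (dd (\<lambda>y. h y (X x) (Y x)) x u + h x (X' u) (Y x)) + h x (X x) (Y' u))) (at x)"
    by (rule linear_family_has_derivative[where L = "\<lambda>y. h y (X y)", OF open_U x linear_metric 1 Y])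
  moreover have "dd (\<lambda>y. h y v w) x u =
      h x (conn x u v - ktensor x u v) w + h x v (conn x u w - ktensor x u w)" for u v w
    by (simp add: bilinear_lsub[OF b] bilinear_rsub[OF b] metric_ktensor[OF x] metric_ktensor_right[OF x]
        cubic_def)
  ultimately show ?thesis
    by (simp add: levi_civita_eq[OF x] dd_eqI[OF X] dd_eqI[OF Y] bilinear_ladd[OF b] bilinear_radd[OF b]
        ac_simps)
qed

end

lemma smooth_on_local:
  assumes "\<And>x. x \<in> S \<Longrightarrow> \<exists>O'. open O' \<and> x \<in> O' \<and> smooth_on O' f"
  shows "smooth_on S f"
proof -
  have loc: "Ck_on k S g" if "\<And>x. x \<in> S \<Longrightarrow> \<exists>O'. open O' \<and> x \<in> O' \<and> Ck_on k O' g" for k and g :: "'a \<Rightarrow> 'b"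
    using that
  proof (induction k arbitrary: g)
    case 0
    have "continuous (at x within S) g" if "x \<in> S" for x
      using 0[OF that] by (auto simp: continuous_on_eq_continuous_at intro: continuous_at_imp_continuous_at_within)
    then show ?case
      by (simp add: continuous_on_eq_continuous_within)
  next
    case (Suc k)
    have "g differentiable at x" if "x \<in> S" for x
      using Suc.prems[OF that] by auto
    moreover have "Ck_on k S (\<lambda>x. dd g x u)" for u
      by (rule Suc.IH) (use Suc.prems in force)
    ultimately show ?case
      by simp
  qed
  have "Ck_on k S f" for k
  proof (rule loc)
    fix x assume "x \<in> S"
    then obtain O' where "open O'" "x \<in> O'" "smooth_on O' f"
      using assms by blast
    then show "\<exists>O'. open O' \<and> x \<in> O' \<and> Ck_on k O' f"
      unfolding smooth_on_def by blast
  qed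
  then show ?thesis
    by (simp add: smooth_on_def)
qed

lemma open_superlevel:
  fixes \<phi> :: "'a::topological_space \<Rightarrow> real"
  assumes "open S" "continuous_on S \<phi>"
  shows "open {x \<in> S. 0 < \<phi> x}"
proof -
  have "{x \<in> S. 0 < \<phi> x} = S \<inter> \<phi> -` {0<..}"
    by auto
  then show ?thesis
    using continuous_open_preimage[OF assms(2,1), of "{0<..}"] by simp
qed

text \<open>Contraction with the inverse metric, computed in an orthonormal frame whose timelike
  vector comes first.\<close>

definition lorentz_trace ::
    "('v \<Rightarrow> 'v \<Rightarrow> 'b::real_vector) \<Rightarrow> 'v \<Rightarrow> 'v \<Rightarrow> 'v \<Rightarrow> 'b" where
  "lorentz_trace B E0 E1 E2 = - B E0 E0 + B E1 E1 + B E2 E2"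

lemma (in affine_sphere_chart) lorentz_expansion:
  assumes x: "x \<in> U" and E: "lorentz_frame (h x) E0 E1 E2"
  shows "u = - (h x u E0 *\<^sub>R E0) + h x u E1 *\<^sub>R E1 + h x u E2 *\<^sub>R E2"
proof -
  note b = bilinear_metric[OF x]
  note hsimps = bilinear_ladd[OF b] bilinear_radd[OF b] bilinear_lmul[OF b] bilinear_rmul[OF b]
    bilinear_lneg[OF b] bilinear_rneg[OF b] bilinear_lsub[OF b]
  have Eh: "h x E0 E0 = -1" "h x E1 E1 = 1" "h x E2 E2 = 1" "h x E0 E1 = 0" "h x E0 E2 = 0" "h x E1 E2 = 0"
    "h x E1 E0 = 0" "h x E2 E0 = 0" "h x E2 E1 = 0"
    using E conn_metric_sym(2)[OF x, of E1 E0] conn_metric_sym(2)[OF x, of E2 E0]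
      conn_metric_sym(2)[OF x, of E2 E1] by (simp_all add: lorentz_frame_def)
  let ?L = "\<lambda>c::real^3. c $ 1 *\<^sub>R E0 + c $ 2 *\<^sub>R E1 + c $ 3 *\<^sub>R E2"
  have lin: "linear ?L"
    by (rule linearI) (simp_all add: algebra_simps)
  have "inj ?L"
  proof (rule linear_injective_0[OF lin, THEN iffD2], intro allI impI)
    fix c assume c: "?L c = 0"
    have "h x (?L c) E0 = 0" "h x (?L c) E1 = 0" "h x (?L c) E2 = 0"
      by (simp_all add: c bilinear_lzero[OF b])
    then show "c = 0"
      by (simp add: hsimps Eh vec_eq_iff forall_3)
  qed
  then have "surj ?L"
    by (rule linear_injective_imp_surjective[OF lin]) (rule refl)
  then have "\<exists>c. u = ?L c"
    by (rule surjD)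
  then obtain c where "u = ?L c" ..
  then show ?thesis
    by (simp add: hsimps Eh)
qed

text \<open>Expanding the first argument of \<open>B\<close> in the frame \<open>E\<close> and the
  second in \<open>F\<close> turns both traces into the same signed double sum of terms
  \<open>h(F i, E j) B(E j, F i)\<close>.\<close>

lemma (in affine_sphere_chart) lorentz_trace_independent:
  assumes x: "x \<in> U" and E: "lorentz_frame (h x) E0 E1 E2" and F: "lorentz_frame (h x) F0 F1 F2"
    and B: "bilinear B"
  shows "lorentz_trace B F0 F1 F2 = lorentz_trace B E0 E1 E2"
proof -
  note bl = bilinear_ladd[OF B] bilinear_lmul[OF B] bilinear_lneg[OF B]
  note br = bilinear_radd[OF B] bilinear_rmul[OF B] bilinear_rneg[OF B]
  have l: "B u v = - (h x u E0 *\<^sub>R B E0 v) + h x u E1 *\<^sub>R B E1 v + h x u E2 *\<^sub>R B E2 v" for u v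
  proof -
    have "B u v = B (- (h x u E0 *\<^sub>R E0) + h x u E1 *\<^sub>R E1 + h x u E2 *\<^sub>R E2) v"
      using lorentz_expansion[OF x E, of u] by (rule arg_cong[where f = "\<lambda>z. B z v"])
    also have "\<dots> = - (h x u E0 *\<^sub>R B E0 v) + h x u E1 *\<^sub>R B E1 v + h x u E2 *\<^sub>R B E2 v"
      by (simp only: bl)
    finally show ?thesis .
  qed
  have r: "B v u = - (h x F0 u *\<^sub>R B v F0) + h x F1 u *\<^sub>R B v F1 + h x F2 u *\<^sub>R B v F2" for u v
  proof -
    have "B v u = B v (- (h x F0 u *\<^sub>R F0) + h x F1 u *\<^sub>R F1 + h x F2 u *\<^sub>R F2)"
      unfolding conn_metric_sym(2)[OF x, of F0 u] conn_metric_sym(2)[OF x, of F1 u] conn_metric_sym(2)[OF x, of F2 u] using lorentz_expansion[OF x F, of u] by (rule arg_cong[where f = "\<lambda>z. B v z"])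
    also have "\<dots> = - (h x F0 u *\<^sub>R B v F0) + h x F1 u *\<^sub>R B v F1 + h x F2 u *\<^sub>R B v F2"
      by (simp only: br)
    finally show ?thesis .
  qed
  show ?thesis
    unfolding lorentz_trace_def l[of F0 F0] l[of F1 F1] l[of F2 F2] r[of E0 E0] r[of E1 E1] r[of E2 E2]
    by (simp add: algebra_simps)
qed

section \<open>Lorentz frames and a timelike direction extracted from \<open>K\<close>\<close>

context affine_sphere_chart
begin

lemma smooth_metric_fields:
  assumes "open S" "S \<subseteq> U" "smooth_on S X" "smooth_on S Y"
  shows "smooth_on S (\<lambda>x. h x (X x) (Y x))"
proof (rule smooth_on_linear_family[OF assms(1) _ _ assms(4)])
  show "linear (h y (X y))" if "y \<in> S" for y
    using linear_metric assms(2) that by blast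
  show "smooth_on S (\<lambda>y. h y (X y) v)" for v
    by (rule smooth_on_linear_family[where L = "\<lambda>y u. h y u v", OF assms(1) _ _ assms(3)])
      (use conn_metric_linear(2) assms(2) smooth_on_subset[OF smooth_metric assms(2)] in blast)+
qed

lemma smooth_ktensor_fields:
  assumes "open S" "S \<subseteq> U" "smooth_on S X" "smooth_on S Y"
  shows "smooth_on S (\<lambda>x. ktensor x (X x) (Y x))"
proof (rule smooth_on_linear_family[OF assms(1) _ _ assms(4)])
  show "linear (ktensor y (X y))" if "y \<in> S" for y
    using bilinear_ktensor assms(2) that unfolding bilinear_def by blast
  show "smooth_on S (\<lambda>y. ktensor y (X y) v)" for v
    by (rule smooth_on_linear_family[where L = "\<lambda>y u. ktensor y u v", OF assms(1) _ _ assms(3)])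
      (use bilinear_ktensor assms(2) smooth_on_subset[OF smooth_ktensor assms(2)] in
        \<open>unfold bilinear_def, blast\<close>)+
qed

text \<open>Contracting \<open>K\<close> with its own trace form \<open>tr (K\<^sub>u K\<^sub>v)\<close> gives a vector
  which, for a canonical frame, is a negative multiple of \<open>T\<close>.\<close>

definition killing :: "real^3 \<Rightarrow> real^3 \<Rightarrow> real^3 \<Rightarrow> real^3 \<Rightarrow> real^3 \<Rightarrow> real^3 \<Rightarrow> real" where
  "killing x E0 E1 E2 u v = lorentz_trace (\<lambda>l m. h x (ktensor x u l) (ktensor x v m)) E0 E1 E2"

definition kvector :: "real^3 \<Rightarrow> real^3 \<Rightarrow> real^3 \<Rightarrow> real^3 \<Rightarrow> real^3" where
  "kvector x E0 E1 E2 = lorentz_trace (\<lambda>i k. lorentz_trace (\<lambda>j l.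
     killing x E0 E1 E2 i j *\<^sub>R ktensor x k l) E0 E1 E2) E0 E1 E2"

text \<open>This lets the same vector be evaluated in a canonical frame, where it is explicit, and
  in an arbitrary smooth frame, where it is smooth.\<close>

lemma kvector_independent:
  assumes x: "x \<in> U" and E: "lorentz_frame (h x) E0 E1 E2" and F: "lorentz_frame (h x) F0 F1 F2"
  shows "kvector x F0 F1 F2 = kvector x E0 E1 E2"
proof -
  note b = bilinear_metric[OF x] note k = bilinear_ktensor[OF x]
  note bs = bilinear_ladd[OF b] bilinear_radd[OF b] bilinear_lmul[OF b] bilinear_rmul[OF b]
    bilinear_ladd[OF k] bilinear_radd[OF k] bilinear_lmul[OF k] bilinear_rmul[OF k]
  have 1: "killing x F0 F1 F2 u v = killing x E0 E1 E2 u v" for u v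
    unfolding killing_def
    by (rule lorentz_trace_independent[OF x E F])
      (auto simp: bilinear_def bs algebra_simps intro!: linearI)
  have k: "bilinear (killing x E0 E1 E2)"
    by (auto simp: bilinear_def killing_def lorentz_trace_def bs algebra_simps intro!: linearI)
  note ks = bilinear_ladd[OF k] bilinear_radd[OF k] bilinear_lmul[OF k] bilinear_rmul[OF k]
  have 2: "lorentz_trace (\<lambda>j l. killing x E0 E1 E2 u j *\<^sub>R ktensor x v l) F0 F1 F2 =
      lorentz_trace (\<lambda>j l. killing x E0 E1 E2 u j *\<^sub>R ktensor x v l) E0 E1 E2" for u v
    by (rule lorentz_trace_independent[OF x E F])
      (auto simp: bilinear_def bs ks algebra_simps intro!: linearI)
  show ?thesis
    unfolding kvector_def 1 2
    by (rule lorentz_trace_independent[OF x E F])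
      (auto simp: bilinear_def bs ks lorentz_trace_def algebra_simps intro!: linearI)
qed

lemma canonical_frameD:
  assumes x: "x \<in> U" and c: "canonical_frame f \<xi> x T V W a s"
  shows "lorentz_frame (h x) T V W"
    "ktensor x T T = (-2 * a) *\<^sub>R T" "ktensor x T V = a *\<^sub>R V" "ktensor x T W = a *\<^sub>R W"
    "ktensor x V T = a *\<^sub>R V" "ktensor x W T = a *\<^sub>R W"
    "ktensor x V V = - (a *\<^sub>R T) + s *\<^sub>R V" "ktensor x V W = - (s *\<^sub>R W)" "ktensor x W V = - (s *\<^sub>R W)"
    "ktensor x W W = - (a *\<^sub>R T) - s *\<^sub>R V"
  using c ktensor_sym[OF x, of V T] ktensor_sym[OF x, of W T] ktensor_sym[OF x, of W V]
  by (simp_all add: canonical_frame_def Let_def difference_tensor_eq[OF x])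

lemma lorentz_frameD:
  assumes x: "x \<in> U" and c: "lorentz_frame (h x) T V W"
  shows "h x T T = -1" "h x V V = 1" "h x W W = 1" "h x T V = 0" "h x T W = 0" "h x V W = 0"
    "h x V T = 0" "h x W T = 0" "h x W V = 0"
  using c conn_metric_sym(2)[OF x, of V T] conn_metric_sym(2)[OF x, of W T]
      conn_metric_sym(2)[OF x, of W V] by (simp_all add: lorentz_frame_def)

text \<open>The plain trace of \<open>K\<close> vanishes (apolarity) and cannot single out
  \<open>T\<close>, which is why a contraction cubic in \<open>K\<close> is used. Its coefficient is
  nonzero whenever \<open>a > 0\<close>, whatever the value of \<open>s\<close>.\<close>

lemma kvector_canonical:
  assumes x: "x \<in> U" and c: "canonical_frame f \<xi> x T V W a s"
  shows "kvector x T V W = - ((4 * a * (2 * a\<^sup>2 + s\<^sup>2)) *\<^sub>R T)"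
proof -
  note b = bilinear_metric[OF x]
  note bs = bilinear_ladd[OF b] bilinear_radd[OF b] bilinear_lmul[OF b] bilinear_rmul[OF b]
    bilinear_lneg[OF b] bilinear_rneg[OF b] bilinear_lsub[OF b] bilinear_rsub[OF b]
  note hs = lorentz_frameD[OF x canonical_frameD(1)[OF x c]]
  note ks = canonical_frameD(2-)[OF x c]
  have "killing x T V W T T = 6 * a\<^sup>2" "killing x T V W V V = 2 * s\<^sup>2 - 2 * a\<^sup>2"
    "killing x T V W W W = 2 * s\<^sup>2 - 2 * a\<^sup>2" "killing x T V W T V = 0" "killing x T V W T W = 0"
    "killing x T V W V W = 0" "killing x T V W V T = 0" "killing x T V W W T = 0"
    "killing x T V W W V = 0"
    by (simp_all add: killing_def lorentz_trace_def ks bs hs power2_eq_square)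
  then show ?thesis
    by (simp add: kvector_def lorentz_trace_def ks) (simp add: vec_eq_iff algebra_simps power2_eq_square)
qed

text \<open>The leading minus sign undoes the one in \<open>kvector_canonical\<close>, so that the
  result is \<open>T\<close> and not \<open>- T\<close>.\<close>

definition kdirection :: "real^3 \<Rightarrow> real^3 \<Rightarrow> real^3 \<Rightarrow> real^3 \<Rightarrow> real^3" where
  "kdirection x E0 E1 E2 = - ((1 / sqrt (- h x (kvector x E0 E1 E2) (kvector x E0 E1 E2))) *\<^sub>R kvector x E0 E1 E2)"

lemma canonical_direction:
  assumes x: "x \<in> U" and c: "canonical_frame f \<xi> x T V W a s" and a: "a > 0"
    and E: "lorentz_frame (h x) E0 E1 E2"
  shows "kdirection x E0 E1 E2 = T" "h x (kvector x E0 E1 E2) (kvector x E0 E1 E2) < 0"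
proof -
  define m where "m = 4 * a * (2 * a\<^sup>2 + s\<^sup>2)"
  have m: "m > 0"
    using a by (simp add: m_def add_pos_nonneg)
  note b = bilinear_metric[OF x]
  note hs = lorentz_frameD[OF x canonical_frameD(1)[OF x c]]
  have k: "kvector x E0 E1 E2 = - (m *\<^sub>R T)"
    using kvector_independent[OF x canonical_frameD(1)[OF x c] E] kvector_canonical[OF x c] by (simp add: m_def)
  have hk: "h x (kvector x E0 E1 E2) (kvector x E0 E1 E2) = - (m * m)"
    unfolding k by (simp only: bilinear_lneg[OF b] bilinear_rneg[OF b] bilinear_lmul[OF b] bilinear_rmul[OF b] hs) simp
  show "h x (kvector x E0 E1 E2) (kvector x E0 E1 E2) < 0"
    unfolding hk using m by simp
  show "kdirection x E0 E1 E2 = T"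
    unfolding kdirection_def hk unfolding k using m by simp
qed

lemma normalize_timelike:
  assumes S: "open S" "S \<subseteq> U" and Z: "smooth_on S Z" and neg: "\<And>x. x \<in> S \<Longrightarrow> h x (Z x) (Z x) < 0"
  shows "smooth_on S (\<lambda>x. (1 / sqrt (- h x (Z x) (Z x))) *\<^sub>R Z x)"
    "x \<in> S \<Longrightarrow> h x ((1 / sqrt (- h x (Z x) (Z x))) *\<^sub>R Z x) ((1 / sqrt (- h x (Z x) (Z x))) *\<^sub>R Z x) = -1"
proof -
  show "smooth_on S (\<lambda>x. (1 / sqrt (- h x (Z x) (Z x))) *\<^sub>R Z x)"
    by (intro smooth_intros S Z smooth_metric_fields) (use neg in force)+
  assume x: "x \<in> S"
  note b = bilinear_metric[OF subsetD[OF S(2) x]]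
  show "h x ((1 / sqrt (- h x (Z x) (Z x))) *\<^sub>R Z x) ((1 / sqrt (- h x (Z x) (Z x))) *\<^sub>R Z x) = -1"
    using neg[OF x] by (simp add: bilinear_lmul[OF b] bilinear_rmul[OF b] field_simps)
qed

lemma normalize_spacelike:
  assumes S: "open S" "S \<subseteq> U" and Z: "smooth_on S Z" and pos: "\<And>x. x \<in> S \<Longrightarrow> h x (Z x) (Z x) > 0"
  shows "smooth_on S (\<lambda>x. (1 / sqrt (h x (Z x) (Z x))) *\<^sub>R Z x)"
    "x \<in> S \<Longrightarrow> h x ((1 / sqrt (h x (Z x) (Z x))) *\<^sub>R Z x) ((1 / sqrt (h x (Z x) (Z x))) *\<^sub>R Z x) = 1"
proof -
  show "smooth_on S (\<lambda>x. (1 / sqrt (h x (Z x) (Z x))) *\<^sub>R Z x)"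
    by (intro smooth_intros S Z smooth_metric_fields) (use pos in force)+
  assume x: "x \<in> S"
  note b = bilinear_metric[OF subsetD[OF S(2) x]]
  show "h x ((1 / sqrt (h x (Z x) (Z x))) *\<^sub>R Z x) ((1 / sqrt (h x (Z x) (Z x))) *\<^sub>R Z x) = 1"
    using pos[OF x] by (simp add: bilinear_lmul[OF b] bilinear_rmul[OF b] field_simps)
qed

text \<open>Gram-Schmidt applied to the constant fields \<open>V0\<close>, \<open>W0\<close>; the
  neighbourhood shrinks twice, each time to where the vector about to be normalized is spacelike. At
  \<open>x0\<close> nothing changes, so the given frame is kept there.\<close>

lemma extend_lorentz_frame:
  assumes S: "open S" "S \<subseteq> U" and T: "smooth_on S T" "\<And>x. x \<in> S \<Longrightarrow> h x (T x) (T x) = -1"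
    and x0: "x0 \<in> S" "lorentz_frame (h x0) (T x0) V0 W0"
  obtains S' V W where "open S'" "S' \<subseteq> S" "x0 \<in> S'" "smooth_on S' V" "smooth_on S' W"
    "\<And>x. x \<in> S' \<Longrightarrow> lorentz_frame (h x) (T x) (V x) (W x)" "V x0 = V0" "W x0 = W0"
proof -
  \<comment> \<open>Projection orthogonal to \<open>T\<close>; the sign is plus because
    \<open>h(T, T) = -1\<close>.\<close>
  define V1 where "V1 x = V0 + h x V0 (T x) *\<^sub>R T x" for x
  define S1 where "S1 = {x \<in> S. 0 < h x (V1 x) (V1 x)}"
  define V where "V x = (1 / sqrt (h x (V1 x) (V1 x))) *\<^sub>R V1 x" for x
  define W1 where "W1 x = W0 + h x W0 (T x) *\<^sub>R T x - h x W0 (V x) *\<^sub>R V x" for x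
  define S2 where "S2 = {x \<in> S1. 0 < h x (W1 x) (W1 x)}"
  define W where "W x = (1 / sqrt (h x (W1 x) (W1 x))) *\<^sub>R W1 x" for x
  have V1: "smooth_on S V1"
    unfolding V1_def by (intro smooth_intros S T smooth_metric_fields)
  have S1: "open S1" "S1 \<subseteq> S" "S1 \<subseteq> U"
    unfolding S1_def
    using open_superlevel[OF S(1) smooth_on_continuous[OF smooth_metric_fields[OF S V1 V1]]] S by auto
  have T1: "smooth_on S1 T"
    by (rule smooth_on_subset[OF T(1) S1(2)])
  have V: "smooth_on S1 V" "\<And>x. x \<in> S1 \<Longrightarrow> h x (V x) (V x) = 1"
    unfolding V_def
    using normalize_spacelike[OF S1(1,3) smooth_on_subset[OF V1 S1(2)]] by (simp_all add: S1_def)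
  have W1: "smooth_on S1 W1"
    unfolding W1_def by (intro smooth_intros S1 T1 V(1) smooth_metric_fields)
  have S2: "open S2" "S2 \<subseteq> S1" "S2 \<subseteq> U"
    unfolding S2_def
    using open_superlevel[OF S1(1) smooth_on_continuous[OF smooth_metric_fields[OF S1(1,3) W1 W1]]] S1 by auto
  have W: "smooth_on S2 W" "\<And>x. x \<in> S2 \<Longrightarrow> h x (W x) (W x) = 1"
    unfolding W_def
    using normalize_spacelike[OF S2(1,3) smooth_on_subset[OF W1 S2(2)]] by (simp_all add: S2_def)
  have frame: "lorentz_frame (h x) (T x) (V x) (W x)" if x: "x \<in> S2" for x
  proof -
    have xs: "x \<in> S1" "x \<in> S" "x \<in> U"
      using x S2(2) S1(2) S(2) by blast+
    note b = bilinear_metric[OF xs(3)]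
    note bs = bilinear_ladd[OF b] bilinear_radd[OF b] bilinear_lmul[OF b] bilinear_rmul[OF b]
      bilinear_lsub[OF b] bilinear_rsub[OF b]
    note sym = conn_metric_sym(2)[OF xs(3)]
    have TV: "h x (T x) (V x) = 0"
      unfolding V_def V1_def by (simp add: bs T(2)[OF xs(2)] sym[of V0 "T x"])
    have "h x (T x) (W1 x) = 0" "h x (V x) (W1 x) = 0"
      unfolding W1_def by (simp_all add: bs T(2)[OF xs(2)] V(2)[OF xs(1)] TV sym[of W0 "T x"] sym[of W0 "V x"] sym[of "V x" "T x"])
    then have "h x (T x) (W x) = 0" "h x (V x) (W x) = 0"
      unfolding W_def by (simp_all add: bs)
    then show ?thesis
      by (simp add: lorentz_frame_def TV T(2)[OF xs(2)] V(2)[OF xs(1)] W(2)[OF x])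
  qed
  have x0U: "x0 \<in> U"
    using x0 S by auto
  note hs = lorentz_frameD[OF x0U x0(2)]
  have "V1 x0 = V0"
    by (simp add: V1_def hs)
  then have V0: "V x0 = V0" "x0 \<in> S1"
    using x0 by (simp_all add: V_def S1_def hs)
  then have "W1 x0 = W0"
    by (simp add: W1_def hs)
  then have W0: "W x0 = W0" "x0 \<in> S2"
    using V0 by (simp_all add: W_def S2_def hs)
  show ?thesis
    using that[OF S2(1) subset_trans[OF S2(2) S1(2)] W0(2) smooth_on_subset[OF V(1) S2(2)] W(1) frame V0(1) W0(1)]
    by blast
qed

end

section \<open>Smoothness of \<open>T\<close>, of \<open>a4\<close> and of canonical frames\<close>

locale symmetric_chart = affine_sphere_chart +
  assumes canonical: "(\<forall>x\<in>U. \<exists>T V W a s. canonical_frame f \<xi> x T V W a s \<and> a > 0 \<and> s = 0) \<or>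
    (\<forall>x\<in>U. \<exists>T V W a s. canonical_frame f \<xi> x T V W a s \<and> a > 0 \<and> s > 0)"
begin

lemmas metric_bilinear =
  bilinear_ladd[OF bilinear_metric] bilinear_radd[OF bilinear_metric]
  bilinear_lmul[OF bilinear_metric] bilinear_rmul[OF bilinear_metric]
  bilinear_lneg[OF bilinear_metric] bilinear_rneg[OF bilinear_metric]
  bilinear_lsub[OF bilinear_metric] bilinear_rsub[OF bilinear_metric]

lemmas ktensor_bilinear =
  bilinear_ladd[OF bilinear_ktensor] bilinear_radd[OF bilinear_ktensor]
  bilinear_lmul[OF bilinear_ktensor] bilinear_rmul[OF bilinear_ktensor]
  bilinear_lneg[OF bilinear_ktensor] bilinear_rneg[OF bilinear_ktensor]
  bilinear_lsub[OF bilinear_ktensor] bilinear_rsub[OF bilinear_ktensor]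

abbreviation "Tf \<equiv> T_field f \<xi>"
abbreviation "af \<equiv> a4 f \<xi>"

lemma canonical_unique:
  assumes x: "x \<in> U" and c: "canonical_frame f \<xi> x T V W a s" "a > 0" "s \<ge> 0"
  shows "Tf x = T" "af x = a"
proof -
  have *: "T' = T \<and> a' = a" if c': "canonical_frame f \<xi> x T' V' W' a' s'" "a' > 0" for T' V' W' a' s'
  proof -
    note E = canonical_frameD(1)[OF x c(1)]
    have T: "T' = T"
      using canonical_direction(1)[OF x c(1,2) E] canonical_direction(1)[OF x c' E] by simp
    have "h x (ktensor x T T) T = 2 * a" "h x (ktensor x T' T') T' = 2 * a'"
      using canonical_frameD(2)[OF x c(1)] canonical_frameD(2)[OF x c'(1)]
        lorentz_frameD(1)[OF x canonical_frameD(1)[OF x c(1)]]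
        lorentz_frameD(1)[OF x canonical_frameD(1)[OF x c'(1)]]
      by (simp_all add: metric_bilinear x)
    then show ?thesis
      using T by simp
  qed
  show "Tf x = T"
    unfolding T_field_def by (rule the_equality) (use c * in blast)+
  show "af x = a"
    unfolding a4_def by (rule the_equality) (use c * in blast)+
qed

lemma canonical_frame_exists:
  assumes x: "x \<in> U"
  obtains V W s where "canonical_frame f \<xi> x (Tf x) V W (af x) s" "af x > 0" "s \<ge> 0"
proof -
  obtain T V W a s where "canonical_frame f \<xi> x T V W a s" "a > 0" "s \<ge> 0"
    using canonical x by (metis order_le_less)
  then show ?thesis
    using canonical_unique[OF x] that by metis
qed

lemma af_pos: "x \<in> U \<Longrightarrow> af x > 0"
  using canonical_frame_exists by blast

lemma Tf_timelike: "x \<in> U \<Longrightarrow> h x (Tf x) (Tf x) = -1"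
  using canonical_frame_exists canonical_frameD(1) lorentz_frameD(1) by metis

text \<open>\<open>K_T\<close> has eigenvalue \<open>a\<close> on the whole plane orthogonal to
  \<open>T\<close> and \<open>- 2 a\<close> on \<open>T\<close>; the factor 3 accounts for the
  difference, and no choice of \<open>V, W\<close> is left.\<close>

lemma ktensor_Tf:
  assumes x: "x \<in> U"
  shows "ktensor x (Tf x) u = af x *\<^sub>R (u + (3 * h x u (Tf x)) *\<^sub>R Tf x)"
proof -
  obtain V W s where c: "canonical_frame f \<xi> x (Tf x) V W (af x) s"
    using canonical_frame_exists[OF x] by blast
  let ?e = "- (h x u (Tf x) *\<^sub>R Tf x) + h x u V *\<^sub>R V + h x u W *\<^sub>R W"
  note k = bilinear_ktensor[OF x]
  have u: "u = ?e"
    by (rule lorentz_expansion[OF x canonical_frameD(1)[OF x c]])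
  have "ktensor x (Tf x) ?e = af x *\<^sub>R (?e + (3 * h x u (Tf x)) *\<^sub>R Tf x)"
    by (simp add: ktensor_bilinear x canonical_frameD(2-4)[OF x c])
      (simp add: vec_eq_iff algebra_simps)
  then show ?thesis
    unfolding u[symmetric] .
qed

lemma smooth_kvector:
  assumes S: "open S" "S \<subseteq> U" and E: "smooth_on S E0" "smooth_on S E1" "smooth_on S E2"
  shows "smooth_on S (\<lambda>x. kvector x (E0 x) (E1 x) (E2 x))"
  unfolding kvector_def killing_def lorentz_trace_def
  by (intro smooth_on_add[OF S(1)] smooth_on_uminus[OF S(1)] smooth_on_scaleR[OF S(1)]
      smooth_metric_fields[OF S] smooth_ktensor_fields[OF S] E)

text \<open>The constant vector \<open>Tf x0\<close> stays timelike near \<open>x0\<close> and, once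
  normalized, can be completed to a smooth Lorentz frame. There \<open>Tf\<close> is
  \<open>kdirection\<close>, an explicit smooth expression, although the frame need not be adapted
  to \<open>Tf\<close> away from \<open>x0\<close>.\<close>

lemma smooth_Tf: "smooth_on U Tf"
proof (rule smooth_on_local)
  fix x0 assume x0: "x0 \<in> U"
  obtain V0 W0 s where c0: "canonical_frame f \<xi> x0 (Tf x0) V0 W0 (af x0) s"
    using canonical_frame_exists[OF x0] by blast
  let ?T0 = "Tf x0"
  define S0 where "S0 = {x \<in> U. 0 < - h x ?T0 ?T0}"
  have cont: "continuous_on U (\<lambda>x. - h x ?T0 ?T0)"
    by (rule smooth_on_continuous, intro smooth_on_uminus open_U smooth_metric)
  have S0: "open S0" "S0 \<subseteq> U" "x0 \<in> S0"
    unfolding S0_def using open_superlevel[OF open_U cont] x0 Tf_timelike[OF x0] by auto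
  let ?F = "\<lambda>x. (1 / sqrt (- h x ?T0 ?T0)) *\<^sub>R ?T0"
  have neg: "h x ?T0 ?T0 < 0" if "x \<in> S0" for x
    using that by (simp add: S0_def)
  note F = normalize_timelike[where Z = "\<lambda>x. ?T0", OF S0(1,2) smooth_on_const[OF S0(1)] neg]
  have F0: "lorentz_frame (h x0) (?F x0) V0 W0"
    using canonical_frameD(1)[OF x0 c0] Tf_timelike[OF x0] by simp
  obtain S' V W where S': "open S'" "S' \<subseteq> S0" "x0 \<in> S'" and VW: "smooth_on S' V" "smooth_on S' W"
    and fr: "\<And>x. x \<in> S' \<Longrightarrow> lorentz_frame (h x) (?F x) (V x) (W x)" and "V x0 = V0" "W x0 = W0"
    by (rule extend_lorentz_frame[where T = ?F, OF S0(1,2) F(1,2) S0(3) F0]) (assumption | rule that)+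
  have S'U: "S' \<subseteq> U"
    by (rule subset_trans[OF S'(2) S0(2)])
  note sF = smooth_on_subset[OF F(1) S'(2)]
  let ?k = "\<lambda>x. kvector x (?F x) (V x) (W x)"
  have K: "smooth_on S' ?k"
    by (rule smooth_kvector[OF S'(1) S'U sF VW])
  have neg': "h x (?k x) (?k x) < 0" "kdirection x (?F x) (V x) (W x) = Tf x" if "x \<in> S'" for x
  proof -
    have x: "x \<in> U"
      using that S'U by blast
    obtain V' W' s where "canonical_frame f \<xi> x (Tf x) V' W' (af x) s" "af x > 0"
      using canonical_frame_exists[OF x] by blast
    then show "h x (?k x) (?k x) < 0" "kdirection x (?F x) (V x) (W x) = Tf x"
      using canonical_direction[OF x _ _ fr[OF that]] by blast+
  qed
  have "smooth_on S' (\<lambda>x. - ((1 / sqrt (- h x (?k x) (?k x))) *\<^sub>R ?k x))"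
    by (rule smooth_on_uminus[OF S'(1) normalize_timelike(1)[OF S'(1) S'U K neg'(1)]])
  then have "smooth_on S' Tf"
    by (rule smooth_on_cong[OF S'(1), rotated]) (use neg'(2) in \<open>simp add: kdirection_def\<close>)
  then show "\<exists>O'. open O' \<and> x0 \<in> O' \<and> smooth_on O' Tf"
    using S'(1,3) by metis
qed

lemma smooth_af: "smooth_on U af"
proof (rule smooth_on_cong[OF open_U])
  show "smooth_on U (\<lambda>x. h x (ktensor x (Tf x) (Tf x)) (Tf x) * (1 / 2))"
    by (intro smooth_on_mult smooth_on_const smooth_metric_fields smooth_ktensor_fields open_U smooth_Tf) auto
  show "h x (ktensor x (Tf x) (Tf x)) (Tf x) * (1 / 2) = af x" if x: "x \<in> U" for x
  proof -
    obtain V W s where c: "canonical_frame f \<xi> x (Tf x) V W (af x) s"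
      using canonical_frame_exists[OF x] by blast
    show ?thesis
      using canonical_frameD(2)[OF x c] by (simp add: bilinear_lmul[OF bilinear_metric[OF x]] bilinear_lneg[OF bilinear_metric[OF x]] Tf_timelike[OF x])
  qed
qed

text \<open>Once \<open>T\<close> is fixed, \<open>K\<close> restricted to the orthogonal plane is a
  trace-free cubic in two variables, and therefore has just the two components \<open>p\<close> and
  \<open>r\<close>.\<close>

lemma adapted_frame:
  assumes x: "x \<in> U" and E: "lorentz_frame (h x) (Tf x) V W"
  defines "p \<equiv> h x (ktensor x V V) V" and "r \<equiv> h x (ktensor x V V) W"
  shows "ktensor x V V = - (af x *\<^sub>R Tf x) + p *\<^sub>R V + r *\<^sub>R W"
    "ktensor x V W = r *\<^sub>R V - p *\<^sub>R W"
    "ktensor x W W = - (af x *\<^sub>R Tf x) - p *\<^sub>R V - r *\<^sub>R W"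
proof -
  note hs = lorentz_frameD[OF x E] and b = bilinear_metric[OF x]
  note bs = bilinear_ladd[OF b] bilinear_lmul[OF b] bilinear_lneg[OF b] bilinear_lsub[OF b]
  have kT: "ktensor x (Tf x) V = af x *\<^sub>R V" "ktensor x (Tf x) W = af x *\<^sub>R W"
    "ktensor x (Tf x) (Tf x) = - ((2 * af x) *\<^sub>R Tf x)"
    by (simp_all add: ktensor_Tf[OF x] hs) (simp add: vec_eq_iff)
  note ks = ktensor_sym[OF x]
  have T1: "h x (ktensor x V V) (Tf x) = af x" "h x (ktensor x V W) (Tf x) = 0"
    using ktensor_metric_sym[OF x, of V V "Tf x"] ktensor_metric_sym[OF x, of V W "Tf x"]
      ks[of V "Tf x"] by (simp_all add: kT bs hs)
  show VV: "ktensor x V V = - (af x *\<^sub>R Tf x) + p *\<^sub>R V + r *\<^sub>R W"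
    using lorentz_expansion[OF x E, of "ktensor x V V"] by (simp add: T1 p_def r_def)
  obtain V' W' s where c: "canonical_frame f \<xi> x (Tf x) V' W' (af x) s"
    using canonical_frame_exists[OF x] by blast
  \<comment> \<open>Apolarity, read off in the canonical frame and carried to the given one by
    invariance of the trace.\<close>
  have "lorentz_trace (ktensor x) (Tf x) V' W' = 0"
    using canonical_frameD(2,7,10)[OF x c] by (simp add: lorentz_trace_def vec_eq_iff)
  then have "lorentz_trace (ktensor x) (Tf x) V W = 0"
    using lorentz_trace_independent[OF x canonical_frameD(1)[OF x c] E bilinear_ktensor[OF x]] by simp
  then have tr: "ktensor x W W = ktensor x (Tf x) (Tf x) - ktensor x V V"
    by (simp add: lorentz_trace_def algebra_simps)
  show WW: "ktensor x W W = - (af x *\<^sub>R Tf x) - p *\<^sub>R V - r *\<^sub>R W"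
    unfolding tr VV kT by (simp add: vec_eq_iff)
  have "h x (ktensor x V W) V = r"
    using ktensor_metric_sym[OF x, of V W V] by (simp add: r_def)
  moreover have "h x (ktensor x V W) W = - p"
  proof -
    have "h x (ktensor x W V) W = h x (ktensor x W W) V"
      by (rule ktensor_metric_sym[OF x])
    then show ?thesis
      unfolding WW ks[of W V] by (simp add: bs hs)
  qed
  ultimately show "ktensor x V W = r *\<^sub>R V - p *\<^sub>R W"
    using lorentz_expansion[OF x E, of "ktensor x V W"] by (simp add: T1)
qed

lemma canonical_frameI:
  assumes x: "x \<in> U" and E: "lorentz_frame (h x) (Tf x) V W"
    and p: "h x (ktensor x V V) V = s" and r: "h x (ktensor x V V) W = 0"
  shows "canonical_frame f \<xi> x (Tf x) V W (af x) s"
proof -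
  note hs = lorentz_frameD[OF x E]
  have "ktensor x (Tf x) V = af x *\<^sub>R V" "ktensor x (Tf x) W = af x *\<^sub>R W"
    "ktensor x (Tf x) (Tf x) = (- 2 * af x) *\<^sub>R Tf x"
    by (simp_all add: ktensor_Tf[OF x] hs) (simp add: vec_eq_iff)
  then show ?thesis
    using E by (simp add: canonical_frame_def Let_def difference_tensor_eq[OF x] adapted_frame[OF x E, unfolded p r])
qed

text \<open>Rotating \<open>V, W\<close> by \<open>\<theta>\<close> turns the pair
  \<open>(p, r)\<close> by \<open>3 \<theta>\<close>, so a third of its argument makes
  \<open>r\<close> vanish. For \<open>SO(2)\<close> every frame adapted to \<open>T\<close> is
  already canonical with \<open>s = 0\<close>; this is recorded as an equality of functions, for
  later use on the quadric.\<close>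

lemma smooth_canonical_frame:
  assumes x0: "x0 \<in> U"
  shows "\<exists>S V W s. open S \<and> S \<subseteq> U \<and> x0 \<in> S \<and> smooth_on S V \<and> smooth_on S W \<and> smooth_on S s \<and>
    (\<forall>x\<in>S. canonical_frame f \<xi> x (Tf x) (V x) (W x) (af x) (s x) \<and> s x \<ge> 0) \<and>
    ((\<forall>x\<in>U. \<exists>T V W a s. canonical_frame f \<xi> x T V W a s \<and> a > 0 \<and> s = 0) \<longrightarrow> s = (\<lambda>x. 0))"
proof (cases "\<forall>x\<in>U. \<exists>T V W a s. canonical_frame f \<xi> x T V W a s \<and> a > 0 \<and> s = 0")
  case True
  obtain V0 W0 s0 where c0: "canonical_frame f \<xi> x0 (Tf x0) V0 W0 (af x0) s0"
    using canonical_frame_exists[OF x0] by blast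
  obtain S V W where S: "open S" "S \<subseteq> U" "x0 \<in> S" "smooth_on S V" "smooth_on S W"
    and fr: "\<And>x. x \<in> S \<Longrightarrow> lorentz_frame (h x) (Tf x) (V x) (W x)" and "V x0 = V0" "W x0 = W0"
    by (rule extend_lorentz_frame[OF open_U subset_refl smooth_Tf Tf_timelike x0 canonical_frameD(1)[OF x0 c0]]) (assumption | rule that)+
  have "canonical_frame f \<xi> x (Tf x) (V x) (W x) (af x) 0" if "x \<in> S" for x
  proof (rule canonical_frameI)
    show x: "x \<in> U"
      using S that by blast
    show "lorentz_frame (h x) (Tf x) (V x) (W x)"
      by (rule fr[OF that])
    note hs = lorentz_frameD[OF x fr[OF that]]
    obtain T V' W' a s where "canonical_frame f \<xi> x T V' W' a s" "a > 0" "s = 0"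
      using True x by blast
    then have c: "canonical_frame f \<xi> x (Tf x) V' W' (af x) 0"
      using canonical_unique[OF x, of T V' W' a s] by simp
    let ?v = "- (h x (V x) (Tf x) *\<^sub>R Tf x) + h x (V x) V' *\<^sub>R V' + h x (V x) W' *\<^sub>R W'"
    note b = bilinear_metric[OF x] and k = bilinear_ktensor[OF x]
    have v: "V x = ?v"
      by (rule lorentz_expansion[OF x canonical_frameD(1)[OF x c]])
    have v': "V x = h x (V x) V' *\<^sub>R V' + h x (V x) W' *\<^sub>R W'"
      using v by (simp add: hs)
    have "ktensor x (h x (V x) V' *\<^sub>R V' + h x (V x) W' *\<^sub>R W') (h x (V x) V' *\<^sub>R V' + h x (V x) W' *\<^sub>R W') =
       - ((((h x (V x) V')\<^sup>2 + (h x (V x) W')\<^sup>2) * af x) *\<^sub>R Tf x)"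
      by (simp add: bilinear_ladd[OF k] bilinear_radd[OF k] bilinear_lmul[OF k] bilinear_rmul[OF k]
          canonical_frameD[OF x c]) (simp add: vec_eq_iff algebra_simps power2_eq_square)
    then have "ktensor x (V x) (V x) = (- (((h x (V x) V')\<^sup>2 + (h x (V x) W')\<^sup>2) * af x)) *\<^sub>R Tf x"
      unfolding v'[symmetric] by simp
    then obtain m where m: "ktensor x (V x) (V x) = m *\<^sub>R Tf x" ..
    show "h x (ktensor x (V x) (V x)) (V x) = 0" "h x (ktensor x (V x) (V x)) (W x) = 0"
      unfolding m by (simp_all add: bilinear_lmul[OF b] hs)
  qed
  then show ?thesis
    by - (rule exI[of _ S], rule exI[of _ V], rule exI[of _ W], rule exI[of _ "\<lambda>x. 0"],
      simp add: S smooth_on_const)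
next
  case False
  then obtain T1 V0 W0 a1 s0 where *: "canonical_frame f \<xi> x0 T1 V0 W0 a1 s0" "a1 > 0" "s0 > 0"
    using canonical x0 by blast
  then have c0: "canonical_frame f \<xi> x0 (Tf x0) V0 W0 (af x0) s0"
    using canonical_unique[OF x0, of T1 V0 W0 a1 s0] by simp
  obtain S V W where S: "open S" "S \<subseteq> U" "x0 \<in> S" "smooth_on S V" "smooth_on S W"
    and fr: "\<And>x. x \<in> S \<Longrightarrow> lorentz_frame (h x) (Tf x) (V x) (W x)" and VW0: "V x0 = V0" "W x0 = W0"
    by (rule extend_lorentz_frame[OF open_U subset_refl smooth_Tf Tf_timelike x0 canonical_frameD(1)[OF x0 c0]]) (assumption | rule that)+
  define p where "p x = h x (ktensor x (V x) (V x)) (V x)" for x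
  define r where "r x = h x (ktensor x (V x) (V x)) (W x)" for x
  have pr: "smooth_on S p" "smooth_on S r"
    unfolding p_def r_def by (intro smooth_metric_fields smooth_ktensor_fields S)+
  \<comment> \<open>Where \<open>p > 0\<close> the argument of \<open>(p, r)\<close> is
    \<open>arctan (r / p)\<close>, with no branch to choose; at \<open>x0\<close> the frame is
    canonical and \<open>p = s0 > 0\<close>.\<close>
  define S' where "S' = {x \<in> S. 0 < p x}"
  have "p x0 = s0"
    using canonical_frameD(7)[OF x0 c0] lorentz_frameD[OF x0 canonical_frameD(1)[OF x0 c0]]
    by (simp add: p_def VW0 metric_bilinear x0)
  then have S': "open S'" "S' \<subseteq> S" "x0 \<in> S'"
    unfolding S'_def using open_superlevel[OF S(1) smooth_on_continuous[OF pr(1)]] S *(3) by auto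
  define \<theta> where "\<theta> x = arctan (r x / p x) * (1 / 3)" for x
  define s where "s x = sqrt ((p x)\<^sup>2 + (r x)\<^sup>2)" for x
  have ppos: "p x > 0" if "x \<in> S'" for x
    using that by (simp add: S'_def)
  have spos: "(p x)\<^sup>2 + (r x)\<^sup>2 > 0" if "x \<in> S'" for x
    using ppos[OF that] by (simp add: add_pos_nonneg)
  note pr' = pr[THEN smooth_on_subset[OF _ S'(2)]]
  note VW' = S(4,5)[THEN smooth_on_subset[OF _ S'(2)]]
  have "smooth_on S' (\<lambda>x. arctan (r x / p x))"
    by (rule smooth_on_arctan[OF S'(1)]) (intro smooth_on_divide S' pr', use ppos in force)
  then have \<theta>: "smooth_on S' \<theta>"
    unfolding \<theta>_def by (intro smooth_on_mult smooth_on_const S')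
  have s: "smooth_on S' s"
    unfolding s_def by (intro smooth_on_sqrt smooth_on_add smooth_on_power S' pr' spos)
  define V' where "V' x = cos (\<theta> x) *\<^sub>R V x + sin (\<theta> x) *\<^sub>R W x" for x
  define W' where "W' x = - (sin (\<theta> x) *\<^sub>R V x) + cos (\<theta> x) *\<^sub>R W x" for x
  have sVW: "smooth_on S' V'" "smooth_on S' W'"
    unfolding V'_def W'_def
    by (intro smooth_on_add smooth_on_uminus smooth_on_scaleR smooth_on_sin smooth_on_cos S' \<theta> VW')+
  have "canonical_frame f \<xi> x (Tf x) (V' x) (W' x) (af x) (s x)" if xS': "x \<in> S'" for x
  proof (rule canonical_frameI)
    show x: "x \<in> U"
      using S S' that by blast
    have xS: "x \<in> S"
      using S' that by blast
    note hs = lorentz_frameD[OF x fr[OF xS]]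
    note b = bilinear_metric[OF x] and k = bilinear_ktensor[OF x]
    note bs = bilinear_ladd[OF b] bilinear_radd[OF b] bilinear_lmul[OF b] bilinear_rmul[OF b]
      bilinear_lneg[OF b] bilinear_rneg[OF b] bilinear_lsub[OF b] bilinear_rsub[OF b]
    note kk = bilinear_ladd[OF k] bilinear_radd[OF k] bilinear_lmul[OF k] bilinear_rmul[OF k]
    define c where "c = cos (\<theta> x)"
    define d where "d = sin (\<theta> x)"
    have cd: "c * c + d * d = 1"
      using sin_cos_squared_add3[of "\<theta> x"] by (simp add: c_def d_def)
    show "lorentz_frame (h x) (Tf x) (V' x) (W' x)"
      using cd by (simp add: lorentz_frame_def V'_def W'_def bs hs c_def d_def algebra_simps)
    define P where "P = p x"
    define R where "R = r x"
    define Q where "Q = s x"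
    have Q: "Q > 0" "P > 0"
      using spos[OF xS'] ppos[OF xS'] by (simp_all add: Q_def s_def P_def)
    have QPR: "Q = sqrt (P\<^sup>2 + R\<^sup>2)"
      by (simp add: Q_def P_def R_def s_def)
    have "1 + (R / P)\<^sup>2 = (Q / P)\<^sup>2"
      using Q by (simp add: QPR field_simps power_divide)
    then have rt: "sqrt (1 + (R / P)\<^sup>2) = Q / P"
      using Q by simp
    have three: "3 * \<theta> x = arctan (R / P)"
      by (simp add: \<theta>_def P_def R_def)
    have "P = Q * cos (3 * \<theta> x)" "R = Q * sin (3 * \<theta> x)"
      unfolding three cos_arctan sin_arctan rt using Q by (simp_all add: field_simps)
    moreover have "3 * \<theta> x = (\<theta> x + \<theta> x) + \<theta> x"
      by simp
    \<comment> \<open>Triple-angle formulas, by adding \<open>\<theta>\<close> three times; the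
      remaining claims are polynomial identities in \<open>c\<close> and \<open>d\<close>.\<close>
    ultimately have PR: "P = Q * ((c * c - d * d) * c - 2 * c * d * d)" "R = Q * (2 * c * d * c + (c * c - d * d) * d)"
      by (simp_all only: cos_add sin_add c_def d_def) (simp_all add: algebra_simps)
    note ad = adapted_frame[OF x fr[OF xS], folded p_def r_def, folded P_def R_def]
    have "ktensor x (W x) (V x) = ktensor x (V x) (W x)"
      by (rule ktensor_sym[OF x])
    then have VV: "ktensor x (V' x) (V' x) = - ((c * c + d * d) * af x) *\<^sub>R Tf x +
        ((c * c - d * d) * P + 2 * c * d * R) *\<^sub>R V x + ((c * c - d * d) * R - 2 * c * d * P) *\<^sub>R W x"
      unfolding V'_def c_def[symmetric] d_def[symmetric]
      by (simp add: kk ad) (simp add: vec_eq_iff algebra_simps)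
    have p': "h x (ktensor x (V' x) (V' x)) (V' x) =
        ((c * c - d * d) * P + 2 * c * d * R) * c + ((c * c - d * d) * R - 2 * c * d * P) * d"
      unfolding VV unfolding V'_def c_def[symmetric] d_def[symmetric] by (simp add: bs hs)
    have r': "h x (ktensor x (V' x) (V' x)) (W' x) =
        - (((c * c - d * d) * P + 2 * c * d * R) * d) + ((c * c - d * d) * R - 2 * c * d * P) * c"
      unfolding VV unfolding W'_def c_def[symmetric] d_def[symmetric] by (simp add: bs hs)
    have "((c * c - d * d) * P + 2 * c * d * R) * c + ((c * c - d * d) * R - 2 * c * d * P) * d = Q"
      using PR cd by algebra
    then show "h x (ktensor x (V' x) (V' x)) (V' x) = s x"
      unfolding p' by (simp add: Q_def)
    have "- (((c * c - d * d) * P + 2 * c * d * R) * d) + ((c * c - d * d) * R - 2 * c * d * P) * c = 0"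
      using PR cd by algebra
    then show "h x (ktensor x (V' x) (V' x)) (W' x) = 0"
      unfolding r' .
  qed
  moreover have "0 \<le> s x" for x
    by (simp add: s_def)
  moreover have "S' \<subseteq> U"
    using S(2) S'(2) by blast
  ultimately show ?thesis
    using False sVW s S'(1,3)
    by - (rule exI[of _ S'], rule exI[of _ V'], rule exI[of _ W'], rule exI[of _ s],
      intro conjI ballI impI; blast)
qed

end

text \<open>The coordinate form of \<open>[X, Y] g = dg([X, Y])\<close>: the second derivatives of
  \<open>g\<close> cancel by symmetry.\<close>

lemma smooth_commutator:
  fixes g :: "'a::euclidean_space \<Rightarrow> 'b::euclidean_space"
  assumes S: "open S" "x \<in> S" and g: "smooth_on S g" and X: "smooth_on S X" and Y: "smooth_on S Y"
  shows "dd (\<lambda>y. dd g y (Y y)) x (X x) - dd (\<lambda>y. dd g y (X y)) x (Y x) =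
    dd g x (dd Y x (X x) - dd X x (Y x))"
proof -
  have *: "dd (\<lambda>y. dd g y (Z y)) x u = dd (\<lambda>y. dd g y (Z x)) x u + dd g x (dd Z x u)"
    if "smooth_on S Z" for Z u
    by (rule dd_eqI[OF linear_family_has_derivative[OF S smooth_on_linear_dd[OF g]
            smooth_on_has_dd[OF smooth_on_dd[OF g] S(2)] smooth_on_has_dd[OF that S(2)]]])
  show ?thesis
    unfolding *[OF X] *[OF Y] symmetric_second_derivative[OF S(1) g S(2), of "Y x" "X x"]
    by (simp add: linear_diff[OF smooth_on_linear_dd[OF g S(2)]])
qed

section \<open>Moving frames\<close>

locale framed_chart = symmetric_chart +
  fixes S :: "(real^3) set" and V W :: "real^3 \<Rightarrow> real^3" and s :: "real^3 \<Rightarrow> real"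
  assumes open_S: "open S" and S_sub: "S \<subseteq> U"
    and smooth_V: "smooth_on S V" and smooth_W: "smooth_on S W" and smooth_s: "smooth_on S s"
    and frame: "\<And>x. x \<in> S \<Longrightarrow> canonical_frame f \<xi> x (Tf x) (V x) (W x) (af x) (s x)"
begin

lemma in_U: "x \<in> S \<Longrightarrow> x \<in> U"
  using S_sub by blast

lemma smooth_Tf_S: "smooth_on S Tf" and smooth_af_S: "smooth_on S af"
  by (rule smooth_on_subset[OF smooth_Tf S_sub], rule smooth_on_subset[OF smooth_af S_sub])

lemmas frame_metric = lorentz_frameD[OF in_U canonical_frameD(1)[OF in_U frame]]
lemmas frame_ktensor = canonical_frameD(2-)[OF in_U frame]

text \<open>The three connection forms of \<open>h\<close> in the frame; orthonormality leaves no
  others.\<close>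

definition "al x u = h x (levi_civita h x u Tf) (V x)"
definition "be x u = h x (levi_civita h x u Tf) (W x)"
definition "om x u = h x (levi_civita h x u V) (W x)"

lemma constant_pairing:
  assumes x: "x \<in> S" and X: "smooth_on S X" and Y: "smooth_on S Y"
    and c: "\<And>y. y \<in> S \<Longrightarrow> h y (X y) (Y y) = c"
  shows "h x (levi_civita h x u X) (Y x) + h x (X x) (levi_civita h x u Y) = 0"
proof -
  have "dd (\<lambda>y. h y (X y) (Y y)) x u = h x (levi_civita h x u X) (Y x) + h x (X x) (levi_civita h x u Y)"
    by (rule dd_eqI[OF metric_derivative[OF in_U[OF x] smooth_on_has_dd[OF X x] smooth_on_has_dd[OF Y x]]])
  moreover have "dd (\<lambda>y. h y (X y) (Y y)) x u = dd (\<lambda>y. c) x u"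
    using dd_cong[OF open_S x, of "\<lambda>y. h y (X y) (Y y)" "\<lambda>y. c"] c by simp
  ultimately show ?thesis
    by simp
qed

lemma frame_connection:
  assumes x: "x \<in> S"
  shows "levi_civita h x u Tf = al x u *\<^sub>R V x + be x u *\<^sub>R W x"
    "levi_civita h x u V = al x u *\<^sub>R Tf x + om x u *\<^sub>R W x"
    "levi_civita h x u W = be x u *\<^sub>R Tf x - om x u *\<^sub>R V x"
proof -
  note F = smooth_Tf_S smooth_V smooth_W
  note exp = lorentz_expansion[OF in_U[OF x] canonical_frameD(1)[OF in_U[OF x] frame[OF x]]]
  note sym = conn_metric_sym(2)[OF in_U[OF x]]
  note cp = constant_pairing[OF x F(1) F(1) frame_metric(1)] constant_pairing[OF x F(2) F(2) frame_metric(2)]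
    constant_pairing[OF x F(3) F(3) frame_metric(3)] constant_pairing[OF x F(1) F(2) frame_metric(4)]
    constant_pairing[OF x F(1) F(3) frame_metric(5)] constant_pairing[OF x F(2) F(3) frame_metric(6)]
  have "h x (levi_civita h x u Tf) (Tf x) = 0" "h x (levi_civita h x u V) (V x) = 0"
    "h x (levi_civita h x u W) (W x) = 0" "h x (levi_civita h x u V) (Tf x) = - al x u"
    "h x (levi_civita h x u W) (Tf x) = - be x u" "h x (levi_civita h x u W) (V x) = - om x u"
    using cp[of u] by (simp_all add: al_def be_def om_def sym[of "Tf x"] sym[of "V x" "levi_civita h x u V"]
        sym[of "V x" "levi_civita h x u W"] sym[of "W x" "levi_civita h x u W"])
  then show "levi_civita h x u Tf = al x u *\<^sub>R V x + be x u *\<^sub>R W x"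
    "levi_civita h x u V = al x u *\<^sub>R Tf x + om x u *\<^sub>R W x"
    "levi_civita h x u W = be x u *\<^sub>R Tf x - om x u *\<^sub>R V x"
    using exp[of "levi_civita h x u Tf"] exp[of "levi_civita h x u V"] exp[of "levi_civita h x u W"]
    by (simp_all add: al_def[symmetric] be_def[symmetric] om_def[symmetric])
qed

lemma smooth_levi_civita:
  assumes X: "smooth_on S X" and Y: "smooth_on S Y"
  shows "smooth_on S (\<lambda>x. levi_civita h x (X x) Y)"
proof (rule smooth_on_cong[OF open_S])
  have "smooth_on S (\<lambda>x. conn x (X x) (Y x))"
  proof (rule smooth_on_linear_family[OF open_S _ _ Y])
    show "linear (conn y (X y))" if "y \<in> S" for y
      using bilinear_conn[OF in_U[OF that]] unfolding bilinear_def by blast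
    show "smooth_on S (\<lambda>y. conn y (X y) v)" for v
      by (rule smooth_on_linear_family[where L = "\<lambda>y u. conn y u v", OF open_S _ _ X])
        (use conn_metric_linear(1) in_U smooth_on_subset[OF smooth_conn S_sub] in blast)+
  qed
  then show "smooth_on S (\<lambda>x. dd Y x (X x) + (conn x (X x) (Y x) - ktensor x (X x) (Y x)))"
    by (intro smooth_on_add smooth_on_diff open_S smooth_on_dd_var smooth_ktensor_fields S_sub X Y)
  show "dd Y x (X x) + (conn x (X x) (Y x) - ktensor x (X x) (Y x)) = levi_civita h x (X x) Y" if "x \<in> S" for x
    by (simp add: levi_civita_eq[OF in_U[OF that]])
qed

text \<open>\<open>cb\<close> and \<open>cc\<close> are the components of
  \<open>\<nabla>_T T\<close>. Otherwise the letters \<open>p\<close>, \<open>q\<close>,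
  \<open>w\<close> stand for \<open>al\<close>, \<open>be\<close>, \<open>om\<close>, and the digits
  0, 1, 2 for the directions \<open>T, V, W\<close>; \<open>p1\<close> will turn out to be
  \<open>n\<close>.\<close>

definition "cb x = al x (Tf x)"
definition "cc x = be x (Tf x)"
definition "w0 x = om x (Tf x)"
definition "p1 x = al x (V x)"
definition "q1 x = be x (V x)"
definition "w1 x = om x (V x)"
definition "p2 x = al x (W x)"
definition "q2 x = be x (W x)"
definition "w2 x = om x (W x)"

lemma smooth_coefficients:
  "smooth_on S cb" "smooth_on S cc" "smooth_on S w0"
  "smooth_on S p1" "smooth_on S q1" "smooth_on S w1"
  "smooth_on S p2" "smooth_on S q2" "smooth_on S w2"
  unfolding cb_def[abs_def] cc_def[abs_def] w0_def[abs_def] p1_def[abs_def] q1_def[abs_def] w1_def[abs_def]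
    p2_def[abs_def] q2_def[abs_def] w2_def[abs_def] al_def be_def om_def
  by (intro smooth_metric_fields[OF open_S S_sub] smooth_levi_civita smooth_Tf_S smooth_V smooth_W)+

text \<open>The moving frame \<open>(T, V, W, \<xi>)\<close> along the hypersurface; the rows of the matrices
  \<open>MT, MV, MW\<close> are the coefficients of its derivatives in the directions \<open>T, V, W\<close>.\<close>

definition e :: "4 \<Rightarrow> real^3 \<Rightarrow> real^4" where
  "e k y = (vector [dd f y (Tf y), dd f y (V y), dd f y (W y), \<xi> y] :: (real^4)^4) $ k"

definition MT :: "real^3 \<Rightarrow> real^4^4" where
  "MT x = vector [vector [- 2 * af x, cb x, cc x, - 1], vector [cb x, af x, w0 x, 0],
     vector [cc x, - w0 x, af x, 0], vector [- H, 0, 0, 0]]"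

definition MV :: "real^3 \<Rightarrow> real^4^4" where
  "MV x = vector [vector [0, p1 x + af x, q1 x, 0], vector [p1 x - af x, s x, w1 x, 1],
     vector [q1 x, - w1 x, - s x, 0], vector [0, - H, 0, 0]]"

definition MW :: "real^3 \<Rightarrow> real^4^4" where
  "MW x = vector [vector [0, p2 x, q2 x + af x, 0], vector [p2 x, 0, w2 x - s x, 0],
     vector [q2 x - af x, - w2 x - s x, 0, 1], vector [0, 0, - H, 0]]"

lemma e_simps [simp]: "e 1 y = dd f y (Tf y)" "e 2 y = dd f y (V y)" "e 3 y = dd f y (W y)" "e 4 y = \<xi> y"
  by (simp_all add: e_def)

lemma e_funs: "e 1 = (\<lambda>y. dd f y (Tf y))" "e 2 = (\<lambda>y. dd f y (V y))" "e 3 = (\<lambda>y. dd f y (W y))" "e 4 = \<xi>"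
  by (simp_all add: fun_eq_iff)

lemma smooth_f_S: "smooth_on S f"
  by (rule smooth_on_subset[OF smooth_f S_sub])

lemma smooth_e: "smooth_on S (e k)"
proof -
  have "\<forall>k. smooth_on S (e k)"
    unfolding forall_4 e_funs
    by (intro conjI smooth_on_dd_var open_S smooth_f_S smooth_Tf_S smooth_V smooth_W
        smooth_on_subset[OF smooth_xi S_sub])
  then show ?thesis ..
qed

lemma dd_frame_field:
  assumes x: "x \<in> S" and X: "smooth_on S X"
  shows "dd (\<lambda>y. dd f y (X y)) x u =
    dd f x (levi_civita h x u X + ktensor x u (X x)) + h x u (X x) *\<^sub>R \<xi> x"
  by (rule dd_eqI[OF gauss[OF in_U[OF x] smooth_on_has_dd[OF X x]]])

lemma frame_equations:
  assumes x: "x \<in> S"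
  shows "dd (e l) x (Tf x) = (\<Sum>m\<in>UNIV. MT x $ l $ m *\<^sub>R e m x)"
    "dd (e l) x (V x) = (\<Sum>m\<in>UNIV. MV x $ l $ m *\<^sub>R e m x)"
    "dd (e l) x (W x) = (\<Sum>m\<in>UNIV. MW x $ l $ m *\<^sub>R e m x)"
proof -
  note df = linear_add[OF linear_df[OF in_U[OF x]]] linear_diff[OF linear_df[OF in_U[OF x]]]
    linear_scale[OF linear_df[OF in_U[OF x]]] linear_neg[OF linear_df[OF in_U[OF x]]]
  note coeffs = cb_def[symmetric] cc_def[symmetric] w0_def[symmetric] p1_def[symmetric] q1_def[symmetric]
    w1_def[symmetric] p2_def[symmetric] q2_def[symmetric] w2_def[symmetric]
  note simps = dd_frame_field[OF x] smooth_Tf_S smooth_V smooth_W frame_connection[OF x] frame_ktensor[OF x]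
    frame_metric[OF x] dxi[OF in_U[OF x]] df coeffs sum_4 x scaleR_add_left scaleR_diff_left
  have "\<forall>l. dd (e l) x (Tf x) = (\<Sum>m\<in>UNIV. MT x $ l $ m *\<^sub>R e m x)"
    unfolding forall_4 e_funs by (simp add: simps MT_def)
  moreover have "\<forall>l. dd (e l) x (V x) = (\<Sum>m\<in>UNIV. MV x $ l $ m *\<^sub>R e m x)"
    unfolding forall_4 e_funs by (simp add: simps MV_def)
  moreover have "\<forall>l. dd (e l) x (W x) = (\<Sum>m\<in>UNIV. MW x $ l $ m *\<^sub>R e m x)"
    unfolding forall_4 e_funs by (simp add: simps MW_def)
  ultimately show "dd (e l) x (Tf x) = (\<Sum>m\<in>UNIV. MT x $ l $ m *\<^sub>R e m x)"
    "dd (e l) x (V x) = (\<Sum>m\<in>UNIV. MV x $ l $ m *\<^sub>R e m x)"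
    "dd (e l) x (W x) = (\<Sum>m\<in>UNIV. MW x $ l $ m *\<^sub>R e m x)"
    by blast+
qed

lemma smooth_matrices:
  "smooth_on S (\<lambda>x. MT x $ l $ m)" "smooth_on S (\<lambda>x. MV x $ l $ m)" "smooth_on S (\<lambda>x. MW x $ l $ m)"
proof -
  have "\<forall>l m. smooth_on S (\<lambda>x. MT x $ l $ m)" "\<forall>l m. smooth_on S (\<lambda>x. MV x $ l $ m)"
    "\<forall>l m. smooth_on S (\<lambda>x. MW x $ l $ m)"
    unfolding forall_4 MT_def MV_def MW_def
    by (simp_all, (intro conjI smooth_on_const[OF open_S] smooth_on_mult[OF open_S] smooth_on_add[OF open_S]
          smooth_on_diff[OF open_S] smooth_on_uminus[OF open_S] smooth_coefficients smooth_af_S smooth_s)+)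
  then show "smooth_on S (\<lambda>x. MT x $ l $ m)" "smooth_on S (\<lambda>x. MV x $ l $ m)" "smooth_on S (\<lambda>x. MW x $ l $ m)"
    by blast+
qed

lemma frame_independent:
  assumes x: "x \<in> S" and eq: "(\<Sum>m\<in>UNIV. c m *\<^sub>R e m x) = 0"
  shows "c m = 0"
proof -
  let ?Z = "c 1 *\<^sub>R Tf x + c 2 *\<^sub>R V x + c 3 *\<^sub>R W x"
  note df = linear_df[OF in_U[OF x]] and xU = in_U[OF x]
  have "dd f x ?Z + c 4 *\<^sub>R \<xi> x = dd f x 0 + 0 *\<^sub>R \<xi> x"
    using eq by (simp add: sum_4 linear_add[OF df] linear_scale[OF df] linear_0[OF df])
  then have Z: "?Z = 0" "c 4 = 0"
    using frame_unique[OF xU, of ?Z "c 4" 0 0] by simp_all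
  have "h x ?Z v = 0" for v
    unfolding Z by (simp add: bilinear_lzero[OF bilinear_metric[OF xU]])
  from this[of "Tf x"] this[of "V x"] this[of "W x"]
  have "c 1 = 0 \<and> c 2 = 0 \<and> c 3 = 0 \<and> c 4 = 0"
    unfolding bilinear_ladd[OF bilinear_metric[OF xU]] bilinear_lmul[OF bilinear_metric[OF xU]]
    by (simp add: x frame_metric[OF x] Z(2))
  then have "\<forall>m. c m = 0"
    unfolding forall_4 .
  then show ?thesis ..
qed

text \<open>\<open>D\<close> is flat: applied to each frame vector,
  \<open>X Y - Y X - [X, Y]\<close> gives zero, and coefficients may be compared because the frame
  is independent.\<close>

lemma flatness:
  assumes x: "x \<in> S" and X: "smooth_on S X" and Y: "smooth_on S Y"
    and MX: "\<And>y l. y \<in> S \<Longrightarrow> dd (e l) y (X y) = (\<Sum>m\<in>UNIV. MX y $ l $ m *\<^sub>R e m y)"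
      "\<And>l m. smooth_on S (\<lambda>y. MX y $ l $ m)"
    and MY: "\<And>y l. y \<in> S \<Longrightarrow> dd (e l) y (Y y) = (\<Sum>m\<in>UNIV. MY y $ l $ m *\<^sub>R e m y)"
      "\<And>l m. smooth_on S (\<lambda>y. MY y $ l $ m)"
    and bracket: "levi_civita h x (X x) Y - levi_civita h x (Y x) X = z0 *\<^sub>R Tf x + z1 *\<^sub>R V x + z2 *\<^sub>R W x"
  shows "dd (\<lambda>y. MY y $ l $ m) x (X x) + (\<Sum>k\<in>UNIV. MY x $ l $ k * MX x $ k $ m)
     - dd (\<lambda>y. MX y $ l $ m) x (Y x) - (\<Sum>k\<in>UNIV. MX x $ l $ k * MY x $ k $ m)
     - (z0 * MT x $ l $ m + z1 * MV x $ l $ m + z2 * MW x $ l $ m) = 0"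
proof -
  note xU = in_U[OF x]
  \<comment> \<open>Both \<open>conn\<close> and \<open>ktensor\<close> are symmetric, so the two
    covariant derivatives differ by the coordinate bracket.\<close>
  have br: "dd Y x (X x) - dd X x (Y x) = z0 *\<^sub>R Tf x + z1 *\<^sub>R V x + z2 *\<^sub>R W x"
    using bracket conn_metric_sym(1)[OF xU, of "X x" "Y x"] ktensor_sym[OF xU, of "X x" "Y x"]
    by (simp add: levi_civita_eq[OF xU])
  have second: "dd (\<lambda>y. dd (e l) y (Q y)) x (P x) =
      (\<Sum>m\<in>UNIV. (dd (\<lambda>y. MQ y $ l $ m) x (P x) + (\<Sum>k\<in>UNIV. MQ x $ l $ k * MP x $ k $ m)) *\<^sub>R e m x)"
    if Q: "\<And>y. y \<in> S \<Longrightarrow> dd (e l) y (Q y) = (\<Sum>m\<in>UNIV. MQ y $ l $ m *\<^sub>R e m y)"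
      and sQ: "\<And>m. smooth_on S (\<lambda>y. MQ y $ l $ m)"
      and P: "\<And>l. dd (e l) x (P x) = (\<Sum>m\<in>UNIV. MP x $ l $ m *\<^sub>R e m x)"
    for P Q and MP MQ :: "real^3 \<Rightarrow> real^4^4"
  proof -
    have "((\<lambda>y. \<Sum>m\<in>UNIV. MQ y $ l $ m *\<^sub>R e m y) has_derivative
        (\<lambda>u. \<Sum>m\<in>UNIV. (MQ x $ l $ m *\<^sub>R dd (e m) x u + dd (\<lambda>y. MQ y $ l $ m) x u *\<^sub>R e m x))) (at x)"
      by (rule has_derivative_sum, rule has_derivative_scaleR[OF smooth_on_has_dd[OF sQ x] smooth_on_has_dd[OF smooth_e x]])
    then have hd: "((\<lambda>y. dd (e l) y (Q y)) has_derivative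
        (\<lambda>u. \<Sum>m\<in>UNIV. (MQ x $ l $ m *\<^sub>R dd (e m) x u + dd (\<lambda>y. MQ y $ l $ m) x u *\<^sub>R e m x))) (at x)"
      by (rule has_derivative_cong_open[OF open_S x, rotated]) (simp add: Q)
    have "dd (\<lambda>y. dd (e l) y (Q y)) x (P x) =
        (\<Sum>m\<in>UNIV. (MQ x $ l $ m *\<^sub>R dd (e m) x (P x) + dd (\<lambda>y. MQ y $ l $ m) x (P x) *\<^sub>R e m x))"
      by (rule dd_eqI[OF hd])
    also have "\<dots> = (\<Sum>m\<in>UNIV. (dd (\<lambda>y. MQ y $ l $ m) x (P x) + (\<Sum>k\<in>UNIV. MQ x $ l $ k * MP x $ k $ m)) *\<^sub>R e m x)"
    proof -
      have "(\<Sum>m\<in>UNIV. MQ x $ l $ m *\<^sub>R (\<Sum>k\<in>UNIV. MP x $ m $ k *\<^sub>R e k x)) =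
          (\<Sum>m\<in>UNIV. \<Sum>k\<in>UNIV. (MQ x $ l $ m * MP x $ m $ k) *\<^sub>R e k x)"
        by (simp add: scaleR_sum_right)
      also have "\<dots> = (\<Sum>k\<in>UNIV. \<Sum>m\<in>UNIV. (MQ x $ l $ m * MP x $ m $ k) *\<^sub>R e k x)"
        by (rule sum.swap)
      finally show ?thesis
        unfolding P by (simp add: sum.distrib scaleR_add_left scaleR_sum_left add.commute)
    qed
    finally show ?thesis .
  qed
  have lin: "linear (frechet_derivative (e l) (at x))"
    by (rule smooth_on_linear_dd[OF smooth_e x])
  define A where "A m = dd (\<lambda>y. MY y $ l $ m) x (X x) + (\<Sum>k\<in>UNIV. MY x $ l $ k * MX x $ k $ m)" for m
  define B where "B m = dd (\<lambda>y. MX y $ l $ m) x (Y x) + (\<Sum>k\<in>UNIV. MX x $ l $ k * MY x $ k $ m)" for m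
  define C where "C m = z0 * MT x $ l $ m + z1 * MV x $ l $ m + z2 * MW x $ l $ m" for m
  have A: "dd (\<lambda>y. dd (e l) y (Y y)) x (X x) = (\<Sum>m\<in>UNIV. A m *\<^sub>R e m x)"
    unfolding A_def
    by (rule second[where Q = Y and MQ = MY and P = X and MP = MX, OF MY(1) MY(2) MX(1)[OF x]])
  have B: "dd (\<lambda>y. dd (e l) y (X y)) x (Y x) = (\<Sum>m\<in>UNIV. B m *\<^sub>R e m x)"
    unfolding B_def
    by (rule second[where Q = X and MQ = MX and P = Y and MP = MY, OF MX(1) MX(2) MY(1)[OF x]])
  have C: "dd (e l) x (z0 *\<^sub>R Tf x + z1 *\<^sub>R V x + z2 *\<^sub>R W x) = (\<Sum>m\<in>UNIV. C m *\<^sub>R e m x)"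
    unfolding C_def
    by (simp only: linear_add[OF lin] linear_scale[OF lin] frame_equations[OF x])
      (simp add: scaleR_add_left sum.distrib scaleR_sum_right)
  have "(\<Sum>m\<in>UNIV. A m *\<^sub>R e m x) - (\<Sum>m\<in>UNIV. B m *\<^sub>R e m x) = (\<Sum>m\<in>UNIV. C m *\<^sub>R e m x)"
    using smooth_commutator[OF open_S x smooth_e X Y, of l] unfolding br A B C .
  then have "(\<Sum>m\<in>UNIV. (A m - B m - C m) *\<^sub>R e m x) = 0"
    by (simp add: scaleR_diff_left sum_subtractf)
  from frame_independent[OF x this] have "A m - B m - C m = 0" .
  then show ?thesis
    unfolding A_def B_def C_def by simp
qed

text \<open>Here \<open>[T, V] = cb T - p1 V + (w0 - q1) W\<close>; the brackets in the next two
  equations arise from \<open>frame_connection\<close> in the same way.\<close>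

lemma flatness_TV:
  assumes x: "x \<in> S"
  shows "dd (\<lambda>y. MV y $ l $ m) x (Tf x) + (\<Sum>k\<in>UNIV. MV x $ l $ k * MT x $ k $ m)
     - dd (\<lambda>y. MT y $ l $ m) x (V x) - (\<Sum>k\<in>UNIV. MT x $ l $ k * MV x $ k $ m)
     - (cb x * MT x $ l $ m + (- p1 x) * MV x $ l $ m + (w0 x - q1 x) * MW x $ l $ m) = 0"
  by (rule flatness[OF x smooth_Tf_S smooth_V frame_equations(1) smooth_matrices(1) frame_equations(2) smooth_matrices(2)])
    (simp_all add: frame_connection[OF x] cb_def cc_def w0_def p1_def q1_def w1_def p2_def q2_def w2_def algebra_simps)

lemma flatness_TW:
  assumes x: "x \<in> S"
  shows "dd (\<lambda>y. MW y $ l $ m) x (Tf x) + (\<Sum>k\<in>UNIV. MW x $ l $ k * MT x $ k $ m)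
     - dd (\<lambda>y. MT y $ l $ m) x (W x) - (\<Sum>k\<in>UNIV. MT x $ l $ k * MW x $ k $ m)
     - (cc x * MT x $ l $ m + (- w0 x - p2 x) * MV x $ l $ m + (- q2 x) * MW x $ l $ m) = 0"
  by (rule flatness[OF x smooth_Tf_S smooth_W frame_equations(1) smooth_matrices(1) frame_equations(3) smooth_matrices(3)])
    (simp_all add: frame_connection[OF x] cb_def cc_def w0_def p1_def q1_def w1_def p2_def q2_def w2_def algebra_simps)

lemma flatness_VW:
  assumes x: "x \<in> S"
  shows "dd (\<lambda>y. MW y $ l $ m) x (V x) + (\<Sum>k\<in>UNIV. MW x $ l $ k * MV x $ k $ m)
     - dd (\<lambda>y. MV y $ l $ m) x (W x) - (\<Sum>k\<in>UNIV. MV x $ l $ k * MW x $ k $ m)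
     - ((q1 x - p2 x) * MT x $ l $ m + (- w1 x) * MV x $ l $ m + (- w2 x) * MW x $ l $ m) = 0"
  by (rule flatness[OF x smooth_V smooth_W frame_equations(2) smooth_matrices(2) frame_equations(3) smooth_matrices(3)])
    (simp_all add: frame_connection[OF x] cb_def cc_def w0_def p1_def q1_def w1_def p2_def q2_def w2_def algebra_simps)

text \<open>The shapes in which functions occur in the entries of \<open>MT\<close>,
  \<open>MV\<close>, \<open>MW\<close>; \<open>dd_simps\<close> instantiates them so that
  derivatives of entries split without smoothness side conditions.\<close>

lemma dd_sum_rules:
  fixes p q :: "real^3 \<Rightarrow> real"
  assumes "x \<in> S" "smooth_on S p" "smooth_on S q"
  shows "dd (\<lambda>y. p y + q y) x u = dd p x u + dd q x u"
    "dd (\<lambda>y. p y - q y) x u = dd p x u - dd q x u"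
    "dd (\<lambda>y. - p y - q y) x u = - dd p x u - dd q x u"
    "dd (\<lambda>y. - p y) x u = - dd p x u"
    "dd (\<lambda>y. 2 * p y) x u = 2 * dd p x u"
    "dd (\<lambda>y. - (2 * p y)) x u = - (2 * dd p x u)"
proof -
  note P = smooth_on_has_dd[OF assms(2,1)] and Q = smooth_on_has_dd[OF assms(3,1)]
  show "dd (\<lambda>y. p y + q y) x u = dd p x u + dd q x u"
    by (rule dd_eqI[OF has_derivative_add[OF P Q]])
  show "dd (\<lambda>y. p y - q y) x u = dd p x u - dd q x u"
    by (rule dd_eqI[OF has_derivative_diff[OF P Q]])
  show "dd (\<lambda>y. - p y - q y) x u = - dd p x u - dd q x u"
    by (rule dd_eqI[OF has_derivative_diff[OF has_derivative_minus[OF P] Q]])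
  show "dd (\<lambda>y. - p y) x u = - dd p x u"
    by (rule dd_eqI[OF has_derivative_minus[OF P]])
  show "dd (\<lambda>y. 2 * p y) x u = 2 * dd p x u"
    by (rule dd_eqI[OF has_derivative_mult_right[OF P]])
  show "dd (\<lambda>y. - (2 * p y)) x u = - (2 * dd p x u)"
    by (rule dd_eqI[OF has_derivative_minus[OF has_derivative_mult_right[OF P]]])
qed

lemmas dd_simps =
  dd_sum_rules(1)[OF _ smooth_af_S smooth_coefficients(4)] dd_sum_rules(1)[OF _ smooth_af_S smooth_coefficients(8)]
  dd_sum_rules(1)[OF _ smooth_coefficients(4) smooth_af_S] dd_sum_rules(2)[OF _ smooth_coefficients(4) smooth_af_S]
  dd_sum_rules(1)[OF _ smooth_coefficients(8) smooth_af_S] dd_sum_rules(2)[OF _ smooth_coefficients(8) smooth_af_S]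
  dd_sum_rules(2)[OF _ smooth_coefficients(9) smooth_s] dd_sum_rules(3)[OF _ smooth_coefficients(9) smooth_s]
  dd_sum_rules(4)[OF _ smooth_coefficients(3) smooth_s] dd_sum_rules(4)[OF _ smooth_coefficients(6) smooth_s]
  dd_sum_rules(4)[OF _ smooth_s smooth_s] dd_sum_rules(6)[OF _ smooth_af_S smooth_s]

text \<open>Entries of the flatness equations for the brackets of \<open>T, V, W\<close>, that is, the equations of Gauss and
  Codazzi in the moving frame.\<close>

lemma structure_TV:
  assumes x: "x \<in> S"
  shows
    "2 * dd af x (V x) + 4 * af x * cb x = 0"
    "dd af x (Tf x) + dd p1 x (Tf x) - dd cb x (V x) - H + 3 * af x * af x + 4 * af x * p1 x - cb x * cb x - cb
      x * s x + cc x * w1 x + p1 x * p1 x + p2 x * q1 x - p2 x * w0 x - q1 x * w0 x = 0"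
    "dd q1 x (Tf x) - dd cc x (V x) + 4 * af x * q1 x - cb x * cc x - cb x * w1 x + cc x * s x + p1 x * q1 x +
      p1 x * w0 x + q1 x * q2 x - q2 x * w0 x = 0"
    "-dd af x (Tf x) + dd p1 x (Tf x) - dd cb x (V x) - H + 3 * af x * af x - 4 * af x * p1 x - cb x * cb x + cb
      x * s x + cc x * w1 x + p1 x * p1 x + p2 x * q1 x - p2 x * w0 x - q1 x * w0 x = 0"
    "dd s x (Tf x) - dd af x (V x) - 3 * af x * cb x + p1 x * s x = 0"
    "dd w1 x (Tf x) - dd w0 x (V x) - af x * cc x - cb x * q1 x - cb x * w0 x + cc x * p1 x + p1 x * w1 x - q1 x
      * s x + q1 x * w2 x + 3 * s x * w0 x - w0 x * w2 x = 0"
    "dd q1 x (Tf x) - dd cc x (V x) - 4 * af x * q1 x - cb x * cc x - cb x * w1 x - cc x * s x + p1 x * q1 x +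
      p1 x * w0 x + q1 x * q2 x - q2 x * w0 x = 0"
    "-dd w1 x (Tf x) + dd w0 x (V x) - af x * cc x + cb x * q1 x + cb x * w0 x - cc x * p1 x - p1 x * w1 x - q1
      x * s x - q1 x * w2 x + 3 * s x * w0 x + w0 x * w2 x = 0"
  using flatness_TV[OF x, of 1 1] flatness_TV[OF x, of 1 2] flatness_TV[OF x, of 1 3]
    flatness_TV[OF x, of 2 1] flatness_TV[OF x, of 2 2] flatness_TV[OF x, of 2 3]
    flatness_TV[OF x, of 3 1] flatness_TV[OF x, of 3 2]
  by (simp_all add: MT_def MV_def MW_def sum_4 dd_simps[OF x] algebra_simps)

lemma structure_TW:
  assumes x: "x \<in> S"
  shows
    "2 * dd af x (W x) + 4 * af x * cc x = 0"
    "dd af x (Tf x) + dd q2 x (Tf x) - dd cc x (W x) - H + 3 * af x * af x + 4 * af x * q2 x + cb x * s x - cb x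
      * w2 x - cc x * cc x + p2 x * q1 x + p2 x * w0 x + q1 x * w0 x + q2 x * q2 x = 0"
    "-dd af x (W x) - af x * cc x + p2 x * s x + 3 * s x * w0 x = 0"
    "-dd s x (Tf x) + dd w2 x (Tf x) - dd w0 x (W x) - af x * cb x - cb x * q2 x + cc x * p2 x - cc x * w0 x +
      p2 x * w1 x - q2 x * s x + q2 x * w2 x + w0 x * w1 x = 0"
    "-dd af x (Tf x) + dd q2 x (Tf x) - dd cc x (W x) - H + 3 * af x * af x - 4 * af x * q2 x - cb x * s x - cb
      x * w2 x - cc x * cc x + p2 x * q1 x + p2 x * w0 x + q1 x * w0 x + q2 x * q2 x = 0"
    "-dd s x (Tf x) - dd w2 x (Tf x) + dd w0 x (W x) - af x * cb x + cb x * q2 x - cc x * p2 x + cc x * w0 x -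
      p2 x * w1 x - q2 x * s x - q2 x * w2 x - w0 x * w1 x = 0"
  using flatness_TW[OF x, of 1 1] flatness_TW[OF x, of 1 3] flatness_TW[OF x, of 2 2]
    flatness_TW[OF x, of 2 3] flatness_TW[OF x, of 3 1] flatness_TW[OF x, of 3 2]
  by (simp_all add: MT_def MV_def MW_def sum_4 dd_simps[OF x] algebra_simps)

lemma structure_VW:
  assumes x: "x \<in> S"
  shows
    "-4 * af x * p2 x + 4 * af x * q1 x = 0"
    "dd p2 x (V x) - dd af x (W x) - dd p1 x (W x) + cb x * p2 x - cb x * q1 x + p1 x * w1 x + p2 x * s x + p2 x
      * w2 x + q1 x * s x + q1 x * w2 x - q2 x * w1 x = 0"
    "dd af x (V x) + dd q2 x (V x) - dd q1 x (W x) + cc x * p2 x - cc x * q1 x + p1 x * s x - p1 x * w2 x + p2 x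
      * w1 x + q1 x * w1 x - q2 x * s x + q2 x * w2 x = 0"
    "-dd s x (W x) + 3 * af x * p2 x - af x * q1 x + 3 * s x * w1 x = 0"
    "-dd s x (V x) + dd w2 x (V x) - dd w1 x (W x) + H + af x * af x - af x * p1 x + af x * q2 x - p1 x * q2 x +
      p2 x * q1 x + p2 x * w0 x - q1 x * w0 x + 2 * s x * s x - 3 * s x * w2 x + w1 x * w1 x + w2 x * w2 x = 0"
    "-dd s x (V x) - dd w2 x (V x) + dd w1 x (W x) - H - af x * af x - af x * p1 x + af x * q2 x + p1 x * q2 x -
      p2 x * q1 x - p2 x * w0 x + q1 x * w0 x - 2 * s x * s x - 3 * s x * w2 x - w1 x * w1 x - w2 x * w2 x = 0"
  using flatness_VW[OF x, of 1 1] flatness_VW[OF x, of 1 2] flatness_VW[OF x, of 1 3]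
    flatness_VW[OF x, of 2 2] flatness_VW[OF x, of 2 3] flatness_VW[OF x, of 3 2]
  by (simp_all add: MT_def MV_def MW_def sum_4 dd_simps[OF x] algebra_simps)

text \<open>The connection part of the frame matrices is skew and the \<open>K\<close> part
  symmetric with respect to \<open>h\<close>. Adding or subtracting the equations for transposed
  entries therefore removes the curvature; the diagonal entries do not contain it in the first
  place.\<close>

lemma codazzi:
  assumes x: "x \<in> S"
  shows "dd af x (V x) = - 2 * af x * cb x" "dd af x (W x) = - 2 * af x * cc x"
    "dd af x (Tf x) = - 4 * af x * p1 x + cb x * s x" "dd af x (Tf x) = - 4 * af x * q2 x - cb x * s x"
    "4 * af x * q1 x = - cc x * s x" "p2 x = q1 x"
    "dd s x (Tf x) = af x * cb x - p1 x * s x" "dd s x (Tf x) = - af x * cb x - q2 x * s x"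
    "3 * s x * w0 x = af x * cc x + s x * q1 x" "3 * s x * w0 x = - af x * cc x - s x * q1 x"
    "3 * s x * w1 x = dd s x (W x) - 2 * af x * q1 x"
    "3 * s x * w2 x = - dd s x (V x) - af x * (p1 x - q2 x)"
proof -
  note TV = structure_TV[OF x] and TW = structure_TW[OF x] and VW = structure_VW[OF x]
  show a: "dd af x (V x) = - 2 * af x * cb x" "dd af x (W x) = - 2 * af x * cc x"
    using TV(1) TW(1) by simp_all
  show "dd af x (Tf x) = - 4 * af x * p1 x + cb x * s x"
    using TV(2,4) by linarith
  show "dd af x (Tf x) = - 4 * af x * q2 x - cb x * s x"
    using TW(2,5) by linarith
  show "4 * af x * q1 x = - cc x * s x"
    using TV(3,7) by (simp add: algebra_simps)
  show p2: "p2 x = q1 x"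
    using VW(1) af_pos[OF in_U[OF x]] by simp
  show "dd s x (Tf x) = af x * cb x - p1 x * s x"
    using TV(5) a by (simp add: algebra_simps)
  show "dd s x (Tf x) = - af x * cb x - q2 x * s x"
    using TW(4,6) by (simp add: algebra_simps)
  show "3 * s x * w0 x = af x * cc x + s x * q1 x"
    using TV(6,8) by (simp add: algebra_simps)
  show "3 * s x * w0 x = - af x * cc x - s x * q1 x"
    using TW(3) a p2 by (simp add: algebra_simps)
  show "3 * s x * w1 x = dd s x (W x) - 2 * af x * q1 x"
    using VW(4) p2 by (simp add: algebra_simps)
  show "3 * s x * w2 x = - dd s x (V x) - af x * (p1 x - q2 x)"
    using VW(5,6) by (simp add: algebra_simps)
qed

text \<open>The two formulas for \<open>da(T)\<close> give \<open>2 a (p1 - q2) = s cb\<close>,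
  those for \<open>ds(T)\<close> give \<open>2 a cb = s (p1 - q2)\<close>; eliminating
  \<open>p1 - q2\<close> leaves the factor \<open>4 a^2 - s^2\<close>. For \<open>cc\<close> the
  elimination of \<open>q1\<close> has the same effect.\<close>

lemma geodesic_or_special:
  assumes x: "x \<in> S"
  shows "cb x = 0 \<and> cc x = 0 \<or> (s x)\<^sup>2 = (2 * af x)\<^sup>2"
proof -
  note c = codazzi[OF x]
  have "(4 * (af x)\<^sup>2 - (s x)\<^sup>2) * cb x = 0"
    using c(3,4,7,8) by algebra
  moreover have "(4 * (af x)\<^sup>2 - (s x)\<^sup>2) * cc x = 0"
    using c(5,9,10) by algebra
  ultimately show ?thesis
    by (auto simp: power_mult_distrib)
qed

text \<open>If \<open>\<nabla>\<^sub>T T \<noteq> 0\<close> then \<open>a\<^sub>6 = 2 a\<^sub>4\<close> nearby, so that all connection coefficients are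
  determined by \<open>\<nabla>\<^sub>T T\<close>, and the Gauss equations are contradictory.\<close>

lemma geodesic:
  assumes s: "\<And>x. x \<in> S \<Longrightarrow> s x \<ge> 0" and x: "x \<in> S"
  shows "cb x = 0" "cc x = 0"
proof -
  have False if ne: "cb x \<noteq> 0 \<or> cc x \<noteq> 0"
  proof -
    \<comment> \<open>An open set is needed because the relation \<open>s = 2 a\<close> and its
      consequences have to be differentiated.\<close>
    define S1 where "S1 = {y \<in> S. 0 < (cb y)\<^sup>2 + (cc y)\<^sup>2}"
    have "smooth_on S (\<lambda>y. (cb y)\<^sup>2 + (cc y)\<^sup>2)"
      by (intro smooth_on_add smooth_on_power smooth_coefficients open_S)
    then have S1: "open S1" "S1 \<subseteq> S"
      unfolding S1_def using open_superlevel[OF open_S] smooth_on_continuous by auto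
    have x1: "x \<in> S1"
      using ne x by (simp add: S1_def sum_power2_gt_zero_iff)
    have s1: "s y = 2 * af y" if y: "y \<in> S1" for y
    proof -
      have yS: "y \<in> S" "0 < (cb y)\<^sup>2 + (cc y)\<^sup>2"
        using y unfolding S1_def by blast+
      have "(s y)\<^sup>2 = (2 * af y)\<^sup>2"
        using geodesic_or_special[OF yS(1)] yS(2) by (metis power_zero_numeral add.right_neutral less_irrefl)
      then show ?thesis
        using power2_eq_imp_eq[of "s y" "2 * af y"] s[OF yS(1)] af_pos[OF in_U[OF yS(1)]] by simp
    qed
    have dlocal: "dd p y u = c * dd q y u"
      if y: "y \<in> S1" and pq: "\<And>z. z \<in> S1 \<Longrightarrow> p z = c * q z" and q: "smooth_on S q"
      for p q :: "real^3 \<Rightarrow> real" and c u y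
    proof -
      have "dd p y u = dd (\<lambda>z. c * q z) y u"
        using dd_cong[OF S1(1) y, of p "\<lambda>z. c * q z"] pq by simp
      also have "\<dots> = c * dd q y u"
        by (rule dd_eqI[OF has_derivative_mult_right[OF smooth_on_has_dd[OF q subsetD[OF S1(2) y]]]])
      finally show ?thesis .
    qed
    have rel: "p1 y = (1 / 2) * cb y" "q2 y = (- 1 / 2) * cb y" "q1 y = (- 1 / 2) * cc y"
      "w0 y = 0 * cb y" "w1 y = (- 1 / 2) * cc y" "w2 y = (1 / 2) * cb y" if y: "y \<in> S1" for y
    proof -
      have yS: "y \<in> S"
        using y S1(2) by blast
      note c = codazzi[OF yS]
      have a: "af y > 0"
        by (rule af_pos[OF in_U[OF yS]])
      have ds: "dd s y u = 2 * dd af y u" for u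
        by (rule dlocal[OF y s1 smooth_af_S])
      have "af y * (6 * p1 y - 3 * cb y) = 0"
        using c(3,7) unfolding ds s1[OF y] by algebra
      then show p1: "p1 y = (1 / 2) * cb y"
        using a by simp
      have "af y * (6 * q2 y + 3 * cb y) = 0"
        using c(4,8) unfolding ds s1[OF y] by algebra
      then show q2: "q2 y = (- 1 / 2) * cb y"
        using a by simp
      have "af y * (4 * q1 y + 2 * cc y) = 0"
        using c(5) unfolding s1[OF y] by algebra
      then show q1: "q1 y = (- 1 / 2) * cc y"
        using a by simp
      have "af y * w0 y = 0"
        using c(9,10) unfolding s1[OF y] by algebra
      then show "w0 y = 0 * cb y"
        using a by simp
      have "af y * (6 * w1 y + 3 * cc y) = 0"
        using c(11) unfolding s1[OF y] ds c(2) q1 by algebra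
      then show "w1 y = (- 1 / 2) * cc y"
        using a by simp
      have "af y * (6 * w2 y - 3 * cb y) = 0"
        using c(12) unfolding s1[OF y] ds c(1) p1 q2 by algebra
      then show "w2 y = (1 / 2) * cb y"
        using a by simp
    qed
    have dl: "dd p1 x u = (1 / 2) * dd cb x u" "dd q2 x u = (- 1 / 2) * dd cb x u"
      "dd w1 x u = (- 1 / 2) * dd cc x u" "dd w2 x u = (1 / 2) * dd cb x u" "dd s x u = 2 * dd af x u" for u
      by (rule dlocal[OF x1 rel(1) smooth_coefficients(1)], assumption)
        (rule dlocal[OF x1 rel(2) smooth_coefficients(1)], assumption,
         rule dlocal[OF x1 rel(5) smooth_coefficients(2)], assumption,
         rule dlocal[OF x1 rel(6) smooth_coefficients(1)], assumption,
         rule dlocal[OF x1 s1 smooth_af_S], assumption)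
    note c = codazzi[OF x]
    have a: "af x > 0"
      by (rule af_pos[OF in_U[OF x]])
    have Ta: "dd af x (Tf x) = 0"
      using c(3) unfolding s1[OF x1] rel[OF x1] by simp
    have p2: "p2 x = (- 1 / 2) * cc x"
      using c(6) rel(3)[OF x1] by simp
    note vals = dl s1[OF x1] rel[OF x1] p2 Ta c(1)
    have 1: "dd cb x (Tf x) / 2 + 3 * (af x)\<^sup>2 - 3 / 4 * (cb x)\<^sup>2 - 1 / 4 * (cc x)\<^sup>2 - dd cb x (V x) - H = 0"
      using structure_TV(2)[OF x] unfolding vals by (simp add: power2_eq_square)
    have 2: "- dd cb x (Tf x) / 2 + 3 * (af x)\<^sup>2 - 1 / 4 * (cb x)\<^sup>2 - 3 / 4 * (cc x)\<^sup>2 - dd cc x (W x) - H = 0"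
      using structure_TW(2)[OF x] unfolding vals by (simp add: power2_eq_square)
    have 3: "(dd cb x (V x) + dd cc x (W x)) / 2 + 9 * (af x)\<^sup>2 + ((cb x)\<^sup>2 + (cc x)\<^sup>2) / 2 + H = 0"
      using structure_VW(5)[OF x] unfolding vals by (simp add: power2_eq_square field_simps)
    \<comment> \<open>The sum of 1, 2 and twice 3 is \<open>24 a^2 = 0\<close>.\<close>
    have "(af x)\<^sup>2 = 0"
      using 1 2 3 by argo
    then show False
      using a by simp
  qed
  then show "cb x = 0" "cc x = 0"
    by blast+
qed

end

section \<open>Frame-free structure equations\<close>

context symmetric_chart
begin

text \<open>With \<open>T\<close> geodesic, Codazzi reads \<open>da(T) = - 4 a n\<close>. Taking
  this as the definition makes \<open>n\<close> smooth on the whole chart and independent of frames;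
  that it equals \<open>a22\<close> is shown in \<open>a22_eq\<close>.\<close>

definition "nf x = - dd af x (Tf x) / (4 * af x)"

lemma smooth_nf: "smooth_on U nf"
proof -
  have "smooth_on U (\<lambda>x. - dd af x (Tf x) / (4 * af x))"
    by (intro smooth_on_divide smooth_on_uminus smooth_on_mult smooth_on_dd_var smooth_on_const open_U
        smooth_af smooth_Tf) (use af_pos in force)
  then show ?thesis
    by (simp add: nf_def[abs_def])
qed

text \<open>With \<open>cb = cc = 0\<close> Codazzi leaves \<open>q1 = p2 = 0\<close> and
  \<open>p1 = q2 = n\<close>; one Gauss equation then gives \<open>dn(T)\<close>, and two further
  structure equations make \<open>n\<close> constant along \<open>V\<close> and \<open>W\<close>.
  The signs in the formulas come from \<open>h(T, T) = -1\<close>: the coefficient of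
  \<open>T\<close> in \<open>u\<close> is \<open>- h(u, T)\<close>.\<close>

lemma symmetric_chart_structure:
  assumes x: "x \<in> U"
  shows "levi_civita h x u Tf = nf x *\<^sub>R (u + h x u (Tf x) *\<^sub>R Tf x)"
    "dd af x u = 4 * af x * nf x * h x u (Tf x)"
    "dd nf x u = - (H - (nf x)\<^sup>2 - 3 * (af x)\<^sup>2) * h x u (Tf x)"
proof -
  obtain S V W s where S: "open S" "S \<subseteq> U" "x \<in> S" "smooth_on S V" "smooth_on S W" "smooth_on S s"
    and fr0: "\<forall>x\<in>S. canonical_frame f \<xi> x (Tf x) (V x) (W x) (af x) (s x) \<and> s x \<ge> 0"
    using smooth_canonical_frame[OF x] by (elim exE conjE) (rule that)
  have fr: "canonical_frame f \<xi> y (Tf y) (V y) (W y) (af y) (s y)" and s0: "s y \<ge> 0" if "y \<in> S" for y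
    using fr0 that by blast+
  interpret framed_chart U f \<xi> H S V W s
    by unfold_locales (use S fr in auto)
  note xS = S(3)
  have geo: "cb y = 0" "cc y = 0" if "y \<in> S" for y
    using geodesic[OF s0 that] by blast+
  have co: "q1 y = 0" "p2 y = 0" "nf y = p1 y" "q2 y = p1 y" if y: "y \<in> S" for y
  proof -
    have a: "af y > 0"
      by (rule af_pos[OF in_U[OF y]])
    note c = codazzi[OF y]
    show "q1 y = 0"
      using c(5) a by (simp add: geo[OF y])
    then show "p2 y = 0"
      using c(6) by simp
    show "nf y = p1 y"
      using c(3) a by (simp add: geo[OF y] nf_def)
    have "af y * q2 y = af y * p1 y"
      using c(3,4) by (simp add: geo[OF y])
    then show "q2 y = p1 y"
      using a by simp
  qed
  have d0: "dd p x u = 0" if "\<And>y. y \<in> S \<Longrightarrow> p y = 0" for p :: "real^3 \<Rightarrow> real" and u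
    using dd_cong[OF open_S xS, of p "\<lambda>y. 0"] that by simp
  have dn: "dd nf x u = dd p1 x u" "dd q2 x u = dd p1 x u" for u
    using dd_cong[OF open_S xS, of nf p1] dd_cong[OF open_S xS, of q2 p1] co by simp_all
  note z = d0[OF geo(1)] d0[OF geo(2)] d0[OF co(1)] d0[OF co(2)] geo[OF xS] co[OF xS] dn(2)
  note c = codazzi[OF xS]
  have a: "af x > 0"
    by (rule af_pos[OF x])
  have da: "dd af x (Tf x) = - 4 * af x * nf x" "dd af x (V x) = 0" "dd af x (W x) = 0"
    using c(1-3) by (simp_all add: z)
  have dp: "dd p1 x (Tf x) = H - (nf x)\<^sup>2 - 3 * (af x)\<^sup>2"
    using structure_TV(2)[OF xS] da by (simp add: z power2_eq_square)
  have dpV: "dd p1 x (V x) = 0"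
    using structure_VW(3)[OF xS] da by (simp add: z)
  have dpW: "dd p1 x (W x) = 0"
    using structure_VW(2)[OF xS] da by (simp add: z)
  let ?e = "- (h x u (Tf x) *\<^sub>R Tf x) + h x u (V x) *\<^sub>R V x + h x u (W x) *\<^sub>R W x"
  have u: "u = ?e"
    by (rule lorentz_expansion[OF x canonical_frameD(1)[OF x fr[OF xS]]])
  have lin: "linear (frechet_derivative af (at x))" "linear (frechet_derivative nf (at x))"
    by (rule smooth_on_linear_dd[OF smooth_af x], rule smooth_on_linear_dd[OF smooth_nf x])
  have expand: "L u = - (h x u (Tf x) *\<^sub>R L (Tf x)) + h x u (V x) *\<^sub>R L (V x) + h x u (W x) *\<^sub>R L (W x)"
    if "linear L" for L :: "real^3 \<Rightarrow> 'z::real_vector"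
    using arg_cong[where f = L, OF u]
    by (simp only: linear_add[OF that] linear_neg[OF that] linear_scale[OF that])
  show "dd af x u = 4 * af x * nf x * h x u (Tf x)"
    using expand[OF lin(1)] da by simp
  show "dd nf x u = - (H - (nf x)\<^sup>2 - 3 * (af x)\<^sup>2) * h x u (Tf x)"
    using expand[OF lin(2)] by (simp add: dn(1) dp dpV dpW algebra_simps)
  have linL: "linear (\<lambda>u. levi_civita h x u Tf)"
  proof -
    have "linear (\<lambda>u. dd Tf x u + (conn x u (Tf x) - ktensor x u (Tf x)))"
      using smooth_on_linear_dd[OF smooth_Tf x] conn_metric_linear(1)[OF x] bilinear_ktensor[OF x]
      unfolding bilinear_def by (intro linear_compose_add linear_compose_sub) blast+
    then show ?thesis
      by (simp add: levi_civita_eq[OF x])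
  qed
  have "levi_civita h x u Tf = - (h x u (Tf x) *\<^sub>R (cb x *\<^sub>R V x + cc x *\<^sub>R W x)) +
      h x u (V x) *\<^sub>R (p1 x *\<^sub>R V x + q1 x *\<^sub>R W x) + h x u (W x) *\<^sub>R (p2 x *\<^sub>R V x + q2 x *\<^sub>R W x)"
    unfolding cb_def cc_def p1_def q1_def p2_def q2_def frame_connection(1)[OF xS, symmetric]
    by (rule expand[OF linL])
  also have "\<dots> = h x u (V x) *\<^sub>R (nf x *\<^sub>R V x) + h x u (W x) *\<^sub>R (nf x *\<^sub>R W x)"
    by (simp add: z)
  also have "\<dots> = nf x *\<^sub>R (?e + h x u (Tf x) *\<^sub>R Tf x)"
    by (simp add: algebra_simps)
  finally show "levi_civita h x u Tf = nf x *\<^sub>R (u + h x u (Tf x) *\<^sub>R Tf x)"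
    unfolding u[symmetric] .
qed

end

section \<open>The invariant splitting\<close>

lemma has_derivative_eqI:
  "(f has_derivative f') F \<Longrightarrow> (\<And>u. f' u = g' u) \<Longrightarrow> (f has_derivative g') F"
proof -
  assume "(f has_derivative f') F" and "\<And>u. f' u = g' u"
  moreover from this have "f' = g'" by blast
  ultimately show ?thesis by simp
qed

context symmetric_chart
begin

text \<open>The immersed \<open>T\<close>, the function \<open>q\<close>, the vector fields \<open>\<eta>\<close> and \<open>\<nu>\<close>, and the covector field \<open>\<lambda>\<close>.\<close>

definition "tt x = dd f x (Tf x)"
definition "qf x = (nf x)\<^sup>2 - (af x)\<^sup>2 - H"
definition "et x = (nf x - af x) *\<^sub>R tt x + \<xi> x"
definition "nu x = H *\<^sub>R tt x + (nf x + af x) *\<^sub>R \<xi> x"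
definition "lamf x w = h x (tangential f \<xi> x w) (Tf x) + (nf x - af x) * transversal f \<xi> x w"

lemma nf_has_derivative:
  assumes x: "x \<in> U"
  shows "(nf has_derivative (\<lambda>u. - (H - (nf x)\<^sup>2 - 3 * (af x)\<^sup>2) * h x u (Tf x))) (at x)"
    "(af has_derivative (\<lambda>u. 4 * af x * nf x * h x u (Tf x))) (at x)"
  using smooth_on_has_dd[OF smooth_nf x] smooth_on_has_dd[OF smooth_af x]
  unfolding symmetric_chart_structure[OF x, abs_def] by simp_all

lemma xi_has_derivative: "x \<in> U \<Longrightarrow> (\<xi> has_derivative (\<lambda>u. - (H *\<^sub>R dd f x u))) (at x)"
  by (rule has_derivative_eqI[OF smooth_on_has_dd[OF smooth_xi]]) (simp_all add: dxi)

lemma tt_has_derivative: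
  assumes x: "x \<in> U"
  shows "(tt has_derivative (\<lambda>u. (nf x + af x) *\<^sub>R dd f x u +
    h x u (Tf x) *\<^sub>R ((nf x + 3 * af x) *\<^sub>R tt x + \<xi> x))) (at x)"
proof -
  have "(tt has_derivative (\<lambda>u. dd f x (levi_civita h x u Tf + ktensor x u (Tf x)) + h x u (Tf x) *\<^sub>R \<xi> x)) (at x)"
    using gauss[OF x smooth_on_has_dd[OF smooth_Tf x]] by (simp add: tt_def[abs_def])
  moreover have "dd f x (levi_civita h x u Tf + ktensor x u (Tf x)) + h x u (Tf x) *\<^sub>R \<xi> x =
      (nf x + af x) *\<^sub>R dd f x u + h x u (Tf x) *\<^sub>R ((nf x + 3 * af x) *\<^sub>R tt x + \<xi> x)" for u
  proof -
    have "levi_civita h x u Tf + ktensor x u (Tf x) =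
        (nf x + af x) *\<^sub>R u + (h x u (Tf x) * (nf x + 3 * af x)) *\<^sub>R Tf x"
      unfolding symmetric_chart_structure(1)[OF x] ktensor_sym[OF x, of u] ktensor_Tf[OF x]
      by (simp add: algebra_simps)
    then show ?thesis
      using linear_df[OF x] by (simp add: linear_add linear_scale tt_def algebra_simps)
  qed
  ultimately show ?thesis
    by simp
qed

lemma qf_has_derivative:
  assumes x: "x \<in> U"
  shows "(qf has_derivative (\<lambda>u. 2 * nf x * h x u (Tf x) * qf x)) (at x)"
proof -
  have "((\<lambda>x. nf x * nf x - af x * af x - H) has_derivative (\<lambda>u.
      (nf x * (- (H - (nf x)\<^sup>2 - 3 * (af x)\<^sup>2) * h x u (Tf x)) + (- (H - (nf x)\<^sup>2 - 3 * (af x)\<^sup>2) * h x u (Tf x)) * nf x) -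
      (af x * (4 * af x * nf x * h x u (Tf x)) + (4 * af x * nf x * h x u (Tf x)) * af x) - 0)) (at x)"
    by (intro has_derivative_diff has_derivative_mult has_derivative_const nf_has_derivative x)
  then show ?thesis
    by (simp add: qf_def[abs_def] power2_eq_square algebra_simps)
qed

text \<open>In the basis \<open>T, \<xi>\<close> the pair \<open>\<eta>, \<nu>\<close> has
  determinant \<open>q\<close>; this solves for \<open>T\<close>.\<close>

lemma tt_decomposition: "qf x *\<^sub>R tt x = (nf x + af x) *\<^sub>R et x - nu x"
  by (simp add: qf_def et_def nu_def power2_eq_square algebra_simps)

text \<open>For \<open>u\<close> orthogonal to \<open>T\<close> only \<open>q df(u)\<close> remains:
  along a slice \<open>\<eta> / q\<close> moves like the hypersurface itself, which is why it
  becomes the position vector of the surface.\<close>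

lemma et_has_derivative:
  assumes x: "x \<in> U"
  shows "(et has_derivative (\<lambda>u. qf x *\<^sub>R (dd f x u + h x u (Tf x) *\<^sub>R tt x) +
    (h x u (Tf x) * (nf x - af x)) *\<^sub>R et x)) (at x)"
proof -
  have "((\<lambda>x. (nf x - af x) *\<^sub>R tt x + \<xi> x) has_derivative (\<lambda>u.
     ((nf x - af x) *\<^sub>R ((nf x + af x) *\<^sub>R dd f x u + h x u (Tf x) *\<^sub>R ((nf x + 3 * af x) *\<^sub>R tt x + \<xi> x)) +
     (- (H - (nf x)\<^sup>2 - 3 * (af x)\<^sup>2) * h x u (Tf x) - 4 * af x * nf x * h x u (Tf x)) *\<^sub>R tt x) +
     - (H *\<^sub>R dd f x u))) (at x)"
    by (intro has_derivative_add has_derivative_scaleR has_derivative_diff nf_has_derivative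
        tt_has_derivative xi_has_derivative x)
  then show ?thesis
    unfolding et_def[abs_def] qf_def
    by (rule has_derivative_eqI) (simp add: vec_eq_iff power2_eq_square algebra_simps)
qed

lemma nu_has_derivative:
  assumes x: "x \<in> U"
  shows "(nu has_derivative (\<lambda>u. ((nf x + 3 * af x) * h x u (Tf x)) *\<^sub>R nu x)) (at x)"
proof -
  have "((\<lambda>x. H *\<^sub>R tt x + (nf x + af x) *\<^sub>R \<xi> x) has_derivative (\<lambda>u.
     H *\<^sub>R ((nf x + af x) *\<^sub>R dd f x u + h x u (Tf x) *\<^sub>R ((nf x + 3 * af x) *\<^sub>R tt x + \<xi> x)) +
     ((nf x + af x) *\<^sub>R - (H *\<^sub>R dd f x u) +
     (- (H - (nf x)\<^sup>2 - 3 * (af x)\<^sup>2) * h x u (Tf x) + 4 * af x * nf x * h x u (Tf x)) *\<^sub>R \<xi> x))) (at x)"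
    by (intro has_derivative_add has_derivative_scaleR has_derivative_scaleR_right nf_has_derivative
        tt_has_derivative xi_has_derivative x)
  then show ?thesis
    unfolding nu_def[abs_def]
    by (rule has_derivative_eqI) (simp add: vec_eq_iff power2_eq_square algebra_simps)
qed

lemma lamf_eq: "x \<in> U \<Longrightarrow> lamf x (dd f x u + c *\<^sub>R \<xi> x) = h x u (Tf x) + (nf x - af x) * c"
  using tangential_transversal_eq[of x "dd f x u + c *\<^sub>R \<xi> x" u c] by (simp add: lamf_def)

lemma linear_lamf:
  assumes x: "x \<in> U"
  shows "linear (lamf x)"
proof (rule linearI)
  note d = frame_decomposition[OF x] and df = linear_df[OF x] and b = bilinear_metric[OF x]
  let ?t = "tangential f \<xi> x" and ?c = "transversal f \<xi> x"
  have add: "dd f x (?t w + ?t w') + (?c w + ?c w') *\<^sub>R \<xi> x = w + w'" for w w'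
  proof -
    have "dd f x (?t w + ?t w') + (?c w + ?c w') *\<^sub>R \<xi> x =
        (dd f x (?t w) + ?c w *\<^sub>R \<xi> x) + (dd f x (?t w') + ?c w' *\<^sub>R \<xi> x)"
      by (simp add: linear_add[OF df] algebra_simps)
    then show ?thesis
      unfolding d[symmetric] .
  qed
  show "lamf x (w + w') = lamf x w + lamf x w'" for w w'
    using lamf_eq[OF x, of "?t w + ?t w'" "?c w + ?c w'"] unfolding add
    by (simp add: lamf_def[of _ w] lamf_def[of _ w'] bilinear_ladd[OF b] algebra_simps)
  have scale: "dd f x (r *\<^sub>R ?t w) + (r * ?c w) *\<^sub>R \<xi> x = r *\<^sub>R w" for r w
  proof -
    have "dd f x (r *\<^sub>R ?t w) + (r * ?c w) *\<^sub>R \<xi> x = r *\<^sub>R (dd f x (?t w) + ?c w *\<^sub>R \<xi> x)"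
      by (simp add: linear_scale[OF df] algebra_simps)
    then show ?thesis
      unfolding d[symmetric] .
  qed
  show "lamf x (r *\<^sub>R w) = r *\<^sub>R lamf x w" for r w
    using lamf_eq[OF x, of "r *\<^sub>R ?t w" "r * ?c w"] unfolding scale
    by (simp add: lamf_def[of _ w] bilinear_lmul[OF b] algebra_simps)
qed

lemma lamf_tangent: "x \<in> U \<Longrightarrow> lamf x (dd f x u) = h x u (Tf x)"
  using lamf_eq[of x u 0] by simp

lemma lamf_et: "x \<in> U \<Longrightarrow> lamf x (et x) = 0"
  using lamf_eq[of x "(nf x - af x) *\<^sub>R Tf x" 1] Tf_timelike[of x]
  by (simp add: et_def tt_def linear_scale[OF linear_df] metric_bilinear)

lemma lamf_nu: "x \<in> U \<Longrightarrow> lamf x (nu x) = qf x"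
  using lamf_eq[of x "H *\<^sub>R Tf x" "nf x + af x"] Tf_timelike[of x]
  by (simp add: nu_def tt_def qf_def linear_scale[OF linear_df] metric_bilinear power2_eq_square algebra_simps)

text \<open>The constant vector \<open>w\<close> is written as \<open>Z + c \<xi>\<close>; setting
  its derivative to zero gives \<open>\<nabla> Z\<close> and \<open>dc\<close>, and the rest is the
  structure equations. The result is again a multiple of \<open>lamf\<close>, so the kernel does not
  move.\<close>

lemma lamf_has_derivative:
  assumes x: "x \<in> U"
  shows "((\<lambda>x. lamf x w) has_derivative (\<lambda>u. (nf x - 3 * af x) * h x u (Tf x) * lamf x w)) (at x)"
proof -
  define Z where "Z y = tangential f \<xi> y w" for y
  define c where "c y = transversal f \<xi> y w" for y
  have w: "w = dd f y (Z y) + c y *\<^sub>R \<xi> y" if "y \<in> U" for y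
    unfolding Z_def c_def by (rule frame_decomposition[OF that])
  have sZ: "smooth_on U Z" and sc: "smooth_on U c"
    unfolding Z_def[abs_def] c_def[abs_def] by (intro smooth_components smooth_on_const open_U)+
  note dZ = smooth_on_has_dd[OF sZ x] and dc = smooth_on_has_dd[OF sc x]
  have "((\<lambda>y. dd f y (Z y) + c y *\<^sub>R \<xi> y) has_derivative
      (\<lambda>u. (dd f x (levi_civita h x u Z + ktensor x u (Z x)) + h x u (Z x) *\<^sub>R \<xi> x) +
        (c x *\<^sub>R - (H *\<^sub>R dd f x u) + dd c x u *\<^sub>R \<xi> x))) (at x)"
    by (intro has_derivative_add has_derivative_scaleR gauss[OF x dZ] xi_has_derivative dc x)
  then have "((\<lambda>y. w) has_derivative
      (\<lambda>u. (dd f x (levi_civita h x u Z + ktensor x u (Z x)) + h x u (Z x) *\<^sub>R \<xi> x) +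
        (c x *\<^sub>R - (H *\<^sub>R dd f x u) + dd c x u *\<^sub>R \<xi> x))) (at x)"
    by (rule has_derivative_cong_open[OF open_U x, rotated]) (rule w[symmetric])
  note hd = has_derivative_unique[OF has_derivative_const this]
  have eqs: "levi_civita h x u Z = - ktensor x u (Z x) + (c x * H) *\<^sub>R u" "dd c x u = - h x u (Z x)" for u
  proof -
    have "dd f x (levi_civita h x u Z + ktensor x u (Z x) - (c x * H) *\<^sub>R u) + (h x u (Z x) + dd c x u) *\<^sub>R \<xi> x
        = dd f x 0 + 0 *\<^sub>R \<xi> x"
      using fun_cong[OF hd, of u] linear_df[OF x]
      by (simp add: linear_add linear_diff linear_scale linear_0 algebra_simps)
    from frame_unique[OF x this]
    show "levi_civita h x u Z = - ktensor x u (Z x) + (c x * H) *\<^sub>R u" "dd c x u = - h x u (Z x)"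
      by (simp_all add: algebra_simps)
  qed
  have "((\<lambda>y. h y (Z y) (Tf y) + (nf y - af y) * c y) has_derivative
      (\<lambda>u. (h x (levi_civita h x u Z) (Tf x) + h x (Z x) (levi_civita h x u Tf)) +
        ((nf x - af x) * dd c x u +
         (- (H - (nf x)\<^sup>2 - 3 * (af x)\<^sup>2) * h x u (Tf x) - 4 * af x * nf x * h x u (Tf x)) * c x))) (at x)"
    by (intro has_derivative_add has_derivative_mult has_derivative_diff nf_has_derivative
        metric_derivative[OF x dZ smooth_on_has_dd[OF smooth_Tf x]] dc x)
  moreover have "h x (ktensor x u (Z x)) (Tf x) = af x * (h x u (Z x) + 3 * h x u (Tf x) * h x (Z x) (Tf x))" for u
  proof -
    have "h x (ktensor x u (Z x)) (Tf x) = h x (ktensor x (Tf x) u) (Z x)"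
      using ktensor_metric_sym[OF x, of u "Z x" "Tf x"] ktensor_sym[OF x, of u "Tf x"] by simp
    then show ?thesis
      using conn_metric_sym(2)[OF x, of "Tf x" "Z x"] by (simp add: ktensor_Tf[OF x] metric_bilinear x)
  qed
  ultimately have "((\<lambda>y. h y (Z y) (Tf y) + (nf y - af y) * c y) has_derivative
      (\<lambda>u. (nf x - 3 * af x) * h x u (Tf x) * (h x (Z x) (Tf x) + (nf x - af x) * c x))) (at x)"
    using conn_metric_sym(2)[OF x, of "Z x"]
    by (simp add: eqs symmetric_chart_structure(1)[OF x] metric_bilinear x power2_eq_square algebra_simps)
  then show ?thesis
    by (simp add: lamf_def[abs_def] Z_def c_def)
qed

lemma zero_derivative_locally_constant:
  fixes g :: "real^3 \<Rightarrow> 'z::real_normed_vector"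
  assumes "\<And>y. y \<in> U \<Longrightarrow> (g has_derivative (\<lambda>u. 0)) (at y)"
    and "ball x r \<subseteq> U" "y \<in> ball x r"
  shows "g y = g x"
proof -
  obtain c where c: "\<And>z. z \<in> ball x r \<Longrightarrow> g z = c"
    using has_derivative_zero_constant[OF convex_ball, of x r g] assms has_derivative_at_withinI by blast
  moreover have "x \<in> ball x r"
    using assms(3) by (meson centre_in_ball mem_ball zero_le_dist le_less_trans)
  ultimately show ?thesis
    using assms(3) by metis
qed

text \<open>The linear equations for \<open>q\<close> and \<open>a\<close> have rates
  \<open>2 n h(u, T)\<close> and \<open>4 n h(u, T)\<close>, which explains the square root. Only
  \<open>a\<close> is inverted, since zeros of \<open>q\<close> are not yet excluded.\<close>

lemma qf_ratio_constant:
  assumes x: "x \<in> U"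
  shows "((\<lambda>x. qf x * (1 / sqrt (af x))) has_derivative (\<lambda>u. 0)) (at x)"
proof -
  have a: "af x > 0"
    by (rule af_pos[OF x])
  have "((\<lambda>x. sqrt (af x)) has_derivative (\<lambda>u. (4 * af x * nf x * h x u (Tf x)) * (inverse (sqrt (af x)) / 2))) (at x)"
  proof -
    have "(sqrt has_derivative (\<lambda>u. u * (inverse (sqrt (af x)) / 2))) (at (af x))"
      using DERIV_real_sqrt[OF a] unfolding has_field_derivative_def by (rule has_derivative_eqI) simp
    from has_derivative_chain[OF nf_has_derivative(2)[OF x] this refl] show ?thesis .
  qed
  then have "((\<lambda>x. qf x / sqrt (af x)) has_derivative (\<lambda>u.
     (2 * nf x * h x u (Tf x) * qf x * sqrt (af x) -
      qf x * ((4 * af x * nf x * h x u (Tf x)) * (inverse (sqrt (af x)) / 2))) / (sqrt (af x) * sqrt (af x)))) (at x)"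
    by (intro has_derivative_divide' qf_has_derivative x) (use a in auto)
  then have hd: "((\<lambda>x. qf x * (1 / sqrt (af x))) has_derivative (\<lambda>u.
     (2 * nf x * h x u (Tf x) * qf x * sqrt (af x) -
      qf x * ((4 * af x * nf x * h x u (Tf x)) * (inverse (sqrt (af x)) / 2))) / (sqrt (af x) * sqrt (af x)))) (at x)"
    by simp
  have s: "af x * inverse (sqrt (af x)) = sqrt (af x)"
    using a by (simp add: real_div_sqrt divide_inverse[symmetric])
  show ?thesis
  proof (rule has_derivative_eqI[OF hd])
    fix u
    have "qf x * ((4 * af x * nf x * h x u (Tf x)) * (inverse (sqrt (af x)) / 2)) =
        2 * nf x * h x u (Tf x) * qf x * (af x * inverse (sqrt (af x)))"
      by simp
    also have "\<dots> = 2 * nf x * h x u (Tf x) * qf x * sqrt (af x)"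
      by (simp only: s)
    finally show "(2 * nf x * h x u (Tf x) * qf x * sqrt (af x) -
      qf x * ((4 * af x * nf x * h x u (Tf x)) * (inverse (sqrt (af x)) / 2))) / (sqrt (af x) * sqrt (af x)) = 0"
      by (simp only: diff_self div_0)
  qed
qed

text \<open>This is the projection onto the line of \<open>\<nu>\<close> along the kernel of
  \<open>\<lambda>\<close>. The rates \<open>n + 3 a\<close> of \<open>\<nu>\<close> and
  \<open>n - 3 a\<close> of \<open>\<lambda>\<close> add up to \<open>2 n\<close>, the rate of
  \<open>q\<close>, and cancel in the quotient.\<close>

lemma projection_constant:
  assumes x: "x \<in> U" and q: "qf x \<noteq> 0"
  shows "((\<lambda>x. (lamf x w / qf x) *\<^sub>R nu x) has_derivative (\<lambda>u. 0)) (at x)"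
proof -
  have "((\<lambda>x. (lamf x w / qf x) *\<^sub>R nu x) has_derivative (\<lambda>u.
     (lamf x w / qf x) *\<^sub>R (((nf x + 3 * af x) * h x u (Tf x)) *\<^sub>R nu x) +
     (((nf x - 3 * af x) * h x u (Tf x) * lamf x w * qf x - lamf x w * (2 * nf x * h x u (Tf x) * qf x)) / (qf x * qf x))
        *\<^sub>R nu x)) (at x)"
    by (intro has_derivative_scaleR has_derivative_divide' nf_has_derivative lamf_has_derivative
        qf_has_derivative nu_has_derivative x q)
  moreover have "(lamf x w / qf x) *\<^sub>R (((nf x + 3 * af x) * h x u (Tf x)) *\<^sub>R nu x) +
     (((nf x - 3 * af x) * h x u (Tf x) * lamf x w * qf x - lamf x w * (2 * nf x * h x u (Tf x) * qf x)) / (qf x * qf x))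
        *\<^sub>R nu x = 0" for u
  proof -
    have "(lamf x w / qf x) * ((nf x + 3 * af x) * h x u (Tf x)) +
     (((nf x - 3 * af x) * h x u (Tf x) * lamf x w * qf x - lamf x w * (2 * nf x * h x u (Tf x) * qf x)) / (qf x * qf x)) = 0"
      using q by (simp add: field_simps)
    then show ?thesis
      by (simp add: scaleR_add_left[symmetric])
  qed
  ultimately show ?thesis
    by simp
qed

text \<open>For \<open>k = h(u, T)\<close> the derivative of \<open>\<eta> / q\<close> is
  \<open>df(u) - (k / q) \<nu>\<close>, once \<open>T\<close> is expressed through
  \<open>\<eta>\<close> and \<open>\<nu>\<close>. What is left of \<open>df(u)\<close> is
  \<open>(k / q) \<nu>\<close>, and this is the derivative of the last term because
  \<open>\<lambda>(df(u)) = k\<close>.\<close>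

lemma center_constant:
  assumes x: "x \<in> U" and q: "\<And>x. x \<in> U \<Longrightarrow> qf x \<noteq> 0"
  shows "((\<lambda>x. f x - (1 / qf x) *\<^sub>R et x - (lamf x (f x) / qf x) *\<^sub>R nu x) has_derivative (\<lambda>u. 0)) (at x)"
proof -
  note q0 = q[OF x]
  \<comment> \<open>By \<open>projection_constant\<close> the family of projections has derivative
    zero, so only its argument \<open>f\<close> contributes.\<close>
  have "((\<lambda>y. (lamf y (f y) / qf y) *\<^sub>R nu y) has_derivative
      (\<lambda>u. 0 + (lamf x (dd f x u) / qf x) *\<^sub>R nu x)) (at x)"
    by (rule linear_family_has_derivative[OF open_U x _ projection_constant[OF x q0] smooth_on_has_dd[OF smooth_f x]])
      (rule linear_compose2[OF linear_lamf], assumption,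
        rule linearI, simp_all add: add_divide_distrib scaleR_add_left)
  moreover have "((\<lambda>y. (1 / qf y) *\<^sub>R et y) has_derivative (\<lambda>u.
      (1 / qf x) *\<^sub>R (qf x *\<^sub>R (dd f x u + h x u (Tf x) *\<^sub>R tt x) + (h x u (Tf x) * (nf x - af x)) *\<^sub>R et x) +
      ((0 * qf x - 1 * (2 * nf x * h x u (Tf x) * qf x)) / (qf x * qf x)) *\<^sub>R et x)) (at x)"
    by (intro has_derivative_scaleR has_derivative_divide' has_derivative_const qf_has_derivative et_has_derivative x q0)
  ultimately have "((\<lambda>x. f x - (1 / qf x) *\<^sub>R et x - (lamf x (f x) / qf x) *\<^sub>R nu x) has_derivative (\<lambda>u. dd f x u -
      ((1 / qf x) *\<^sub>R (qf x *\<^sub>R (dd f x u + h x u (Tf x) *\<^sub>R tt x) + (h x u (Tf x) * (nf x - af x)) *\<^sub>R et x) +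
      ((0 * qf x - 1 * (2 * nf x * h x u (Tf x) * qf x)) / (qf x * qf x)) *\<^sub>R et x) -
      (0 + (lamf x (dd f x u) / qf x) *\<^sub>R nu x))) (at x)"
    by (intro has_derivative_diff smooth_on_has_dd[OF smooth_f x])
  moreover have "dd f x u -
      ((1 / qf x) *\<^sub>R (qf x *\<^sub>R (dd f x u + h x u (Tf x) *\<^sub>R tt x) + (h x u (Tf x) * (nf x - af x)) *\<^sub>R et x) +
      ((0 * qf x - 1 * (2 * nf x * h x u (Tf x) * qf x)) / (qf x * qf x)) *\<^sub>R et x) -
      (0 + (lamf x (dd f x u) / qf x) *\<^sub>R nu x) = 0" for u
  proof -
    define k where "k = h x u (Tf x)"
    have t: "tt x = (1 / qf x) *\<^sub>R ((nf x + af x) *\<^sub>R et x - nu x)"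
      unfolding tt_decomposition[symmetric] using q0 by simp
    show ?thesis
      unfolding lamf_tangent[OF x] k_def[symmetric] t
      using q0 by (simp add: vec_eq_iff field_simps)
  qed
  ultimately show ?thesis
    by simp
qed

text \<open>Turns the hypothesis on \<open>a22\<close> and \<open>a4\<close> into
  \<open>q \<noteq> 0\<close> at one point.\<close>

lemma a22_eq:
  assumes x: "x \<in> U" and "h x V V = 1" "h x (Tf x) V = 0"
  shows "a22 f \<xi> x V = nf x"
  unfolding a22_def symmetric_chart_structure(1)[OF x]
  using assms conn_metric_sym(2)[OF x, of V "Tf x"] by (simp add: metric_bilinear)

end

section \<open>Change of charts\<close>

text \<open>\<open>T\<close>, \<open>a4\<close> and the splitting are defined through coordinates
  and descriptions, so their independence of the chart has to be proved; \<open>\<tau>\<close> is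
  the transition map.\<close>

locale chart_transition =
  A: symmetric_chart U1 f1 \<xi>1 H + B: symmetric_chart U2 f2 \<xi>2 H
  for U1 f1 \<xi>1 U2 f2 \<xi>2 H +
  fixes D :: "(real^3) set" and \<tau> :: "real^3 \<Rightarrow> real^3"
  assumes open_D: "open D" and D_sub: "D \<subseteq> U2" and smooth_tau: "smooth_on D \<tau>" and tau_in: "\<tau> ` D \<subseteq> U1"
    and f2: "\<And>x. x \<in> D \<Longrightarrow> f2 x = f1 (\<tau> x)" and xi2: "\<And>x. x \<in> D \<Longrightarrow> \<xi>2 x = \<xi>1 (\<tau> x)"
begin

lemma tau_U1: "x \<in> D \<Longrightarrow> \<tau> x \<in> U1" and in_U2: "x \<in> D \<Longrightarrow> x \<in> U2"
  using tau_in D_sub by auto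

lemma dd_compose_tau:
  fixes g :: "real^3 \<Rightarrow> 'z::real_normed_vector"
  assumes "x \<in> D" "smooth_on U1 g"
  shows "((\<lambda>y. g (\<tau> y)) has_derivative (\<lambda>u. dd g (\<tau> x) (dd \<tau> x u))) (at x)"
  by (rule has_derivative_chain[OF smooth_on_has_dd[OF smooth_tau assms(1)]
        smooth_on_has_dd[OF assms(2) tau_U1[OF assms(1)]] refl])

lemma df2:
  assumes x: "x \<in> D"
  shows "dd f2 x u = dd f1 (\<tau> x) (dd \<tau> x u)"
  by (rule dd_eqI[OF has_derivative_cong_open[OF open_D x f2[symmetric] dd_compose_tau[OF x A.smooth_f]]])

lemma linear_dtau: "x \<in> D \<Longrightarrow> linear (frechet_derivative \<tau> (at x))"
  by (rule smooth_on_linear_dd[OF smooth_tau])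

lemma inj_dtau:
  assumes x: "x \<in> D"
  shows "inj (frechet_derivative \<tau> (at x))"
proof (rule linear_injective_0[OF linear_dtau[OF x], THEN iffD2], intro allI impI)
  fix u assume "dd \<tau> x u = 0"
  then have "dd f2 x u = dd f2 x 0"
    unfolding df2[OF x] by (simp add: linear_0[OF linear_dtau[OF x]])
  then show "u = 0"
    using B.inj_df[OF in_U2[OF x]] by (rule injD[rotated])
qed

lemma surj_dtau: "x \<in> D \<Longrightarrow> \<exists>u. w = dd \<tau> x u"
  by (rule surjD[OF linear_injective_imp_surjective[OF linear_dtau inj_dtau refl]])

text \<open>The second derivative of \<open>\<tau>\<close> is tangential: it enters the connection,
  as for any Christoffel symbols, but not the metric.\<close>

lemma conn_metric_transition:
  assumes x: "x \<in> D"
  shows "dd \<tau> x (B.conn x u v) = A.conn (\<tau> x) (dd \<tau> x u) (dd \<tau> x v) + dd (\<lambda>y. dd \<tau> y v) x u"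
    "B.h x u v = A.h (\<tau> x) (dd \<tau> x u) (dd \<tau> x v)"
proof -
  note tx = tau_U1[OF x] and xU = in_U2[OF x]
  have "((\<lambda>y. dd f1 (\<tau> y) (dd \<tau> y v)) has_derivative (\<lambda>u.
      dd (\<lambda>z. dd f1 z (dd \<tau> x v)) (\<tau> x) (dd \<tau> x u) + dd f1 (\<tau> x) (dd (\<lambda>y. dd \<tau> y v) x u))) (at x)"
    by (rule linear_family_has_derivative[where L = "\<lambda>y. frechet_derivative f1 (at (\<tau> y))",
          OF open_D x A.linear_df[OF tau_U1] dd_compose_tau[OF x smooth_on_dd[OF A.smooth_f]]
            smooth_on_has_dd[OF smooth_on_dd[OF smooth_tau] x]])
  then have hd: "((\<lambda>y. dd f2 y v) has_derivative (\<lambda>u.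
      dd (\<lambda>z. dd f1 z (dd \<tau> x v)) (\<tau> x) (dd \<tau> x u) + dd f1 (\<tau> x) (dd (\<lambda>y. dd \<tau> y v) x u))) (at x)"
    by (rule has_derivative_cong_open[OF open_D x, rotated]) (rule df2[symmetric])
  have "dd f1 (\<tau> x) (dd \<tau> x (B.conn x u v)) + B.h x u v *\<^sub>R \<xi>1 (\<tau> x) =
      dd f1 (\<tau> x) (A.conn (\<tau> x) (dd \<tau> x u) (dd \<tau> x v) + dd (\<lambda>y. dd \<tau> y v) x u) +
      A.h (\<tau> x) (dd \<tau> x u) (dd \<tau> x v) *\<^sub>R \<xi>1 (\<tau> x)"
    using dd_eqI[OF hd, of u] unfolding B.gauss_const[OF xU] A.gauss_const[OF tx] df2[OF x] xi2[OF x]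
    by (simp add: linear_add[OF A.linear_df[OF tx]] algebra_simps)
  from A.frame_unique[OF tx this]
  show "dd \<tau> x (B.conn x u v) = A.conn (\<tau> x) (dd \<tau> x u) (dd \<tau> x v) + dd (\<lambda>y. dd \<tau> y v) x u"
    "B.h x u v = A.h (\<tau> x) (dd \<tau> x u) (dd \<tau> x v)"
    by simp_all
qed

text \<open>The second derivatives of \<open>\<tau>\<close> enter through the derivative of
  \<open>h\<close> and through \<open>conn\<close>, with opposite signs.\<close>

lemma cubic_transition:
  assumes x: "x \<in> D"
  shows "B.cubic x u v w = A.cubic (\<tau> x) (dd \<tau> x u) (dd \<tau> x v) (dd \<tau> x w)"
proof -
  note tx = tau_U1[OF x] and xU = in_U2[OF x]
  note b = A.bilinear_metric[OF tx]
  let ?J = "frechet_derivative \<tau> (at x)"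
  have 1: "((\<lambda>y. A.h (\<tau> y) (dd \<tau> y v) b) has_derivative (\<lambda>u.
      dd (\<lambda>z. A.h z (?J v) b) (\<tau> x) (?J u) + A.h (\<tau> x) (dd (\<lambda>y. dd \<tau> y v) x u) b)) (at x)" for b
    by (rule linear_family_has_derivative[where L = "\<lambda>y a. A.h (\<tau> y) a b",
          OF open_D x A.conn_metric_linear(2)[OF tau_U1] dd_compose_tau[OF x A.smooth_metric]
            smooth_on_has_dd[OF smooth_on_dd[OF smooth_tau] x]])
  have "((\<lambda>y. A.h (\<tau> y) (dd \<tau> y v) (dd \<tau> y w)) has_derivative (\<lambda>u.
      (dd (\<lambda>z. A.h z (?J v) (?J w)) (\<tau> x) (?J u) + A.h (\<tau> x) (dd (\<lambda>y. dd \<tau> y v) x u) (?J w)) +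
      A.h (\<tau> x) (?J v) (dd (\<lambda>y. dd \<tau> y w) x u))) (at x)"
    by (rule linear_family_has_derivative[where L = "\<lambda>y. A.h (\<tau> y) (dd \<tau> y v)",
          OF open_D x A.linear_metric[OF tau_U1] 1
            smooth_on_has_dd[OF smooth_on_dd[OF smooth_tau] x]])
  then have hd: "((\<lambda>y. B.h y v w) has_derivative (\<lambda>u.
      (dd (\<lambda>z. A.h z (?J v) (?J w)) (\<tau> x) (?J u) + A.h (\<tau> x) (dd (\<lambda>y. dd \<tau> y v) x u) (?J w)) +
      A.h (\<tau> x) (?J v) (dd (\<lambda>y. dd \<tau> y w) x u))) (at x)"
    by (rule has_derivative_cong_open[OF open_D x, rotated]) (rule conn_metric_transition(2)[symmetric])
  show ?thesis
    unfolding B.cubic_def A.cubic_def dd_eqI[OF hd] conn_metric_transition[OF x]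
    by (simp add: bilinear_ladd[OF b] bilinear_radd[OF b])
qed

lemma ktensor_transition:
  assumes x: "x \<in> D"
  shows "dd \<tau> x (B.ktensor x u v) = A.ktensor (\<tau> x) (dd \<tau> x u) (dd \<tau> x v)"
proof (rule A.metric_eqI[OF tau_U1[OF x]])
  fix w
  obtain z where "w = dd \<tau> x z"
    using surj_dtau[OF x] by blast
  then show "A.h (\<tau> x) (dd \<tau> x (B.ktensor x u v)) w = A.h (\<tau> x) (A.ktensor (\<tau> x) (dd \<tau> x u) (dd \<tau> x v)) w"
    using B.metric_ktensor[OF in_U2[OF x], of u v z] A.metric_ktensor[OF tau_U1[OF x], of "dd \<tau> x u" "dd \<tau> x v" w]
    by (simp add: conn_metric_transition(2)[OF x] cubic_transition[OF x])
qed

lemma canonical_frame_transition: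
  assumes x: "x \<in> D" and c: "canonical_frame f2 \<xi>2 x T V W a s"
  shows "canonical_frame f1 \<xi>1 (\<tau> x) (dd \<tau> x T) (dd \<tau> x V) (dd \<tau> x W) a s"
proof -
  note lin = linear_add[OF linear_dtau[OF x]] linear_diff[OF linear_dtau[OF x]]
    linear_neg[OF linear_dtau[OF x]] linear_scale[OF linear_dtau[OF x]]
  have "lorentz_frame (A.h (\<tau> x)) (dd \<tau> x T) (dd \<tau> x V) (dd \<tau> x W)"
    using B.canonical_frameD(1)[OF in_U2[OF x] c]
    by (simp add: lorentz_frame_def conn_metric_transition(2)[OF x])
  then show ?thesis
    unfolding canonical_frame_def Let_def
    by (simp add: A.difference_tensor_eq[OF tau_U1[OF x]] ktensor_transition[OF x, symmetric]
        B.canonical_frameD[OF in_U2[OF x] c] lin)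
qed

lemma invariants_transition:
  assumes x: "x \<in> D"
  shows "A.Tf (\<tau> x) = dd \<tau> x (B.Tf x)" "A.af (\<tau> x) = B.af x"
proof -
  obtain V W s where "canonical_frame f2 \<xi>2 x (B.Tf x) V W (B.af x) s" "B.af x > 0" "s \<ge> 0"
    by (rule B.canonical_frame_exists[OF in_U2[OF x]])
  then show "A.Tf (\<tau> x) = dd \<tau> x (B.Tf x)" "A.af (\<tau> x) = B.af x"
    using A.canonical_unique[OF tau_U1[OF x] canonical_frame_transition[OF x]] by blast+
qed

lemma nf_transition:
  assumes x: "x \<in> D"
  shows "A.nf (\<tau> x) = B.nf x"
proof -
  have "dd B.af x u = dd A.af (\<tau> x) (dd \<tau> x u)" for u
    by (rule dd_eqI[OF has_derivative_cong_open[OF open_D x _ dd_compose_tau[OF x A.smooth_af]]])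
      (rule invariants_transition(2))
  then show ?thesis
    by (simp add: A.nf_def B.nf_def invariants_transition[OF x])
qed

lemma splitting_transition:
  assumes x: "x \<in> D"
  shows "A.qf (\<tau> x) = B.qf x" "A.et (\<tau> x) = B.et x" "A.nu (\<tau> x) = B.nu x" "A.lamf (\<tau> x) w = B.lamf x w"
proof -
  have tt: "A.tt (\<tau> x) = B.tt x"
    by (simp add: A.tt_def B.tt_def df2[OF x] invariants_transition[OF x])
  note inv = invariants_transition[OF x] nf_transition[OF x] tt xi2[OF x]
  show "A.qf (\<tau> x) = B.qf x" "A.et (\<tau> x) = B.et x" "A.nu (\<tau> x) = B.nu x"
    by (simp_all add: A.qf_def B.qf_def A.et_def B.et_def A.nu_def B.nu_def inv)
  let ?t = "tangential f2 \<xi>2 x w" and ?c = "transversal f2 \<xi>2 x w"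
  have "w = dd f1 (\<tau> x) (dd \<tau> x ?t) + ?c *\<^sub>R \<xi>1 (\<tau> x)"
    using B.frame_decomposition[OF in_U2[OF x], of w] unfolding df2[OF x] xi2[OF x] .
  from A.tangential_transversal_eq[OF tau_U1[OF x] this]
  show "A.lamf (\<tau> x) w = B.lamf x w"
    by (simp add: A.lamf_def B.lamf_def inv conn_metric_transition(2)[OF x])
qed

end


section \<open>Global constants\<close>

lemma local_paramD:
  assumes "local_param X (U, \<psi>)"
  shows "open U" "openin X (\<psi> ` U)" "inj_on \<psi> U"
    and "\<And>S. open S \<Longrightarrow> S \<subseteq> U \<Longrightarrow> openin X (\<psi> ` S)"
    and "\<And>G. openin X G \<Longrightarrow> open (U \<inter> \<psi> -` G)"
proof -
  have *: "open U" "openin X (\<psi> ` U)" "homeomorphic_map (top_of_set U) (subtopology X (\<psi> ` U)) \<psi>"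
    using assms by (simp_all add: local_param_def)
  then show "open U" "openin X (\<psi> ` U)" by simp_all
  have sub: "\<psi> ` U \<subseteq> topspace X"
    using *(2) by (rule openin_subset)
  show "inj_on \<psi> U"
    using *(3) by (simp add: homeomorphic_eq_everything_map)
  show "openin X (\<psi> ` S)" if "open S" "S \<subseteq> U" for S
  proof -
    have "openin (top_of_set U) S"
      using that by (simp add: open_subset)
    then have "openin (subtopology X (\<psi> ` U)) (\<psi> ` S)"
      using *(3) that(2) by (simp add: homeomorphic_map_openness)
    then show ?thesis
      using *(2) openin_trans_full by blast
  qed
  show "open (U \<inter> \<psi> -` G)" if "openin X G" for G
  proof -
    have "continuous_map (top_of_set U) (subtopology X (\<psi> ` U)) \<psi>"
      using *(3) by (rule homeomorphic_imp_continuous_map)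
    then have "continuous_map (top_of_set U) X \<psi>"
      using continuous_map_into_fulltopology by blast
    then have "openin (top_of_set U) {x \<in> topspace (top_of_set U). \<psi> x \<in> G}"
      using that by (rule openin_continuous_map_preimage)
    moreover have "{x \<in> topspace (top_of_set U). \<psi> x \<in> G} = U \<inter> \<psi> -` G"
      by auto
    ultimately show ?thesis
      using *(1) by (simp add: openin_open_eq)
  qed
qed

lemma open_transition_dom:
  assumes "local_param X c" "local_param X d"
  shows "open (transition_dom c d)"
  using local_paramD(5)[of X "fst c" "snd c" "snd d ` fst d"] local_paramD(2)[of X "fst d" "snd d"] assms
  by simp

text \<open>\<open>g c\<close> is a function on each chart, and need agree only where charts
  overlap. Since \<open>g\<close> is locally constant, \<open>P Q\<close> is open for every
  predicate \<open>Q\<close>, so equality with a value and its negation would split the connected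
  space.\<close>

lemma locally_constant_global:
  assumes conn: "connected_space X" and par: "\<And>c. c \<in> \<A> \<Longrightarrow> local_param X c"
    and cov: "topspace X = (\<Union>(U, \<psi>)\<in>\<A>. \<psi> ` U)"
    and loc: "\<And>c x. c \<in> \<A> \<Longrightarrow> x \<in> fst c \<Longrightarrow> \<exists>S. open S \<and> x \<in> S \<and> S \<subseteq> fst c \<and> (\<forall>y\<in>S. g c y = g c x)"
    and inv: "\<And>c d x y. c \<in> \<A> \<Longrightarrow> d \<in> \<A> \<Longrightarrow> x \<in> fst c \<Longrightarrow> y \<in> fst d \<Longrightarrow> snd c x = snd d y \<Longrightarrow> g c x = g d y"
    and c: "c \<in> \<A>" "x \<in> fst c" and d: "d \<in> \<A>" "y \<in> fst d"
  shows "g c x = g d y"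
proof (rule ccontr)
  assume ne: "g c x \<noteq> g d y"
  define P where "P Q = {p. \<exists>e\<in>\<A>. \<exists>z\<in>fst e. snd e z = p \<and> Q (g e z)}" for Q
  have op: "openin X (P Q)" for Q
  proof (subst openin_subopen, intro ballI)
    fix p assume "p \<in> P Q"
    then obtain e z where e: "e \<in> \<A>" "z \<in> fst e" "snd e z = p" "Q (g e z)"
      by (auto simp: P_def)
    obtain S where S: "open S" "z \<in> S" "S \<subseteq> fst e" "\<forall>y\<in>S. g e y = g e z"
      using loc[OF e(1,2)] by blast
    have "openin X (snd e ` S)"
      using local_paramD(4)[of X "fst e" "snd e" S] par[OF e(1)] S by simp
    moreover have "p \<in> snd e ` S"
      using e(3) S(2) by blast
    moreover have "snd e ` S \<subseteq> P Q"
    proof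
      fix p' assume "p' \<in> snd e ` S"
      then obtain y where "y \<in> S" "p' = snd e y" by blast
      then show "p' \<in> P Q"
        unfolding P_def using e(1,4) S(3,4) by (intro CollectI bexI[of _ e] bexI[of _ y]) auto
    qed
    ultimately show "\<exists>T. openin X T \<and> p \<in> T \<and> T \<subseteq> P Q"
      by blast
  qed
  let ?P = "P (\<lambda>k. k = g c x)" and ?N = "P (\<lambda>k. k \<noteq> g c x)"
  have "topspace X \<subseteq> ?P \<union> ?N"
    unfolding cov by (force simp: P_def)
  moreover have "?P \<inter> ?N = {}"
  proof -
    have False if p: "p \<in> ?P" "p \<in> ?N" for p
    proof -
      obtain e z where e: "e \<in> \<A>" "z \<in> fst e" "snd e z = p" "g e z = g c x"
        using p(1) unfolding P_def by blast
      obtain e' z' where e': "e' \<in> \<A>" "z' \<in> fst e'" "snd e' z' = p" "g e' z' \<noteq> g c x"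
        using p(2) unfolding P_def by blast
      have "snd e z = snd e' z'"
        using e(3) e'(3) by simp
      then show False
        using inv[OF e(1) e'(1) e(2) e'(2)] e(4) e'(4) by simp
    qed
    then show ?thesis by blast
  qed
  moreover have "snd c x \<in> ?P"
    unfolding P_def using c by blast
  moreover have "snd d y \<in> ?N"
    unfolding P_def using d ne[symmetric] by blast
  ultimately show False
    using conn op unfolding connected_space_def by blast
qed

locale symmetric_hypersphere =
  fixes X :: "'a topology" and \<A> :: "(real^3, 'a) param set" and \<phi> \<xi> :: "'a \<Rightarrow> real^4" and H :: real
  assumes manifold: "smooth_manifold X \<A>" and connected: "connected_space X"
    and hypersphere: "indefinite_affine_hypersphere \<A> \<phi> \<xi> H"
    and symmetric: "pointwise_Z3_symmetry \<A> \<phi> \<xi> \<or> pointwise_SO2_symmetry \<A> \<phi> \<xi>"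
begin

lemma chart: "c \<in> \<A> \<Longrightarrow> local_param X c"
  and charts_compatible: "c \<in> \<A> \<Longrightarrow> d \<in> \<A> \<Longrightarrow> compatible c d"
  and covering: "topspace X = (\<Union>(U, \<psi>)\<in>\<A>. \<psi> ` U)"
  using manifold by (auto simp: smooth_manifold_def)

lemma symmetric_chart:
  assumes c: "c \<in> \<A>"
  shows "symmetric_chart (fst c) (\<phi> \<circ> snd c) (\<xi> \<circ> snd c) H"
proof
  obtain U \<psi> where c': "c = (U, \<psi>)" by (cases c)
  show "affine_sphere (fst c) (\<phi> \<circ> snd c) (\<xi> \<circ> snd c) H"
    using hypersphere c c' by (auto simp: indefinite_affine_hypersphere_def)
  show "(\<forall>x\<in>fst c. \<exists>T V W a s. canonical_frame (\<phi> \<circ> snd c) (\<xi> \<circ> snd c) x T V W a s \<and> 0 < a \<and> s = 0) \<or>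
    (\<forall>x\<in>fst c. \<exists>T V W a s. canonical_frame (\<phi> \<circ> snd c) (\<xi> \<circ> snd c) x T V W a s \<and> 0 < a \<and> 0 < s)"
    using symmetric
  proof
    assume "pointwise_Z3_symmetry \<A> \<phi> \<xi>"
    then have "\<forall>x\<in>U. \<exists>T V W a s. canonical_frame (\<phi> \<circ> \<psi>) (\<xi> \<circ> \<psi>) x T V W a s \<and> a > 0 \<and> s > 0"
      unfolding pointwise_Z3_symmetry_def using c c' by blast
    then show ?thesis by (simp add: c')
  next
    assume "pointwise_SO2_symmetry \<A> \<phi> \<xi>"
    then have "\<forall>x\<in>U. \<exists>T V W a s. canonical_frame (\<phi> \<circ> \<psi>) (\<xi> \<circ> \<psi>) x T V W a s \<and> a > 0 \<and> s = 0"
      unfolding pointwise_SO2_symmetry_def using c c' by blast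
    then show ?thesis by (simp add: c')
  qed
qed

lemma transition:
  assumes c: "c \<in> \<A>" and d: "d \<in> \<A>"
  shows "chart_transition (fst c) (\<phi> \<circ> snd c) (\<xi> \<circ> snd c) (fst d) (\<phi> \<circ> snd d) (\<xi> \<circ> snd d) H
    (transition_dom d c) (transition d c)"
proof -
  interpret A: symmetric_chart "fst c" "\<phi> \<circ> snd c" "\<xi> \<circ> snd c" H by (rule symmetric_chart[OF c])
  interpret B: symmetric_chart "fst d" "\<phi> \<circ> snd d" "\<xi> \<circ> snd d" H by (rule symmetric_chart[OF d])
  have t: "transition d c x \<in> fst c" "snd c (transition d c x) = snd d x" if "x \<in> transition_dom d c" for x
  proof -
    have "snd d x \<in> snd c ` fst c" using that by auto
    then show "transition d c x \<in> fst c" "snd c (transition d c x) = snd d x"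
      by (simp_all add: inv_into_into f_inv_into_f)
  qed
  show ?thesis
  proof
    show "open (transition_dom d c)"
      by (rule open_transition_dom[OF chart[OF d] chart[OF c]])
    show "smooth_on (transition_dom d c) (transition d c)"
      using charts_compatible[OF c d] by (simp add: compatible_def)
    show "transition d c ` transition_dom d c \<subseteq> fst c"
      using t(1) by blast
    show "(\<phi> \<circ> snd d) x = (\<phi> \<circ> snd c) (transition d c x)" "(\<xi> \<circ> snd d) x = (\<xi> \<circ> snd c) (transition d c x)"
      if "x \<in> transition_dom d c" for x
      using t(2)[OF that] by simp_all
  qed auto
qed

definition "q c = symmetric_chart.qf (\<phi> \<circ> snd c) (\<xi> \<circ> snd c) H"
definition "a c = a4 (\<phi> \<circ> snd c) (\<xi> \<circ> snd c)"
definition "lam c = symmetric_chart.lamf (\<phi> \<circ> snd c) (\<xi> \<circ> snd c)"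
definition "n c = symmetric_chart.nu (\<phi> \<circ> snd c) (\<xi> \<circ> snd c) H"
definition "eta c = symmetric_chart.et (\<phi> \<circ> snd c) (\<xi> \<circ> snd c)"

lemmas chart_defs = q_def a_def lam_def n_def eta_def

lemma splitting_invariant:
  assumes c: "c \<in> \<A>" "x \<in> fst c" and d: "d \<in> \<A>" "y \<in> fst d" and eq: "snd c x = snd d y"
  shows "q c x = q d y" "a c x = a d y" "lam c x = lam d y" "n c x = n d y" "eta c x = eta d y"
proof -
  interpret chart_transition "fst c" "\<phi> \<circ> snd c" "\<xi> \<circ> snd c" "fst d" "\<phi> \<circ> snd d" "\<xi> \<circ> snd d" H
    "transition_dom d c" "transition d c"
    by (rule transition[OF c(1) d(1)])
  have y: "y \<in> transition_dom d c"
    using c(2) d(2) eq by force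
  have "inj_on (snd c) (fst c)"
    using local_paramD(3)[of X "fst c" "snd c"] chart[OF c(1)] by simp
  then have x: "transition d c y = x"
    using c(2) eq by (simp flip: eq)
  show "q c x = q d y" "a c x = a d y" "lam c x = lam d y" "n c x = n d y" "eta c x = eta d y"
    using splitting_transition[OF y, unfolded x] invariants_transition[OF y, unfolded x]
    by (simp_all add: chart_defs fun_eq_iff)
qed

lemma q_ratio_constant:
  assumes c: "c \<in> \<A>" "x \<in> fst c" and d: "d \<in> \<A>" "y \<in> fst d"
  shows "q c x * (1 / sqrt (a c x)) = q d y * (1 / sqrt (a d y))"
proof (rule locally_constant_global[where g = "\<lambda>c x. q c x * (1 / sqrt (a c x))", OF connected chart covering _ _ c d])
  fix c x assume c: "c \<in> \<A>" "x \<in> fst c"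
  interpret A: symmetric_chart "fst c" "\<phi> \<circ> snd c" "\<xi> \<circ> snd c" H by (rule symmetric_chart[OF c(1)])
  obtain r where r: "r > 0" "ball x r \<subseteq> fst c"
    using A.open_U c(2) openE by blast
  have "q c y * (1 / sqrt (a c y)) = q c x * (1 / sqrt (a c x))" if "y \<in> ball x r" for y
    unfolding chart_defs by (rule A.zero_derivative_locally_constant[OF A.qf_ratio_constant r(2) that])
  then show "\<exists>S. open S \<and> x \<in> S \<and> S \<subseteq> fst c \<and>
      (\<forall>y\<in>S. q c y * (1 / sqrt (a c y)) = q c x * (1 / sqrt (a c x)))"
    using r centre_in_ball[of x r] open_ball[of x r] by blast
next
  show "q c x * (1 / sqrt (a c x)) = q d y * (1 / sqrt (a d y))"
    if "c \<in> \<A>" "d \<in> \<A>" "x \<in> fst c" "y \<in> fst d" "snd c x = snd d y" for c d x y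
    using splitting_invariant[OF that(1,3,2,4,5)] by simp
qed

definition "proj c x w = (lam c x w / q c x) *\<^sub>R n c x"
definition "center c x = \<phi> (snd c x) - (1 / q c x) *\<^sub>R eta c x - (lam c x (\<phi> (snd c x)) / q c x) *\<^sub>R n c x"

lemma splitting_constant:
  assumes q0: "\<And>c x. c \<in> \<A> \<Longrightarrow> x \<in> fst c \<Longrightarrow> q c x \<noteq> 0"
    and c: "c \<in> \<A>" "x \<in> fst c" and d: "d \<in> \<A>" "y \<in> fst d"
  shows "(proj c x, center c x) = (proj d y, center d y)"
proof (rule locally_constant_global[where g = "\<lambda>c x. (proj c x, center c x)", OF connected chart covering _ _ c d])
  fix c x assume c: "c \<in> \<A>" "x \<in> fst c"
  interpret A: symmetric_chart "fst c" "\<phi> \<circ> snd c" "\<xi> \<circ> snd c" H by (rule symmetric_chart[OF c(1)])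
  obtain r where r: "r > 0" "ball x r \<subseteq> fst c"
    using A.open_U c(2) openE by blast
  have q: "A.qf z \<noteq> 0" if "z \<in> fst c" for z
    using q0[OF c(1) that] by (simp add: chart_defs)
  have "proj c y w = proj c x w" if "y \<in> ball x r" for y w
    unfolding proj_def chart_defs
    by (rule A.zero_derivative_locally_constant[OF A.projection_constant[OF _ q] r(2) that])
  moreover have "center c y = center c x" if "y \<in> ball x r" for y
    unfolding center_def chart_defs
    using A.zero_derivative_locally_constant[OF A.center_constant[OF _ q] r(2) that] by simp
  ultimately have "(proj c y, center c y) = (proj c x, center c x)" if "y \<in> ball x r" for y
    using that by (intro prod_eqI ext) (simp_all only: fst_conv snd_conv)
  then show "\<exists>S. open S \<and> x \<in> S \<and> S \<subseteq> fst c \<and> (\<forall>y\<in>S. (proj c y, center c y) = (proj c x, center c x))"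
    using r centre_in_ball[of x r] open_ball[of x r] by blast
next
  show "(proj c x, center c x) = (proj d y, center d y)"
    if "c \<in> \<A>" "d \<in> \<A>" "x \<in> fst c" "y \<in> fst d" "snd c x = snd d y" for c d x y
    using splitting_invariant[OF that(1,3,2,4,5)] that(5) by (simp add: proj_def center_def fun_eq_iff)
qed

end

section \<open>Adapted coordinates\<close>

text \<open>Along a slice the span of \<open>V, W, \<eta>\<close> is closed under \<open>D\<close>.
  The coefficients have trace zero, and for \<open>s = 0\<close> they are skew with respect to a
  quadratic form; \<open>Delta_slice\<close> and \<open>quadric_slice\<close> rest on these two
  facts.\<close>

lemma (in framed_chart) slice_frame:
  assumes x: "x \<in> S" and u: "h x u (Tf x) = 0"
  shows "dd (e 2) x u = om x u *\<^sub>R e 3 x + s x *\<^sub>R (h x u (V x) *\<^sub>R e 2 x - h x u (W x) *\<^sub>R e 3 x) +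
      h x u (V x) *\<^sub>R et x"
    "dd (e 3) x u = - (om x u *\<^sub>R e 2 x) - s x *\<^sub>R (h x u (V x) *\<^sub>R e 3 x + h x u (W x) *\<^sub>R e 2 x) +
      h x u (W x) *\<^sub>R et x"
    "dd et x u = qf x *\<^sub>R (h x u (V x) *\<^sub>R e 2 x + h x u (W x) *\<^sub>R e 3 x)"
proof -
  note xU = in_U[OF x]
  note k = bilinear_ktensor[OF xU]
  have exp: "u = h x u (V x) *\<^sub>R V x + h x u (W x) *\<^sub>R W x"
    using lorentz_expansion[OF xU canonical_frameD(1)[OF xU frame[OF x]], of u] u by simp
  have al: "al x u = nf x * h x u (V x)" "be x u = nf x * h x u (W x)"
    unfolding al_def be_def symmetric_chart_structure(1)[OF xU] u by (simp_all add: metric_bilinear xU)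
  have kV: "ktensor x u (V x) = h x u (V x) *\<^sub>R (- (af x *\<^sub>R Tf x) + s x *\<^sub>R V x) + h x u (W x) *\<^sub>R (- (s x *\<^sub>R W x))"
  proof -
    have "ktensor x (h x u (V x) *\<^sub>R V x + h x u (W x) *\<^sub>R W x) (V x) =
      h x u (V x) *\<^sub>R (- (af x *\<^sub>R Tf x) + s x *\<^sub>R V x) + h x u (W x) *\<^sub>R (- (s x *\<^sub>R W x))"
      by (simp only: bilinear_ladd[OF k] bilinear_lmul[OF k] frame_ktensor[OF x x])
    then show ?thesis
      unfolding exp[symmetric] .
  qed
  have kW: "ktensor x u (W x) = h x u (V x) *\<^sub>R (- (s x *\<^sub>R W x)) + h x u (W x) *\<^sub>R (- (af x *\<^sub>R Tf x) - s x *\<^sub>R V x)"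
  proof -
    have "ktensor x (h x u (V x) *\<^sub>R V x + h x u (W x) *\<^sub>R W x) (W x) =
      h x u (V x) *\<^sub>R (- (s x *\<^sub>R W x)) + h x u (W x) *\<^sub>R (- (af x *\<^sub>R Tf x) - s x *\<^sub>R V x)"
      by (simp only: bilinear_ladd[OF k] bilinear_lmul[OF k] frame_ktensor[OF x x])
    then show ?thesis
      unfolding exp[symmetric] .
  qed
  note df = linear_add[OF linear_df[OF xU]] linear_diff[OF linear_df[OF xU]]
    linear_scale[OF linear_df[OF xU]] linear_neg[OF linear_df[OF xU]]
  show "dd (e 2) x u = om x u *\<^sub>R e 3 x + s x *\<^sub>R (h x u (V x) *\<^sub>R e 2 x - h x u (W x) *\<^sub>R e 3 x) +
      h x u (V x) *\<^sub>R et x"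
    unfolding e_funs dd_frame_field[OF x smooth_V] frame_connection[OF x] kV al et_def tt_def
    by (simp add: df) (simp add: vec_eq_iff algebra_simps)
  show "dd (e 3) x u = - (om x u *\<^sub>R e 2 x) - s x *\<^sub>R (h x u (V x) *\<^sub>R e 3 x + h x u (W x) *\<^sub>R e 2 x) +
      h x u (W x) *\<^sub>R et x"
    unfolding e_funs dd_frame_field[OF x smooth_W] frame_connection[OF x] kW al et_def tt_def
    by (simp add: df) (simp add: vec_eq_iff algebra_simps)
  have "dd et x u = qf x *\<^sub>R (dd f x u + h x u (Tf x) *\<^sub>R tt x) + (h x u (Tf x) * (nf x - af x)) *\<^sub>R et x"
    by (rule dd_eqI[OF et_has_derivative[OF xU]])
  moreover have "dd f x u = h x u (V x) *\<^sub>R e 2 x + h x u (W x) *\<^sub>R e 3 x"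
  proof -
    have "dd f x (h x u (V x) *\<^sub>R V x + h x u (W x) *\<^sub>R W x) = h x u (V x) *\<^sub>R e 2 x + h x u (W x) *\<^sub>R e 3 x"
      by (simp only: df e_simps)
    then show ?thesis
      unfolding exp[symmetric] .
  qed
  ultimately show "dd et x u = qf x *\<^sub>R (h x u (V x) *\<^sub>R e 2 x + h x u (W x) *\<^sub>R e 3 x)"
    by (simp add: u)
qed

definition tail :: "real^4 \<Rightarrow> real^3" where
  "tail w = vector [w $ 2, w $ 3, w $ 4]"

lemma tail_nth [simp]: "tail w $ 1 = w $ 2" "tail w $ 2 = w $ 3" "tail w $ 3 = w $ 4"
  by (simp_all add: tail_def vector_3)

lemma linear_tail: "linear tail"
  by (rule linearI) (simp_all add: vec_eq_iff forall_3)

text \<open>\<open>L\<close> is the linear part of the affine transformation, \<open>C\<close> its centre, and \<open>n0\<close> spans the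
  distinguished line.\<close>

locale adapted_chart = symmetric_chart +
  fixes L :: "real^4 \<Rightarrow> real^4" and C n0 :: "real^4"
  assumes linear_L: "linear L" and inj_L: "inj L" and L_n0: "L n0 = axis 1 1"
    and q_nonzero: "\<And>x. x \<in> U \<Longrightarrow> qf x \<noteq> 0"
    and proj: "\<And>x w. x \<in> U \<Longrightarrow> (lamf x w / qf x) *\<^sub>R nu x = (L w $ 1) *\<^sub>R n0"
    and center: "\<And>x. x \<in> U \<Longrightarrow> f x = C + (1 / qf x) *\<^sub>R et x + (lamf x (f x) / qf x) *\<^sub>R nu x"
begin

definition "N w = tail (L w)"
text \<open>The component of \<open>T\<close> along the distinguished line; as it has no zeros,
  \<open>g\<close> can serve as a coordinate whose level sets are orthogonal to
  \<open>T\<close>.\<close>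

definition "\<kappa> x = L (tt x) $ 1"
definition "g x = L (f x - C) $ 1"
definition "y x = tail (L (f x - C))"

lemma linear_N: "linear N"
  unfolding N_def[abs_def] by (rule linear_compose2[OF linear_L linear_tail])

lemma linear_L1: "linear (\<lambda>w. L w $ 1)"
  by (rule linear_compose2[OF linear_L]) (rule linearI, simp_all)

lemma n0_nonzero: "n0 \<noteq> 0"
proof
  assume "n0 = 0"
  then have "axis 1 1 = (0 :: real^4)"
    using L_n0 linear_0[OF linear_L] by simp
  then show False
    by (simp add: axis_eq_0_iff)
qed

lemma nu_eq: "x \<in> U \<Longrightarrow> nu x = - (qf x * \<kappa> x) *\<^sub>R n0"
proof -
  assume x: "x \<in> U"
  have "lamf x (tt x) = -1"
    by (simp add: tt_def lamf_tangent[OF x] Tf_timelike[OF x])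
  then have "\<kappa> x *\<^sub>R n0 = (- 1 / qf x) *\<^sub>R nu x"
    using proj[OF x, of "tt x"] by (simp add: \<kappa>_def)
  then have "qf x *\<^sub>R \<kappa> x *\<^sub>R n0 = - nu x"
    using q_nonzero[OF x] by simp
  then show ?thesis
    by simp
qed

lemma nu_nonzero: "x \<in> U \<Longrightarrow> nu x \<noteq> 0"
  using lamf_nu[of x] linear_0[OF linear_lamf, of x] q_nonzero[of x] by auto

lemma kappa_nonzero: "x \<in> U \<Longrightarrow> \<kappa> x \<noteq> 0"
  using nu_eq[of x] nu_nonzero[of x] by auto

lemma L1_eq:
  assumes x: "x \<in> U"
  shows "L w $ 1 = - \<kappa> x * lamf x w"
proof -
  have "(L w $ 1) *\<^sub>R n0 = (- \<kappa> x * lamf x w) *\<^sub>R n0"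
    unfolding proj[OF x, symmetric] nu_eq[OF x] using q_nonzero[OF x] by simp
  then show ?thesis
    using n0_nonzero by (simp only: scaleR_cancel_right simp_thms)
qed

lemma L1_tangent: "x \<in> U \<Longrightarrow> L (dd f x u) $ 1 = - \<kappa> x * h x u (Tf x)"
  by (simp add: L1_eq[of x] lamf_tangent)

lemma N_nu: "x \<in> U \<Longrightarrow> N (nu x) = 0"
  by (simp add: nu_eq linear_scale[OF linear_N] linear_neg[OF linear_N])
    (simp add: N_def L_n0 vec_eq_iff forall_3 axis_def)

lemma N_tt: "x \<in> U \<Longrightarrow> N (tt x) = ((nf x + af x) / qf x) *\<^sub>R N (et x)"
proof -
  assume x: "x \<in> U"
  have "tt x = (1 / qf x) *\<^sub>R ((nf x + af x) *\<^sub>R et x - nu x)"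
    unfolding tt_decomposition[symmetric] using q_nonzero[OF x] by simp
  then show ?thesis
    by (simp add: linear_scale[OF linear_N] linear_diff[OF linear_N] N_nu[OF x])
qed

lemma kernel_N: "x \<in> U \<Longrightarrow> lamf x w = 0 \<Longrightarrow> N w = 0 \<Longrightarrow> w = 0"
proof -
  assume "x \<in> U" "lamf x w = 0" "N w = 0"
  then have "L w $ 1 = 0" "tail (L w) = 0"
    using L1_eq[of x w] by (simp_all add: N_def)
  then have "L w = 0"
    by (simp add: vec_eq_iff forall_3 forall_4)
  then show "w = 0"
    using injD[OF inj_L, of w 0] linear_0[OF linear_L] by simp
qed

lemma y_eq: "x \<in> U \<Longrightarrow> y x = (1 / qf x) *\<^sub>R N (et x)"
proof -
  assume x: "x \<in> U"
  have "y x = N (f x - C)"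
    by (simp add: y_def N_def)
  also have "f x - C = (1 / qf x) *\<^sub>R et x + (lamf x (f x) / qf x) *\<^sub>R nu x"
    by (rule diff_eq_eq[THEN iffD2], rule trans[OF center[OF x]]) (simp only: ac_simps)
  finally show ?thesis
    by (simp add: linear_add[OF linear_N] linear_scale[OF linear_N] N_nu[OF x])
qed

lemma smooth_g: "smooth_on U g" and smooth_y: "smooth_on U y"
proof -
  have 1: "smooth_on U (\<lambda>x. f x - C)"
    by (intro smooth_on_diff open_U smooth_f smooth_on_const)
  show "smooth_on U g"
    unfolding g_def[abs_def] by (rule smooth_on_linear[OF linear_L1 open_U 1])
  show "smooth_on U y"
    unfolding y_def[abs_def] by (rule smooth_on_linear[OF linear_compose2[OF linear_L linear_tail] open_U 1])
qed

lemma dg: "x \<in> U \<Longrightarrow> dd g x u = - \<kappa> x * h x u (Tf x)" and dy: "x \<in> U \<Longrightarrow> dd y x u = N (dd f x u)"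
proof -
  assume x: "x \<in> U"
  have 1: "((\<lambda>x. f x - C) has_derivative (\<lambda>u. dd f x u - 0)) (at x)"
    by (intro has_derivative_diff has_derivative_const smooth_on_has_dd[OF smooth_f x])
  show "dd g x u = - \<kappa> x * h x u (Tf x)"
    unfolding g_def[abs_def]
    using dd_eqI[OF bounded_linear.has_derivative[OF linear_L1[unfolded linear_conv_bounded_linear] 1], of u]
    by (simp add: L1_tangent[OF x])
  show "dd y x u = N (dd f x u)"
    unfolding y_def[abs_def]
    using dd_eqI[OF bounded_linear.has_derivative[OF
          linear_compose2[OF linear_L linear_tail, unfolded linear_conv_bounded_linear] 1], of u]
    by (simp add: N_def)
qed

text \<open>The vector \<open>df(u) - (c / q) \<eta>\<close> lies in the kernels of both
  \<open>\<lambda>\<close> and \<open>N\<close>, and so vanishes. Geometrically, the projected slice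
  is immersed and its position vector is nowhere tangent.\<close>

lemma transverse_y:
  assumes x: "x \<in> U" and u: "h x u (Tf x) = 0" and eq: "N (dd f x u) = c *\<^sub>R y x"
  shows "u = 0" "c = 0"
proof -
  define k where "k = c / qf x"
  let ?w = "dd f x u - k *\<^sub>R et x"
  have "lamf x ?w = 0"
    by (simp add: linear_diff[OF linear_lamf[OF x]] linear_scale[OF linear_lamf[OF x]]
        lamf_tangent[OF x] lamf_et[OF x] u)
  moreover have "N ?w = 0"
    using eq by (simp add: linear_diff[OF linear_N] linear_scale[OF linear_N] y_eq[OF x] k_def)
  ultimately have "?w = 0"
    by (rule kernel_N[OF x])
  then have "dd f x (u - (k * (nf x - af x)) *\<^sub>R Tf x) + (- k) *\<^sub>R \<xi> x = dd f x 0 + 0 *\<^sub>R \<xi> x"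
    unfolding linear_diff[OF linear_df[OF x]] linear_scale[OF linear_df[OF x]] linear_0[OF linear_df[OF x]]
    by (simp add: et_def tt_def algebra_simps)
  from frame_unique[OF x this] have "k = 0" "u = (k * (nf x - af x)) *\<^sub>R Tf x"
    by simp_all
  then show "u = 0" "c = 0"
    using q_nonzero[OF x] by (simp_all add: k_def)
qed

lemma kappa_has_derivative:
  assumes x: "x \<in> U"
  shows "(\<kappa> has_derivative (\<lambda>u. h x u (Tf x) * (2 * af x * \<kappa> x + L (\<xi> x) $ 1))) (at x)"
proof -
  have "(\<kappa> has_derivative (\<lambda>u. L ((nf x + af x) *\<^sub>R dd f x u +
    h x u (Tf x) *\<^sub>R ((nf x + 3 * af x) *\<^sub>R tt x + \<xi> x)) $ 1)) (at x)"
    unfolding \<kappa>_def[abs_def]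
    by (rule bounded_linear.has_derivative[OF linear_L1[unfolded linear_conv_bounded_linear] tt_has_derivative[OF x]])
  then show ?thesis
    by (rule has_derivative_eqI)
      (simp add: linear_add[OF linear_L1] linear_scale[OF linear_L1] L1_tangent[OF x] \<kappa>_def[symmetric] algebra_simps)
qed

end

section \<open>Quantities constant on slices\<close>

locale adapted_frame_chart = framed_chart + adapted_chart
begin

definition "\<Delta> x = N (e 2 x) \<bullet> cross3 (N (e 3 x)) (N (et x))"
definition "quadric x c d = (N (e 2 x) \<bullet> c) * (N (e 2 x) \<bullet> d) + (N (e 3 x) \<bullet> c) * (N (e 3 x) \<bullet> d) -
  (N (et x) \<bullet> c) * (N (et x) \<bullet> d) / qf x"

lemma N_has_derivative: "(v has_derivative v') F \<Longrightarrow> ((\<lambda>x. N (v x)) has_derivative (\<lambda>u. N (v' u))) F"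
  by (rule bounded_linear.has_derivative[OF linear_N[unfolded linear_conv_bounded_linear]])

text \<open>A determinant changes by the trace of the frame equations: the contributions
  \<open>s h(u, V)\<close> from \<open>V\<close> and \<open>- s h(u, V)\<close> from
  \<open>W\<close> cancel.\<close>

lemma Delta_slice:
  assumes x: "x \<in> S"
  obtains D where "(\<Delta> has_derivative D) (at x)" "\<And>u. h x u (Tf x) = 0 \<Longrightarrow> D u = 0"
proof -
  note xU = in_U[OF x]
  have et: "(et has_derivative frechet_derivative et (at x)) (at x)"
    by (rule differentiable_has_dd[OF differentiableI[OF et_has_derivative[OF xU]]])
  note d = N_has_derivative[OF smooth_on_has_dd[OF smooth_e x]]
  let ?D = "\<lambda>u. N (e 2 x) \<bullet> (cross3 (N (e 3 x)) (N (dd et x u)) + cross3 (N (dd (e 3) x u)) (N (et x))) +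
     N (dd (e 2) x u) \<bullet> cross3 (N (e 3 x)) (N (et x))"
  have "(\<Delta> has_derivative ?D) (at x)"
    unfolding \<Delta>_def[abs_def]
    by (rule has_derivative_inner[OF d bounded_bilinear.FDERIV[OF bilinear_cross[unfolded bilinear_conv_bounded_bilinear]
            d N_has_derivative[OF et]]])
  moreover have "?D u = 0" if u: "h x u (Tf x) = 0" for u
    unfolding slice_frame[OF x u]
    by (simp only: linear_add[OF linear_N] linear_diff[OF linear_N] linear_scale[OF linear_N] linear_neg[OF linear_N])
      (simp add: cross3_simps forall_3)
  ultimately show ?thesis
    by (rule that)
qed

text \<open>For \<open>s = 0\<close> the rotation terms \<open>om\<close> cancel between
  \<open>V\<close> and \<open>W\<close>. The mixed terms with \<open>\<eta>\<close> cancel against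
  the last summand because \<open>d\<eta>(u) = q df(u)\<close>, while \<open>q\<close> is constant
  along the slice.\<close>

lemma quadric_slice:
  assumes x: "x \<in> S" and s0: "s x = 0"
  obtains D where "((\<lambda>x. quadric x c d) has_derivative D) (at x)" "\<And>u. h x u (Tf x) = 0 \<Longrightarrow> D u = 0"
proof -
  note xU = in_U[OF x]
  have et: "(et has_derivative frechet_derivative et (at x)) (at x)"
    by (rule differentiable_has_dd[OF differentiableI[OF et_has_derivative[OF xU]]])
  note dE = has_derivative_inner_left[OF N_has_derivative[OF smooth_on_has_dd[OF smooth_e x]]]
  note dn = has_derivative_inner_left[OF N_has_derivative[OF et]]
  have "((\<lambda>x. quadric x c d) has_derivative (\<lambda>u.
     ((N (e 2 x) \<bullet> c) * (N (dd (e 2) x u) \<bullet> d) + (N (dd (e 2) x u) \<bullet> c) * (N (e 2 x) \<bullet> d)) +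
     ((N (e 3 x) \<bullet> c) * (N (dd (e 3) x u) \<bullet> d) + (N (dd (e 3) x u) \<bullet> c) * (N (e 3 x) \<bullet> d)) -
     ((((N (et x) \<bullet> c) * (N (dd et x u) \<bullet> d) + (N (dd et x u) \<bullet> c) * (N (et x) \<bullet> d)) * qf x -
       ((N (et x) \<bullet> c) * (N (et x) \<bullet> d)) * (2 * nf x * h x u (Tf x) * qf x)) / (qf x * qf x)))) (at x)"
    (is "(_ has_derivative ?D) _")
    unfolding quadric_def[abs_def]
    by (intro has_derivative_diff has_derivative_add has_derivative_mult has_derivative_divide'
        dE dn qf_has_derivative xU q_nonzero)
  moreover have "?D u = 0" if u: "h x u (Tf x) = 0" for u
    unfolding slice_frame[OF x u] u s0 using q_nonzero[OF xU]
    by (simp add: linear_add[OF linear_N] linear_diff[OF linear_N] linear_scale[OF linear_N] linear_neg[OF linear_N]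
        inner_add_left inner_diff_left field_simps)
  ultimately show ?thesis
    by (rule that)
qed

end

text \<open>Passage between products \<open>I \<times> N0\<close> and \<open>real^3\<close>, since
  the inverse function theorem is applied to a self-map of \<open>real^3\<close>.\<close>

definition emb :: "real \<times> (real^2) \<Rightarrow> real^3" where
  "emb z = vector [fst z, snd z $ 1, snd z $ 2]"

definition unemb :: "real^3 \<Rightarrow> real \<times> (real^2)" where
  "unemb w = (w $ 1, vector [w $ 2, w $ 3])"

lemma emb_nth [simp]: "emb z $ 1 = fst z" "emb z $ 2 = snd z $ 1" "emb z $ 3 = snd z $ 2"
  by (simp_all add: emb_def vector_3)

lemma unemb_emb [simp]: "unemb (emb z) = z"
  by (simp add: unemb_def prod_eq_iff vec_eq_iff forall_2)

lemma emb_unemb [simp]: "emb (unemb w) = w"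
  by (simp add: unemb_def vec_eq_iff forall_3)

lemma linear_emb: "linear emb"
  by (rule linearI) (simp_all add: vec_eq_iff forall_3)

lemma linear_unemb: "linear unemb"
  by (rule linearI) (simp_all add: unemb_def prod_eq_iff vec_eq_iff forall_2)

context adapted_frame_chart
begin

text \<open>Coordinates are given by \<open>g\<close> and by projective coordinates of \<open>y\<close> in \<open>\<real>\<^sup>3\<close>.\<close>

lemma box_exists:
  assumes x0: "x0 \<in> S"
  shows "\<exists>I (N0 :: (real^2) set) \<theta> \<Theta> \<rho> sec. open I \<and> is_interval I \<and> open N0 \<and> convex N0 \<and> smooth_on (I \<times> N0) \<theta> \<and>
    \<theta> ` (I \<times> N0) \<subseteq> S \<and> open (\<theta> ` (I \<times> N0)) \<and> x0 \<in> \<theta> ` (I \<times> N0) \<and>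
    smooth_on (\<theta> ` (I \<times> N0)) \<Theta> \<and> (\<forall>z\<in>I \<times> N0. \<Theta> (\<theta> z) = z) \<and> smooth_on (I \<times> N0) \<rho> \<and>
    (\<forall>t\<in>I. \<forall>v\<in>N0. g (\<theta> (t, v)) = t \<and> y (\<theta> (t, v)) = \<rho> (t, v) *\<^sub>R sec v \<and> \<rho> (t, v) > (0::real))"
proof -
  note x0U = in_U[OF x0]
  \<comment> \<open>In the basis \<open>N V, N W, y\<close> at \<open>x0\<close> the third
    coordinate of \<open>y\<close> is 1 at \<open>x0\<close>, so the ratios of the other two to it
    are defined nearby.\<close>
  define M where "M c = c $ 1 *\<^sub>R N (e 2 x0) + c $ 2 *\<^sub>R N (e 3 x0) + c $ 3 *\<^sub>R y x0" for c :: "real^3"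
  have linM: "linear M"
    unfolding M_def[abs_def] by (rule linearI) (simp_all add: algebra_simps)
  have injM: "inj M"
  proof (rule linear_injective_0[OF linM, THEN iffD2], intro allI impI)
    fix c assume c: "M c = 0"
    let ?u = "c $ 1 *\<^sub>R V x0 + c $ 2 *\<^sub>R W x0"
    have "N (dd f x0 ?u) = (- c $ 3) *\<^sub>R y x0"
      using c by (simp add: M_def linear_add[OF linear_df[OF x0U]] linear_scale[OF linear_df[OF x0U]]
          linear_add[OF linear_N] linear_scale[OF linear_N] eq_neg_iff_add_eq_0)
    moreover have "h x0 ?u (Tf x0) = 0"
      by (simp add: metric_bilinear x0U x0 frame_metric)
    ultimately have u: "?u = 0" and c3: "- c $ 3 = 0"
      using transverse_y[OF x0U, of ?u "- c $ 3"] by blast+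
    have "h x0 ?u (V x0) = 0" "h x0 ?u (W x0) = 0"
      unfolding u by (simp_all add: bilinear_lzero[OF bilinear_metric[OF x0U]])
    then have "c $ 1 = 0" "c $ 2 = 0"
      unfolding bilinear_ladd[OF bilinear_metric[OF x0U]] bilinear_lmul[OF bilinear_metric[OF x0U]]
      by (simp_all add: x0 frame_metric)
    with c3 show "c = 0"
      by (simp add: vec_eq_iff forall_3)
  qed
  obtain R where R: "linear R" "R \<circ> M = id"
    using linear_injective_left_inverse[OF linM injM] by blast
  have RM: "R (M c) = c" for c
    using R(2) by (simp add: fun_eq_iff)
  have MR: "M (R z) = z" for z
  proof -
    have "\<exists>c. z = M c"
      by (rule surjD[OF linear_injective_imp_surjective[OF linM injM refl]])
    then show ?thesis
      using RM by metis
  qed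
  define l where "l x = R (y x) $ 3" for x
  have sR: "smooth_on S (\<lambda>x. R (y x))"
    by (rule smooth_on_linear[OF R(1) open_S smooth_on_subset[OF smooth_y S_sub]])
  have sl: "smooth_on S l"
    unfolding l_def[abs_def] by (rule smooth_on_vec_nth[OF open_S sR])
  have "y x0 = M (axis 3 1)"
    by (simp add: M_def axis_def)
  then have l0: "l x0 = 1"
    by (simp add: l_def RM)
  define S1 where "S1 = {x \<in> S. 0 < l x}"
  have S1: "open S1" "S1 \<subseteq> S" "x0 \<in> S1"
    unfolding S1_def using open_superlevel[OF open_S smooth_on_continuous[OF sl]] x0 l0 by auto
  have lpos: "l x > 0" if "x \<in> S1" for x
    using that by (simp add: S1_def)
  have S1U: "x \<in> U" if "x \<in> S1" for x
    using that S1(2) S_sub by blast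
  define \<Phi> where "\<Phi> x = g x *\<^sub>R axis 1 1 + (R (y x) $ 1 / l x) *\<^sub>R axis 2 1 + (R (y x) $ 2 / l x) *\<^sub>R (axis 3 1 :: real^3)" for x
  have \<Phi>_nth: "\<Phi> x $ 1 = g x" "\<Phi> x $ 2 = R (y x) $ 1 / l x" "\<Phi> x $ 3 = R (y x) $ 2 / l x" for x
    by (simp_all add: \<Phi>_def axis_def)
  have s\<Phi>: "smooth_on S1 \<Phi>"
    unfolding \<Phi>_def[abs_def]
  proof (intro smooth_on_add smooth_on_scaleR smooth_on_divide smooth_on_const smooth_on_vec_nth S1(1))
    show "smooth_on S1 g"
      using smooth_on_subset[OF smooth_g S_sub] smooth_on_subset S1(2) by blast
    show "smooth_on S1 (\<lambda>x. R (y x))" "smooth_on S1 (\<lambda>x. R (y x))"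
      using smooth_on_subset[OF sR S1(2)] by simp_all
    show "smooth_on S1 l" "smooth_on S1 l"
      using smooth_on_subset[OF sl S1(2)] by simp_all
    show "l x \<noteq> 0" "l x \<noteq> 0" if "x \<in> S1" for x
      using lpos[OF that] by simp_all
  qed
  define P where "P w = w $ 2 *\<^sub>R axis 1 1 + w $ 3 *\<^sub>R axis 2 1 + (axis 3 1 :: real^3)" for w :: "real^3"
  have rel: "R (y x) = l x *\<^sub>R P (\<Phi> x)" if "x \<in> S1" for x
    using lpos[OF that] by (simp add: P_def \<Phi>_nth vec_eq_iff forall_3 axis_def) (simp add: l_def)
  have y_rel: "y x = l x *\<^sub>R M (P (\<Phi> x))" if "x \<in> S1" for x
    using arg_cong[OF rel[OF that], of M] by (simp add: MR linear_scale[OF linM])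
  \<comment> \<open>If \<open>d\<Phi>(u) = 0\<close> then \<open>u\<close> is orthogonal to
    \<open>T\<close> because \<open>g\<close> is stationary, and \<open>dy(u)\<close> is a multiple
    of \<open>y\<close> because the ratios are; \<open>transverse_y\<close> gives
    \<open>u = 0\<close>.\<close>
  have inj: "inj (frechet_derivative \<Phi> (at x0))"
  proof (rule linear_injective_0[OF smooth_on_linear_dd[OF s\<Phi> S1(3)], THEN iffD2], intro allI impI)
    fix u assume u: "dd \<Phi> x0 u = 0"
    note d\<Phi> = smooth_on_has_dd[OF s\<Phi> S1(3)]
    have nth: "((\<lambda>x. \<Phi> x $ i) has_derivative (\<lambda>u. dd \<Phi> x0 u $ i)) (at x0)" for i
      by (rule bounded_linear.has_derivative[OF bounded_linear_vec_nth d\<Phi>])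
    have "dd g x0 u = dd \<Phi> x0 u $ 1"
      using dd_eqI[OF nth[of 1]] by (simp add: \<Phi>_nth)
    then have hu: "h x0 u (Tf x0) = 0"
      using kappa_nonzero[OF x0U] by (simp add: u dg[OF x0U])
    have "((\<lambda>x. l x *\<^sub>R M (P (\<Phi> x))) has_derivative (\<lambda>u. l x0 *\<^sub>R M (dd \<Phi> x0 u $ 2 *\<^sub>R axis 1 1 + dd \<Phi> x0 u $ 3 *\<^sub>R axis 2 1 + 0)
        + dd l x0 u *\<^sub>R M (P (\<Phi> x0)))) (at x0)"
      unfolding P_def
      by (intro has_derivative_scaleR smooth_on_has_dd[OF sl x0] has_derivative_add has_derivative_scaleR_left
          bounded_linear.has_derivative[OF linM[unfolded linear_conv_bounded_linear]] nth has_derivative_const)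
    then have hd: "(y has_derivative (\<lambda>u. l x0 *\<^sub>R M (dd \<Phi> x0 u $ 2 *\<^sub>R axis 1 1 + dd \<Phi> x0 u $ 3 *\<^sub>R axis 2 1 + 0)
        + dd l x0 u *\<^sub>R M (P (\<Phi> x0)))) (at x0)"
      by (rule has_derivative_cong_open[OF S1(1,3), rotated]) (rule y_rel[symmetric])
    have "N (dd f x0 u) = dd l x0 u *\<^sub>R y x0"
      using dd_eqI[OF hd, of u] by (simp add: dy[OF x0U] u linear_0[OF linM] y_rel[OF S1(3)] l0)
    then show "u = 0"
      by (rule transverse_y(1)[OF x0U hu])
  qed
  obtain S' T G where S': "open S'" "S' \<subseteq> S1" "x0 \<in> S'" "open T" and hom: "homeomorphism S' T \<Phi> G"
    and sG: "smooth_on T G"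
    using smooth_inverse_function_theorem[OF S1(1) s\<Phi> S1(3) inj] by metis
  have GT: "G w \<in> S'" "\<Phi> (G w) = w" if "w \<in> T" for w
    using hom that by (auto simp: homeomorphism_def)
  have GS: "\<Phi> x \<in> T" "G (\<Phi> x) = x" if "x \<in> S'" for x
    using hom that by (auto simp: homeomorphism_def)
  obtain t0 v0 where tv0: "unemb (\<Phi> x0) = (t0, v0)"
    by (cases "unemb (\<Phi> x0)")
  have "open (emb -` T)"
    using S'(4) linear_emb by (intro open_vimage linear_continuous_on) (auto simp: linear_conv_bounded_linear)
  moreover have "(t0, v0) \<in> emb -` T"
    unfolding tv0[symmetric] using GS(1)[OF S'(3)] by simp
  ultimately obtain A B where AB: "open A" "open B" "(t0, v0) \<in> A \<times> B" "A \<times> B \<subseteq> emb -` T"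
    by (rule open_prod_elim)
  obtain r1 where r1: "r1 > 0" "ball t0 r1 \<subseteq> A"
    using AB openE by blast
  obtain r2 where r2: "r2 > 0" "ball v0 r2 \<subseteq> B"
    using AB openE by blast
  \<comment> \<open>Balls make \<open>I\<close> an interval and \<open>N0\<close> convex, which
    later turns vanishing derivatives into constancy.\<close>
  define I where "I = ball t0 r1"
  define N0 where "N0 = ball v0 r2"
  have IN: "I \<times> N0 \<subseteq> emb -` T"
    using r1(2) r2(2) AB(4) unfolding I_def N0_def by blast
  have oIN: "open (I \<times> N0)"
    by (intro open_Times) (simp_all add: I_def N0_def)
  define \<theta> where "\<theta> z = G (emb z)" for z
  define \<Theta> where "\<Theta> x = unemb (\<Phi> x)" for x
  have \<theta>S: "\<theta> z \<in> S'" "\<Phi> (\<theta> z) = emb z" "\<Theta> (\<theta> z) = z" if "z \<in> I \<times> N0" for z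
    using GT[of "emb z"] IN that by (auto simp: \<theta>_def \<Theta>_def)
  have s\<theta>: "smooth_on (I \<times> N0) \<theta>"
    unfolding \<theta>_def[abs_def]
  proof (rule smooth_on_compose[OF oIN S'(4) _ sG])
    show "emb ` (I \<times> N0) \<subseteq> T" using IN by blast
    show "smooth_on (I \<times> N0) emb"
      using smooth_on_linear[OF linear_emb oIN smooth_on_id[OF oIN]] .
  qed
  have s\<Theta>: "smooth_on S' \<Theta>"
    unfolding \<Theta>_def[abs_def] by (rule smooth_on_linear[OF linear_unemb S'(1) smooth_on_subset[OF s\<Phi> S'(2)]])
  have img: "\<theta> ` (I \<times> N0) = S' \<inter> \<Theta> -` (I \<times> N0)"
  proof
    show "\<theta> ` (I \<times> N0) \<subseteq> S' \<inter> \<Theta> -` (I \<times> N0)"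
      using \<theta>S by auto
    show "S' \<inter> \<Theta> -` (I \<times> N0) \<subseteq> \<theta> ` (I \<times> N0)"
    proof
      fix x assume x: "x \<in> S' \<inter> \<Theta> -` (I \<times> N0)"
      then have "x = \<theta> (\<Theta> x)"
        using GS(2)[of x] by (simp add: \<theta>_def \<Theta>_def)
      then show "x \<in> \<theta> ` (I \<times> N0)"
        by (rule image_eqI) (use x in simp)
    qed
  qed
  have o\<theta>: "open (\<theta> ` (I \<times> N0))"
    unfolding img by (rule continuous_open_preimage[OF smooth_on_continuous[OF s\<Theta>] S'(1) oIN])
  have x0\<theta>: "x0 \<in> \<theta> ` (I \<times> N0)"
    unfolding img using S'(3) tv0 r1 r2 by (simp add: \<Theta>_def I_def N0_def)
  have \<theta>S1: "\<theta> z \<in> S1" if "z \<in> I \<times> N0" for z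
    using \<theta>S(1)[OF that] S'(2) by blast
  have s\<rho>: "smooth_on (I \<times> N0) (\<lambda>z. l (\<theta> z))"
    by (rule smooth_on_compose[OF oIN open_S _ sl s\<theta>]) (use \<theta>S1 S1(2) in blast)
  show ?thesis
  \<comment> \<open>\<open>\<rho>\<close> is the third coordinate of \<open>y\<close>, and
    \<open>sec v\<close> is the point with coordinates \<open>(v1, v2, 1)\<close> on the ray of
    \<open>y\<close>.\<close>
  proof (rule exI[of _ I], rule exI[of _ N0], rule exI[of _ \<theta>], rule exI[of _ \<Theta>], rule exI[of _ "\<lambda>z. l (\<theta> z)"],
      rule exI[of _ "\<lambda>v::real^2. M (v $ 1 *\<^sub>R axis 1 1 + v $ 2 *\<^sub>R axis 2 1 + axis 3 1)"], intro conjI ballI)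
    show "is_interval I"
      unfolding I_def by (rule is_interval_ball_real)
    show "smooth_on (\<theta> ` (I \<times> N0)) \<Theta>"
      by (rule smooth_on_subset[OF s\<Theta>]) (use img in blast)
    show "\<theta> ` (I \<times> N0) \<subseteq> S"
      using \<theta>S1 S1(2) by blast
    fix t v assume "t \<in> I" "v \<in> N0"
    then have z: "(t, v) \<in> I \<times> N0" by simp
    show "g (\<theta> (t, v)) = t"
      using \<Phi>_nth(1)[of "\<theta> (t, v)"] \<theta>S(2)[OF z] by simp
    show "y (\<theta> (t, v)) = l (\<theta> (t, v)) *\<^sub>R M (v $ 1 *\<^sub>R axis 1 1 + v $ 2 *\<^sub>R axis 2 1 + axis 3 1)"
      using y_rel[OF \<theta>S1[OF z]] \<theta>S(2)[OF z] by (simp add: P_def)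
    show "0 < l (\<theta> (t, v))"
      by (rule lpos[OF \<theta>S1[OF z]])
  qed (use s\<theta> o\<theta> x0\<theta> s\<rho> \<theta>S(3) in \<open>simp_all add: I_def N0_def\<close>)
qed

end

section \<open>The surface\<close>

locale box = adapted_frame_chart +
  fixes I :: "real set" and N0 :: "(real^2) set" and \<theta> :: "real \<times> (real^2) \<Rightarrow> real^3"
    and \<Theta> :: "real^3 \<Rightarrow> real \<times> (real^2)" and \<rho> :: "real \<times> (real^2) \<Rightarrow> real" and sec :: "real^2 \<Rightarrow> real^3"
    and t0 :: real and v0 :: "real^2"
  assumes open_I: "open I" and interval_I: "is_interval I" and open_N0: "open N0" and convex_N0: "convex N0"
    and smooth_theta: "smooth_on (I \<times> N0) \<theta>" and theta_S: "\<theta> ` (I \<times> N0) \<subseteq> S"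
    and open_image: "open (\<theta> ` (I \<times> N0))" and smooth_Theta: "smooth_on (\<theta> ` (I \<times> N0)) \<Theta>"
    and Theta_theta: "\<And>z. z \<in> I \<times> N0 \<Longrightarrow> \<Theta> (\<theta> z) = z" and smooth_rho: "smooth_on (I \<times> N0) \<rho>"
    and g_theta: "\<And>t v. t \<in> I \<Longrightarrow> v \<in> N0 \<Longrightarrow> g (\<theta> (t, v)) = t"
    and y_theta: "\<And>t v. t \<in> I \<Longrightarrow> v \<in> N0 \<Longrightarrow> y (\<theta> (t, v)) = \<rho> (t, v) *\<^sub>R sec v"
    and rho_pos: "\<And>t v. t \<in> I \<Longrightarrow> v \<in> N0 \<Longrightarrow> \<rho> (t, v) > 0"
    and t0: "t0 \<in> I" and v0: "v0 \<in> N0"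
begin

lemma open_box: "open (I \<times> N0)"
  by (rule open_Times[OF open_I open_N0])

lemma theta_in_S: "z \<in> I \<times> N0 \<Longrightarrow> \<theta> z \<in> S"
  using theta_S by blast

lemma theta_in_U: "z \<in> I \<times> N0 \<Longrightarrow> \<theta> z \<in> U"
  by (rule in_U[OF theta_in_S])

lemmas theta_has_dd = smooth_on_has_dd[OF smooth_theta]

lemma dtheta_inverse:
  assumes z: "z \<in> I \<times> N0"
  shows "dd \<Theta> (\<theta> z) (dd \<theta> z \<zeta>) = \<zeta>" "dd \<theta> z (dd \<Theta> (\<theta> z) u) = u"
proof -
  have im: "\<theta> z \<in> \<theta> ` (I \<times> N0)"
    using z by blast
  have 1: "((\<lambda>z. \<Theta> (\<theta> z)) has_derivative (\<lambda>\<zeta>. dd \<Theta> (\<theta> z) (dd \<theta> z \<zeta>))) (at z)"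
    by (rule has_derivative_chain[OF theta_has_dd[OF z] smooth_on_has_dd[OF smooth_Theta im] refl])
  have "((\<lambda>z. z) has_derivative (\<lambda>\<zeta>. dd \<Theta> (\<theta> z) (dd \<theta> z \<zeta>))) (at z)"
    by (rule has_derivative_cong_open[OF open_box z Theta_theta 1])
  from has_derivative_unique[OF this has_derivative_ident] show "dd \<Theta> (\<theta> z) (dd \<theta> z \<zeta>) = \<zeta>"
    by metis
  have 2: "((\<lambda>x. \<theta> (\<Theta> x)) has_derivative (\<lambda>u. dd \<theta> z (dd \<Theta> (\<theta> z) u))) (at (\<theta> z))"
    by (rule has_derivative_chain[OF smooth_on_has_dd[OF smooth_Theta im] theta_has_dd[OF z] Theta_theta[OF z]])
  have "((\<lambda>x. x) has_derivative (\<lambda>u. dd \<theta> z (dd \<Theta> (\<theta> z) u))) (at (\<theta> z))"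
    by (rule has_derivative_cong_open[OF open_image im _ 2]) (use Theta_theta in auto)
  from has_derivative_unique[OF this has_derivative_ident] show "dd \<theta> z (dd \<Theta> (\<theta> z) u) = u"
    by metis
qed

lemma dg_theta:
  assumes z: "z \<in> I \<times> N0"
  shows "- \<kappa> (\<theta> z) * h (\<theta> z) (dd \<theta> z \<zeta>) (Tf (\<theta> z)) = fst \<zeta>"
proof -
  have 1: "((\<lambda>z. g (\<theta> z)) has_derivative (\<lambda>\<zeta>. dd g (\<theta> z) (dd \<theta> z \<zeta>))) (at z)"
    by (rule has_derivative_chain[OF theta_has_dd[OF z] smooth_on_has_dd[OF smooth_g theta_in_U[OF z]] refl])
  have "(fst has_derivative (\<lambda>\<zeta>. dd g (\<theta> z) (dd \<theta> z \<zeta>))) (at z)"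
    by (rule has_derivative_cong_open[OF open_box z _ 1]) (use g_theta in auto)
  moreover have "(fst has_derivative fst) (at z)"
    by (rule bounded_linear_imp_has_derivative[OF bounded_linear_fst])
  ultimately have "(\<lambda>\<zeta>. dd g (\<theta> z) (dd \<theta> z \<zeta>)) = fst"
    by (rule has_derivative_unique)
  then show ?thesis
    using dg[OF theta_in_U[OF z]] by metis
qed

lemma slice_tangent: "z \<in> I \<times> N0 \<Longrightarrow> h (\<theta> z) (dd \<theta> z (0, w)) (Tf (\<theta> z)) = 0"
  using dg_theta[of z "(0, w)"] kappa_nonzero[OF theta_in_U, of z] by simp

lemma slice_tangentD:
  assumes z: "z \<in> I \<times> N0" and u: "h (\<theta> z) u (Tf (\<theta> z)) = 0"
  obtains w where "u = dd \<theta> z (0, w)"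
proof -
  let ?\<zeta> = "dd \<Theta> (\<theta> z) u"
  have J: "dd \<theta> z ?\<zeta> = u"
    by (rule dtheta_inverse(2)[OF z])
  then have "fst ?\<zeta> = 0"
    using dg_theta[OF z, of ?\<zeta>] u by simp
  then have "u = dd \<theta> z (0, snd ?\<zeta>)"
    using J by (metis prod.collapse)
  then show ?thesis
    by (rule that)
qed

lemma Pair_has_derivative_right: "((\<lambda>w. (t, w)) has_derivative (\<lambda>w. (0, w))) (at v)"
  using has_derivative_Pair[OF has_derivative_const[where c = t] has_derivative_ident] .

lemma slice_has_derivative:
  assumes z: "t \<in> I" "v \<in> N0"
  shows "((\<lambda>v. \<theta> (t, v)) has_derivative (\<lambda>w. dd \<theta> (t, v) (0, w))) (at v)"
  by (rule has_derivative_chain[OF Pair_has_derivative_right theta_has_dd refl]) (use z in simp)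

section \<open>Separation of variables\<close>

lemma slice_constant:
  fixes k :: "real^3 \<Rightarrow> real"
  assumes t: "t \<in> I" and v: "v \<in> N0"
    and k: "\<And>x. x \<in> S \<Longrightarrow> \<exists>D. (k has_derivative D) (at x) \<and> (\<forall>u. h x u (Tf x) = 0 \<longrightarrow> D u = 0)"
  shows "k (\<theta> (t, v)) = k (\<theta> (t, v0))"
proof -
  have d: "((\<lambda>v. k (\<theta> (t, v))) has_derivative (\<lambda>w. 0)) (at v)" if v: "v \<in> N0" for v
  proof -
    have z: "(t, v) \<in> I \<times> N0"
      using t v by simp
    obtain D where D: "(k has_derivative D) (at (\<theta> (t, v)))"
      "\<And>u. h (\<theta> (t, v)) u (Tf (\<theta> (t, v))) = 0 \<Longrightarrow> D u = 0"
      using k[OF theta_in_S[OF z]] by blast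
    have "((\<lambda>v. k (\<theta> (t, v))) has_derivative (\<lambda>w. D (dd \<theta> (t, v) (0, w)))) (at v)"
      by (rule has_derivative_chain[OF slice_has_derivative[OF t v] D(1) refl])
    then show ?thesis
      by (rule has_derivative_eqI) (rule D(2)[OF slice_tangent[OF z]])
  qed
  show ?thesis
    by (rule has_derivative_zero_unique[OF convex_N0 has_derivative_at_withinI[OF d] v v0])
qed

lemma slice_constants:
  assumes t: "t \<in> I" and v: "v \<in> N0"
  shows "qf (\<theta> (t, v)) = qf (\<theta> (t, v0))" "nf (\<theta> (t, v)) = nf (\<theta> (t, v0))" "af (\<theta> (t, v)) = af (\<theta> (t, v0))"
    "\<kappa> (\<theta> (t, v)) = \<kappa> (\<theta> (t, v0))" "\<Delta> (\<theta> (t, v)) = \<Delta> (\<theta> (t, v0))"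
proof -
  note sc = slice_constant[OF t v]
  show "qf (\<theta> (t, v)) = qf (\<theta> (t, v0))"
    by (rule sc) (use qf_has_derivative in_U in force)
  show "nf (\<theta> (t, v)) = nf (\<theta> (t, v0))"
    by (rule sc) (use nf_has_derivative(1) in_U in force)
  show "af (\<theta> (t, v)) = af (\<theta> (t, v0))"
    by (rule sc) (use nf_has_derivative(2) in_U in force)
  show "\<kappa> (\<theta> (t, v)) = \<kappa> (\<theta> (t, v0))"
    by (rule sc) (use kappa_has_derivative in_U in force)
  show "\<Delta> (\<theta> (t, v)) = \<Delta> (\<theta> (t, v0))"
    by (rule sc) (metis Delta_slice)
qed

text \<open>With \<open>v\<close> fixed, \<open>y\<close> stays on one ray, so its velocity is a
  multiple of \<open>y\<close>. Removing the \<open>T\<close>-component of the velocity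
  \<open>u\<close> leaves a slice-tangent vector with the same property, which
  \<open>transverse_y\<close> forces to vanish; the rate is that of \<open>T\<close> alone, built
  from quantities constant on slices.\<close>

lemma rho_log_derivative:
  assumes t: "t \<in> I" and v: "v \<in> N0"
  shows "dd \<rho> (t, v) (1, 0) = \<rho> (t, v) * ((nf (\<theta> (t, v0)) + af (\<theta> (t, v0))) / \<kappa> (\<theta> (t, v0)))"
proof -
  have z: "(t, v) \<in> I \<times> N0"
    using t v by simp
  define x where "x = \<theta> (t, v)"
  define u where "u = dd \<theta> (t, v) (1, 0)"
  have xU: "x \<in> U"
    unfolding x_def by (rule theta_in_U[OF z])
  have hu: "- \<kappa> x * h x u (Tf x) = 1"
    using dg_theta[OF z, of "(1, 0)"] by (simp add: x_def u_def)
  have Pd: "((\<lambda>s. (s, v)) has_derivative (\<lambda>s. (s, 0))) (at t)"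
    by (intro has_derivative_Pair has_derivative_ident has_derivative_const)
  have th: "((\<lambda>s. \<theta> (s, v)) has_derivative (\<lambda>s. dd \<theta> (t, v) (s, 0))) (at t)"
    by (rule has_derivative_chain[OF Pd theta_has_dd[OF z] refl])
  have dyx: "(y has_derivative (\<lambda>u. N (dd f x u))) (at x)"
    by (rule has_derivative_eqI[OF smooth_on_has_dd[OF smooth_y xU]]) (rule dy[OF xU])
  have 1: "((\<lambda>s. y (\<theta> (s, v))) has_derivative (\<lambda>s. N (dd f x (dd \<theta> (t, v) (s, 0))))) (at t)"
    by (rule has_derivative_chain[OF th dyx]) (simp add: x_def)
  have r: "((\<lambda>s. \<rho> (s, v)) has_derivative (\<lambda>s. dd \<rho> (t, v) (s, 0))) (at t)"
    by (rule has_derivative_chain[OF Pd smooth_on_has_dd[OF smooth_rho z] refl])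
  have "((\<lambda>s. \<rho> (s, v) *\<^sub>R sec v) has_derivative (\<lambda>s. dd \<rho> (t, v) (s, 0) *\<^sub>R sec v)) (at t)"
    by (rule has_derivative_scaleR_left[OF r])
  then have 2: "((\<lambda>s. y (\<theta> (s, v))) has_derivative (\<lambda>s. dd \<rho> (t, v) (s, 0) *\<^sub>R sec v)) (at t)"
    by (rule has_derivative_cong_open[OF open_I t, rotated]) (use y_theta v in simp)
  have "N (dd f x u) = dd \<rho> (t, v) (1, 0) *\<^sub>R sec v"
    using fun_cong[OF has_derivative_unique[OF 1 2], of 1] by (simp add: u_def)
  also have "sec v = (1 / \<rho> (t, v)) *\<^sub>R y x"
    using y_theta[OF t v] rho_pos[OF t v] by (simp add: x_def)
  finally have Nu: "N (dd f x u) = (dd \<rho> (t, v) (1, 0) / \<rho> (t, v)) *\<^sub>R y x"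
    by simp
  let ?X = "u + h x u (Tf x) *\<^sub>R Tf x"
  have hX: "h x ?X (Tf x) = 0"
    by (simp add: metric_bilinear xU Tf_timelike)
  have "N (tt x) = (nf x + af x) *\<^sub>R y x"
    by (simp add: N_tt[OF xU] y_eq[OF xU])
  then have "N (dd f x ?X) = (dd \<rho> (t, v) (1, 0) / \<rho> (t, v) + h x u (Tf x) * (nf x + af x)) *\<^sub>R y x"
    by (simp add: linear_add[OF linear_df[OF xU]] linear_scale[OF linear_df[OF xU]] linear_add[OF linear_N]
        linear_scale[OF linear_N] Nu tt_def[symmetric] scaleR_add_left algebra_simps)
  from transverse_y(2)[OF xU hX this]
  have "dd \<rho> (t, v) (1, 0) / \<rho> (t, v) = - h x u (Tf x) * (nf x + af x)"
    by simp
  moreover have "- h x u (Tf x) = 1 / \<kappa> x"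
    using hu kappa_nonzero[OF xU] by (simp add: field_simps)
  ultimately have "dd \<rho> (t, v) (1, 0) = \<rho> (t, v) * ((nf x + af x) / \<kappa> x)"
    using rho_pos[OF t v] by (simp add: field_simps)
  then show ?thesis
    by (simp add: x_def slice_constants[OF t v])
qed

text \<open>\<open>\<rho> (t, v)\<close> and \<open>\<rho> (t, v0)\<close> satisfy the same linear
  equation in \<open>t\<close>, so their ratio is constant.\<close>

lemma rho_product:
  assumes t: "t \<in> I" and v: "v \<in> N0"
  shows "\<rho> (t, v) = \<rho> (t, v0) / \<rho> (t0, v0) * \<rho> (t0, v)"
proof -
  let ?r = "\<lambda>t. \<rho> (t, v) / \<rho> (t, v0)"
  have d: "(?r has_derivative (\<lambda>s. 0)) (at t)" if t: "t \<in> I" for t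
  proof -
    have r: "((\<lambda>s. \<rho> (s, v)) has_derivative (\<lambda>s. s * (\<rho> (t, v) * ((nf (\<theta> (t, v0)) + af (\<theta> (t, v0))) / \<kappa> (\<theta> (t, v0)))))) (at t)"
      if v: "v \<in> N0" for v
    proof -
      have z: "(t, v) \<in> I \<times> N0"
        using t v by simp
      have Pd: "((\<lambda>s. (s, v)) has_derivative (\<lambda>s. (s, 0))) (at t)"
        by (intro has_derivative_Pair has_derivative_ident has_derivative_const)
      have "((\<lambda>s. \<rho> (s, v)) has_derivative (\<lambda>s. dd \<rho> (t, v) (s, 0))) (at t)"
        by (rule has_derivative_chain[OF Pd smooth_on_has_dd[OF smooth_rho z] refl])
      moreover have "dd \<rho> (t, v) (s, 0) = s * dd \<rho> (t, v) (1, 0)" for s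
        using linear_scale[OF smooth_on_linear_dd[OF smooth_rho z], of s "(1, 0)"] by simp
      ultimately show ?thesis
        unfolding rho_log_derivative[OF t v, symmetric] by (rule has_derivative_eqI)
    qed
    have nz: "\<rho> (t, v0) \<noteq> 0"
      using rho_pos[OF t v0] by simp
    have "(?r has_derivative (\<lambda>s. (s * (\<rho> (t, v) * ((nf (\<theta> (t, v0)) + af (\<theta> (t, v0))) / \<kappa> (\<theta> (t, v0)))) * \<rho> (t, v0) -
        \<rho> (t, v) * (s * (\<rho> (t, v0) * ((nf (\<theta> (t, v0)) + af (\<theta> (t, v0))) / \<kappa> (\<theta> (t, v0)))))) /
        (\<rho> (t, v0) * \<rho> (t, v0)))) (at t)"
      by (rule has_derivative_divide'[OF r[OF v] r[OF v0] nz])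
    then show ?thesis
      by (rule has_derivative_eqI) simp
  qed
  have "convex I"
    using interval_I is_interval_convex by blast
  then have "?r t = ?r t0"
    by (rule has_derivative_zero_unique[OF _ has_derivative_at_withinI[OF d] t t0])
  then show ?thesis
    using rho_pos[OF t v0] rho_pos[OF t0 v0] by (simp add: field_simps)
qed

text \<open>Normalized to \<open>\<gamma> t0 = 1\<close>, so that \<open>\<sigma>\<close> is the
  slice at \<open>t0\<close> itself.\<close>

definition "\<gamma> t = \<rho> (t, v0) / \<rho> (t0, v0)"
definition "\<sigma> v = y (\<theta> (t0, v))"

lemma smooth_gamma: "smooth_on I \<gamma>"
proof -
  have "smooth_on I (\<lambda>t. \<rho> (t, v0))"
    by (rule smooth_on_compose[OF open_I open_box _ smooth_rho])
      (use v0 in \<open>auto intro!: smooth_on_Pair open_I smooth_on_id smooth_on_const\<close>)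
  then have "smooth_on I (\<lambda>t. \<rho> (t, v0) * (1 / \<rho> (t0, v0)))"
    by (rule smooth_on_mult[OF open_I]) (rule smooth_on_const[OF open_I])
  then show ?thesis
    by (simp add: \<gamma>_def[abs_def])
qed

lemma product_form:
  assumes "t \<in> I" "v \<in> N0"
  shows "L (f (\<theta> (t, v)) - C) = vector [t, \<gamma> t * \<sigma> v $ 1, \<gamma> t * \<sigma> v $ 2, \<gamma> t * \<sigma> v $ 3]"
proof -
  have "y (\<theta> (t, v)) = \<gamma> t *\<^sub>R \<sigma> v"
    unfolding \<sigma>_def y_theta[OF assms] y_theta[OF t0 assms(2)] rho_product[OF assms] \<gamma>_def by simp
  then have "tail (L (f (\<theta> (t, v)) - C)) = \<gamma> t *\<^sub>R \<sigma> v"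
    by (simp add: y_def)
  moreover have "L (f (\<theta> (t, v)) - C) $ 1 = t"
    using g_theta[OF assms] by (simp add: g_def)
  ultimately show ?thesis
    by (simp add: vec_eq_iff forall_4 forall_3)
qed

section \<open>The slice at \<open>t0\<close> as an immersed surface\<close>

definition "X v w = dd \<theta> (t0, v) (0, w)"

lemma box_slice: "v \<in> N0 \<Longrightarrow> (t0, v) \<in> I \<times> N0"
  using t0 by simp

lemma linear_X: "v \<in> N0 \<Longrightarrow> linear (X v)"
  unfolding X_def[abs_def]
  by (rule linear_compose2[OF _ smooth_on_linear_dd[OF smooth_theta box_slice]])
    (rule linearI, simp_all)

lemma X_zero: "v \<in> N0 \<Longrightarrow> X v w = 0 \<Longrightarrow> w = 0"
  using dtheta_inverse(1)[OF box_slice, of v "(0, w)"]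
    linear_0[OF smooth_on_linear_dd[OF smooth_Theta, of "\<theta> (t0, v)"]] box_slice[of v]
  by (simp add: X_def zero_prod_def)

lemma X_slice: "v \<in> N0 \<Longrightarrow> h (\<theta> (t0, v)) (X v w) (Tf (\<theta> (t0, v))) = 0"
  unfolding X_def by (rule slice_tangent[OF box_slice])

lemma smooth_slice: "smooth_on N0 (\<lambda>v. \<theta> (t0, v))"
  by (rule smooth_on_compose[OF open_N0 open_box _ smooth_theta])
    (use t0 in \<open>auto intro!: smooth_on_Pair open_N0 smooth_on_id smooth_on_const\<close>)

lemma smooth_sigma: "smooth_on N0 \<sigma>"
  unfolding \<sigma>_def[abs_def]
  by (rule smooth_on_compose[OF open_N0 open_U _ smooth_y smooth_slice]) (use theta_in_U box_slice in blast)

lemma sigma_has_derivative: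
  assumes v: "v \<in> N0"
  shows "(\<sigma> has_derivative (\<lambda>w. N (dd f (\<theta> (t0, v)) (X v w)))) (at v)"
proof -
  note xU = theta_in_U[OF box_slice[OF v]]
  have dyx: "(y has_derivative (\<lambda>u. N (dd f (\<theta> (t0, v)) u))) (at (\<theta> (t0, v)))"
    by (rule has_derivative_eqI[OF smooth_on_has_dd[OF smooth_y xU]]) (rule dy[OF xU])
  show ?thesis
    unfolding \<sigma>_def[abs_def] X_def
    by (rule has_derivative_chain[OF slice_has_derivative[OF t0 v] dyx refl])
qed

lemma dsigma: "v \<in> N0 \<Longrightarrow> dd \<sigma> v w = N (dd f (\<theta> (t0, v)) (X v w))"
  by (rule dd_eqI[OF sigma_has_derivative])

lemma sigma_transverse:
  assumes v: "v \<in> N0" and eq: "dd \<sigma> v w = c *\<^sub>R \<sigma> v"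
  shows "w = 0" "c = 0"
proof -
  have "X v w = 0" "c = 0"
    using transverse_y[OF theta_in_U[OF box_slice[OF v]] X_slice[OF v], of w c] eq
    by (simp_all add: dsigma[OF v] \<sigma>_def)
  then show "w = 0" "c = 0"
    using X_zero[OF v] by simp_all
qed

text \<open>The \<open>et\<close>-component of the second derivative of \<open>\<sigma>\<close> is found without computation: the second
  derivative stays in the kernel of the covector \<open>lamf\<close>.\<close>

lemma sigma_second_derivative:
  assumes v: "v \<in> N0"
  obtains w'' where "dd (\<lambda>v. dd \<sigma> v w') v w =
    dd \<sigma> v w'' + (qf (\<theta> (t0, v)) * h (\<theta> (t0, v)) (X v w) (X v w')) *\<^sub>R \<sigma> v"
proof -
  note z = box_slice[OF v]
  define x where "x = \<theta> (t0, v)"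
  have xU: "x \<in> U"
    unfolding x_def by (rule theta_in_U[OF z])
  have sX: "smooth_on N0 (\<lambda>v. X v w')"
  proof -
    have *: "smooth_on N0 (\<lambda>v. (\<lambda>z. dd \<theta> z (0, w')) (t0, v))"
      by (rule smooth_on_compose[OF open_N0 open_box _ smooth_on_dd[OF smooth_theta]])
        (use t0 in \<open>auto intro!: smooth_on_Pair open_N0 smooth_on_id smooth_on_const\<close>)
    then show ?thesis
      by (simp add: X_def)
  qed
  define Z where "Z = conn x (X v w) (X v w') + dd (\<lambda>v. X v w') v w"
  define \<eta> where "\<eta> = h x (X v w) (X v w')"
  let ?D = "\<lambda>w. dd (\<lambda>x. dd f x (X v w')) x (X v w) + dd f x (dd (\<lambda>v. X v w') v w)"
  have hd: "((\<lambda>v. dd f (\<theta> (t0, v)) (X v w')) has_derivative ?D) (at v)"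
  proof (rule linear_family_has_derivative[where L = "\<lambda>v. frechet_derivative f (at (\<theta> (t0, v)))", OF open_N0 v _ _
        smooth_on_has_dd[OF sX v], folded x_def])
    show "linear (frechet_derivative f (at (\<theta> (t0, v))))" if "v \<in> N0" for v
      by (rule linear_df[OF theta_in_U[OF box_slice[OF that]]])
    show "((\<lambda>v. dd f (\<theta> (t0, v)) b) has_derivative (\<lambda>w. dd (\<lambda>x. dd f x b) x (X v w))) (at v)" for b
      unfolding X_def
      by (rule has_derivative_chain[OF slice_has_derivative[OF t0 v] smooth_on_has_dd[OF smooth_on_dd[OF smooth_f] xU]])
        (simp add: x_def)
  qed
  have D: "?D w = dd f x Z + \<eta> *\<^sub>R \<xi> x"
    unfolding gauss_const[OF xU] Z_def \<eta>_def by (simp add: linear_add[OF linear_df[OF xU]] algebra_simps)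
  have "((\<lambda>v. L (dd f (\<theta> (t0, v)) (X v w')) $ 1) has_derivative (\<lambda>w. L (?D w) $ 1)) (at v)"
    by (rule bounded_linear.has_derivative[OF linear_L1[unfolded linear_conv_bounded_linear] hd])
  then have "((\<lambda>v. 0) has_derivative (\<lambda>w. L (?D w) $ 1)) (at v)"
    by (rule has_derivative_cong_open[OF open_N0 v, rotated])
      (simp add: L1_tangent[OF theta_in_U[OF box_slice]] X_slice)
  from fun_cong[OF has_derivative_unique[OF this has_derivative_const], of w]
  have "L (?D w) $ 1 = 0" .
  then have "lamf x (dd f x Z + \<eta> *\<^sub>R \<xi> x) = 0"
    using L1_eq[OF xU, of "?D w"] kappa_nonzero[OF xU] unfolding D by simp
  then have Z0: "h x Z (Tf x) + (nf x - af x) * \<eta> = 0"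
    by (simp add: lamf_eq[OF xU])
  \<comment> \<open>The \<open>T\<close>-part of \<open>Z\<close> is exactly what completes
    \<open>\<xi>\<close> to \<open>et\<close>; removing it leaves a vector tangent to the
    slice.\<close>
  define Z' where "Z' = Z - (\<eta> * (nf x - af x)) *\<^sub>R Tf x"
  have "h x Z' (Tf x) = 0"
    using Z0 by (simp add: Z'_def metric_bilinear xU Tf_timelike algebra_simps)
  then obtain w'' where w'': "Z' = X v w''"
    unfolding x_def X_def by (rule slice_tangentD[OF z])
  have "dd f x Z + \<eta> *\<^sub>R \<xi> x = dd f x Z' + \<eta> *\<^sub>R et x"
    unfolding Z'_def et_def tt_def linear_diff[OF linear_df[OF xU]] linear_scale[OF linear_df[OF xU]]
    by (simp add: algebra_simps)
  moreover have "((\<lambda>v. N (dd f (\<theta> (t0, v)) (X v w'))) has_derivative (\<lambda>w. N (?D w))) (at v)"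
    by (rule N_has_derivative[OF hd])
  then have "((\<lambda>v. dd \<sigma> v w') has_derivative (\<lambda>w. N (?D w))) (at v)"
    by (rule has_derivative_cong_open[OF open_N0 v, rotated]) (simp add: dsigma)
  from dd_eqI[OF this, of w] have "dd (\<lambda>v. dd \<sigma> v w') v w = N (dd f x Z + \<eta> *\<^sub>R \<xi> x)"
    unfolding D .
  moreover have "N (et x) = qf x *\<^sub>R \<sigma> v"
    using y_eq[OF xU] q_nonzero[OF xU] by (simp add: \<sigma>_def x_def)
  ultimately have "dd (\<lambda>v. dd \<sigma> v w') v w = N (dd f x (X v w'')) + (qf x * \<eta>) *\<^sub>R \<sigma> v"
    by (simp add: linear_add[OF linear_N] linear_scale[OF linear_N] w'')
  then show ?thesis
    by (intro that[of w'']) (simp add: dsigma[OF v] x_def \<eta>_def)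
qed

lemma Delta_nonzero:
  assumes x: "x \<in> S"
  shows "\<Delta> x \<noteq> 0"
proof
  assume D: "\<Delta> x = 0"
  note xU = in_U[OF x]
  let ?M = "\<lambda>c::real^3. c $ 1 *\<^sub>R N (e 2 x) + c $ 2 *\<^sub>R N (e 3 x) + c $ 3 *\<^sub>R N (et x)"
  have lin: "linear ?M"
    by (rule linearI) (simp_all add: algebra_simps)
  have inj: "inj ?M"
  proof (rule linear_injective_0[OF lin, THEN iffD2], intro allI impI)
    fix c assume c: "?M c = 0"
    let ?u = "c $ 1 *\<^sub>R V x + c $ 2 *\<^sub>R W x"
    have "N (et x) = qf x *\<^sub>R y x"
      using y_eq[OF xU] q_nonzero[OF xU] by simp
    then have "N (dd f x ?u) = (- c $ 3 * qf x) *\<^sub>R y x"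
      using c by (simp add: linear_add[OF linear_df[OF xU]] linear_scale[OF linear_df[OF xU]]
          linear_add[OF linear_N] linear_scale[OF linear_N] eq_neg_iff_add_eq_0)
    moreover have "h x ?u (Tf x) = 0"
      by (simp add: metric_bilinear xU x frame_metric)
    ultimately have u: "?u = 0" and c3: "- c $ 3 * qf x = 0"
      using transverse_y[OF xU, of ?u "- c $ 3 * qf x"] by blast+
    have "h x ?u (V x) = 0" "h x ?u (W x) = 0"
      unfolding u by (simp_all add: bilinear_lzero[OF bilinear_metric[OF xU]])
    then have "c $ 1 = 0" "c $ 2 = 0"
      unfolding bilinear_ladd[OF bilinear_metric[OF xU]] bilinear_lmul[OF bilinear_metric[OF xU]]
      by (simp_all add: x frame_metric)
    with c3 q_nonzero[OF xU] show "c = 0"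
      by (simp add: vec_eq_iff forall_3)
  qed
  let ?z = "cross3 (N (e 3 x)) (N (et x))"
  have "\<exists>c. ?z = ?M c"
    by (rule surjD[OF linear_injective_imp_surjective[OF lin inj refl]])
  then obtain c where c: "?z = ?M c" ..
  \<comment> \<open>One factor is expanded in the basis: \<open>?z\<close> is orthogonal to two of
    its vectors by construction and to \<open>N (e 2 x)\<close> by \<open>\<Delta> x = 0\<close>.
    The cross product therefore vanishes, against independence.\<close>
  have "?z \<bullet> ?z = 0"
    by (subst (2) c) (use D in \<open>simp add: inner_add_right dot_cross_self \<Delta>_def inner_commute\<close>)
  then have "collinear {0, N (e 3 x), N (et x)}"
    by (simp add: cross_eq_0)
  then consider "N (e 3 x) = 0" | "N (et x) = 0" | k where "N (et x) = k *\<^sub>R N (e 3 x)"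
    unfolding collinear_lemma by blast
  then obtain c1 c2 where c12: "c1 \<noteq> 0 \<or> c2 \<noteq> 0" "c1 *\<^sub>R N (e 3 x) + c2 *\<^sub>R N (et x) = 0"
  proof cases
    case 1
    then show ?thesis by (intro that[of 1 0]) simp_all
  next
    case 2
    then show ?thesis by (intro that[of 0 1]) simp_all
  next
    case 3
    then show ?thesis by (intro that[of "- k" 1]) simp_all
  qed
  have "?M (vector [0, c1, c2]) = ?M 0"
    using c12(2) by (simp add: vector_3)
  then have "(vector [0, c1, c2] :: real^3) = 0"
    by (rule injD[OF inj])
  then have "c1 = 0" "c2 = 0"
    by (simp_all add: vec_eq_iff forall_3 vector_3)
  then show False
    using c12(1) by simp
qed

end

section \<open>The affine sphere\<close>

text \<open>Frames with the same form \<open>G J G^T\<close> differ by an isometry of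
  \<open>J\<close>. The factor obtained satisfies \<open>R J R^T = J\<close>; with
  \<open>J J = 1\<close> this passes to the transpose, which gives control of the columns of
  \<open>R\<close>.\<close>

lemma orthogonal_frames:
  fixes G G0 J :: "real^'n^'n"
  assumes eq: "G ** J ** transpose G = G0 ** J ** transpose G0" and G0: "det G0 \<noteq> 0" and J: "J ** J = mat 1"
  obtains R where "G = G0 ** R" "transpose R ** J ** R = J"
proof -
  define B where "B = matrix_inv G0"
  have GB: "G0 ** B = mat 1"
    unfolding B_def by (rule matrix_inv_right[OF G0])
  then have BG: "B ** G0 = mat 1"
    by (simp add: matrix_left_right_inverse)
  define R where "R = B ** G"
  have "R ** J ** transpose R = B ** (G ** J ** transpose G) ** transpose B"
    by (simp add: R_def matrix_transpose_mul matrix_mul_assoc)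
  also have "\<dots> = (B ** G0) ** J ** transpose (B ** G0)"
    by (simp only: eq matrix_transpose_mul matrix_mul_assoc)
  also have "\<dots> = J"
    by (simp add: BG transpose_mat)
  finally have "R ** (J ** transpose R ** J) = mat 1"
    using J by (simp add: matrix_mul_assoc)
  then have "(J ** transpose R ** J) ** R = mat 1"
    by (simp add: matrix_left_right_inverse)
  then have "J ** (J ** transpose R ** J ** R) = J"
    by simp
  then have "transpose R ** J ** R = J"
    by (simp add: matrix_mul_assoc J)
  moreover have "G = G0 ** R"
    by (simp add: R_def matrix_mul_assoc GB)
  ultimately show ?thesis
    by (rule that[rotated])
qed

lemma affine_transformation_matrix:
  fixes G :: "real^'n^'n"
  assumes G: "det G \<noteq> 0" and c: "c \<noteq> 0"
  shows "affine_transformation (\<lambda>v. c *\<^sub>R (G *v v))"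
proof -
  have lin: "linear (\<lambda>v. c *\<^sub>R (G *v v))"
    by (rule linear_compose_scale_right) (rule matrix_vector_mul_linear)
  have "inj (\<lambda>v. G *v v)"
    using G by (simp add: inj_matrix_vector_mult invertible_det_nz)
  then have "inj (\<lambda>v. c *\<^sub>R (G *v v))"
    using c by (auto simp: inj_on_def)
  then have "bij (\<lambda>v. c *\<^sub>R (G *v v))"
    using linear_injective_imp_surjective[OF lin _ refl] by (simp add: bij_def)
  then show ?thesis
    unfolding affine_transformation_def by (intro conjI exI[of _ "\<lambda>v. c *\<^sub>R (G *v v)"] exI[of _ 0] lin) auto
qed

lemma triple_product_plane:
  "(a *\<^sub>R u + b *\<^sub>R v) \<bullet> cross3 (a' *\<^sub>R u + b' *\<^sub>R v) (c *\<^sub>R w) = (a * b' - a' * b) * (u \<bullet> cross3 v w) * c"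
  by (simp add: cross3_simps)

context box
begin

definition "q0 = qf (\<theta> (t0, v0))"
text \<open>The factor \<open>k\<close> makes \<open>k \<sigma>\<close> the affine normal of \<open>\<sigma>\<close>: by equality of the volume forms
  \<open>k\<^sup>2 \<bar>\<Delta>\<bar> = q\<^sup>2\<close>, and the sign makes the metric positive definite.\<close>

definition "\<mu> = sqrt \<bar>\<Delta> (\<theta> (t0, v0))\<bar>"
definition "k = q0 / \<mu>"
definition "\<xi>\<sigma> v = k *\<^sub>R \<sigma> v"

lemma box_base: "(t0, v0) \<in> I \<times> N0"
  using t0 v0 by simp

lemma q0_nonzero: "q0 \<noteq> 0"
  unfolding q0_def by (rule q_nonzero[OF theta_in_U[OF box_base]])

lemma mu_pos: "\<mu> > 0"
  using Delta_nonzero[OF theta_in_S[OF box_base]] by (simp add: \<mu>_def)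

lemma k_nonzero: "k \<noteq> 0"
  using q0_nonzero mu_pos by (simp add: k_def)

lemma slice_q: "v \<in> N0 \<Longrightarrow> qf (\<theta> (t0, v)) = q0" and slice_Delta: "v \<in> N0 \<Longrightarrow> \<bar>\<Delta> (\<theta> (t0, v))\<bar> = \<mu>\<^sup>2"
  using slice_constants[OF t0] by (simp_all add: q0_def \<mu>_def)

lemma linear_dsigma: "v \<in> N0 \<Longrightarrow> linear (frechet_derivative \<sigma> (at v))"
  by (rule smooth_on_linear_dd[OF smooth_sigma])

lemma sigma_components:
  assumes v: "v \<in> N0"
  shows "tangential \<sigma> \<xi>\<sigma> v (dd \<sigma> v Z + c *\<^sub>R \<sigma> v) = Z" "transversal \<sigma> \<xi>\<sigma> v (dd \<sigma> v Z + c *\<^sub>R \<sigma> v) = c / k"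
proof -
  have *: "Z' = Z \<and> c' = c / k" if "dd \<sigma> v Z + c *\<^sub>R \<sigma> v = dd \<sigma> v Z' + c' *\<^sub>R \<xi>\<sigma> v" for Z' c'
  proof -
    have "dd \<sigma> v (Z' - Z) = (c - c' * k) *\<^sub>R \<sigma> v"
      unfolding linear_diff[OF linear_dsigma[OF v]]
      using that by (simp add: \<xi>\<sigma>_def algebra_simps)
    from sigma_transverse[OF v this] show ?thesis
      using k_nonzero by (simp add: field_simps)
  qed
  have eq: "dd \<sigma> v Z + c *\<^sub>R \<sigma> v = dd \<sigma> v Z + (c / k) *\<^sub>R \<xi>\<sigma> v"
    using k_nonzero by (simp add: \<xi>\<sigma>_def)
  show "tangential \<sigma> \<xi>\<sigma> v (dd \<sigma> v Z + c *\<^sub>R \<sigma> v) = Z"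
    unfolding tangential_def by (rule the_equality) (use eq * in blast)+
  show "transversal \<sigma> \<xi>\<sigma> v (dd \<sigma> v Z + c *\<^sub>R \<sigma> v) = c / k"
    unfolding transversal_def by (rule the_equality) (use eq * in blast)+
qed

text \<open>The second derivative has \<open>\<sigma>\<close>-component \<open>q h\<close>; dividing
  by \<open>k = q / \<mu>\<close> yields \<open>\<mu> h\<close>, positive whatever the sign of
  \<open>q\<close>.\<close>

lemma sigma_metric:
  assumes v: "v \<in> N0"
  shows "affine_metric \<sigma> \<xi>\<sigma> v w w' = \<mu> * h (\<theta> (t0, v)) (X v w) (X v w')"
proof -
  obtain w'' where "dd (\<lambda>v. dd \<sigma> v w') v w =
    dd \<sigma> v w'' + (qf (\<theta> (t0, v)) * h (\<theta> (t0, v)) (X v w) (X v w')) *\<^sub>R \<sigma> v"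
    using sigma_second_derivative[OF v] .
  then show ?thesis
    unfolding affine_metric_def using q0_nonzero mu_pos
    by (simp add: sigma_components[OF v] slice_q[OF v] k_def)
qed

lemma sigma_shape:
  assumes v: "v \<in> N0"
  shows "dd \<xi>\<sigma> v w = dd \<sigma> v (k *\<^sub>R w)" "shape_operator \<sigma> \<xi>\<sigma> v w = - k *\<^sub>R w"
proof -
  have "(\<xi>\<sigma> has_derivative (\<lambda>w. k *\<^sub>R dd \<sigma> v w)) (at v)"
    unfolding \<xi>\<sigma>_def[abs_def]
    by (rule has_derivative_scaleR_right[OF smooth_on_has_dd[OF smooth_sigma v]])
  then show d: "dd \<xi>\<sigma> v w = dd \<sigma> v (k *\<^sub>R w)"
    by (simp add: dd_eqI linear_scale[OF linear_dsigma[OF v]])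
  show "shape_operator \<sigma> \<xi>\<sigma> v w = - k *\<^sub>R w"
    using sigma_components(1)[OF v, of "k *\<^sub>R w" 0] by (simp add: shape_operator_def d)
qed

lemma slice_expansion:
  assumes v: "v \<in> N0"
  shows "X v w = h (\<theta> (t0, v)) (X v w) (V (\<theta> (t0, v))) *\<^sub>R V (\<theta> (t0, v)) +
    h (\<theta> (t0, v)) (X v w) (W (\<theta> (t0, v))) *\<^sub>R W (\<theta> (t0, v))"
  using lorentz_expansion[OF theta_in_U[OF box_slice[OF v]]
      canonical_frameD(1)[OF theta_in_U[OF box_slice[OF v]] frame[OF theta_in_S[OF box_slice[OF v]]]], of "X v w"]
  by (simp add: X_slice[OF v])

lemma slice_metric:
  assumes v: "v \<in> N0"
  shows "h (\<theta> (t0, v)) (X v w) (X v w') =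
    h (\<theta> (t0, v)) (X v w) (V (\<theta> (t0, v))) * h (\<theta> (t0, v)) (X v w') (V (\<theta> (t0, v))) +
    h (\<theta> (t0, v)) (X v w) (W (\<theta> (t0, v))) * h (\<theta> (t0, v)) (X v w') (W (\<theta> (t0, v)))"
proof -
  note xU = theta_in_U[OF box_slice[OF v]]
  have "h (\<theta> (t0, v)) (X v w) (X v w') = h (\<theta> (t0, v)) (X v w)
    (h (\<theta> (t0, v)) (X v w') (V (\<theta> (t0, v))) *\<^sub>R V (\<theta> (t0, v)) +
    h (\<theta> (t0, v)) (X v w') (W (\<theta> (t0, v))) *\<^sub>R W (\<theta> (t0, v)))"
    by (rule arg_cong[OF slice_expansion[OF v]])
  then show ?thesis
    by (simp add: metric_bilinear xU)
qed

lemma sigma_positive_definite: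
  assumes v: "v \<in> N0"
  shows "positive_definite (affine_metric \<sigma> \<xi>\<sigma> v)"
  unfolding positive_definite_def
proof (intro allI impI)
  fix w :: "real^2" assume w: "w \<noteq> 0"
  let ?A = "h (\<theta> (t0, v)) (X v w) (V (\<theta> (t0, v)))" and ?B = "h (\<theta> (t0, v)) (X v w) (W (\<theta> (t0, v)))"
  have "?A \<noteq> 0 \<or> ?B \<noteq> 0"
  proof (rule ccontr)
    assume "\<not> ?thesis"
    then have "X v w = 0"
      using slice_expansion[OF v, of w] by simp
    then show False
      using X_zero[OF v] w by blast
  qed
  then have "?A * ?A + ?B * ?B > 0"
    using sum_squares_gt_zero_iff by blast
  then show "affine_metric \<sigma> \<xi>\<sigma> v w w > 0"
    unfolding sigma_metric[OF v] slice_metric[OF v] using mu_pos by simp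
qed

lemma sigma_affine_sphere: "affine_sphere N0 \<sigma> \<xi>\<sigma> (- k)"
  unfolding affine_sphere_def affine_normal_def
proof (intro conjI ballI allI)
  show "open N0" by (rule open_N0)
  show "smooth_on N0 \<sigma>" by (rule smooth_sigma)
  show "smooth_on N0 \<xi>\<sigma>"
    unfolding \<xi>\<sigma>_def[abs_def] by (rule smooth_on_linear[OF _ open_N0 smooth_sigma]) simp
next
  fix v w assume "v \<in> N0"
  then show "shape_operator \<sigma> \<xi>\<sigma> v w = - k *\<^sub>R w" "dd \<xi>\<sigma> v w \<in> range (frechet_derivative \<sigma> (at v))"
    by (simp_all add: sigma_shape)
next
  fix v assume v: "v \<in> N0"
  show "inj (frechet_derivative \<sigma> (at v))"
    by (rule linear_injective_0[OF linear_dsigma[OF v], THEN iffD2]) (use sigma_transverse(1)[OF v, of _ 0] in simp)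
  show "\<xi>\<sigma> v \<notin> range (frechet_derivative \<sigma> (at v))"
  proof
    assume "\<xi>\<sigma> v \<in> range (frechet_derivative \<sigma> (at v))"
    then obtain w where "dd \<sigma> v w = k *\<^sub>R \<sigma> v"
      unfolding \<xi>\<sigma>_def by (metis rangeE)
    then show False
      using sigma_transverse(2)[OF v] k_nonzero by blast
  qed
  define x where "x = \<theta> (t0, v)"
  define E where "E i = X v (axis i 1)" for i :: 2
  define A where "A i = h x (E i) (V x)" for i
  define B where "B i = h x (E i) (W x)" for i
  \<comment> \<open>The determinant of the coordinate fields relative to \<open>V, W\<close>. The
    metric has determinant \<open>(\<mu> d)^2\<close> and the volume is
    \<open>d \<Delta> / \<mu>\<close>; they match because
    \<open>|\<Delta>| = \<mu>^2\<close>.\<close>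
  define d where "d = A 1 * B 2 - A 2 * B 1"
  have xU: "x \<in> U" and xS: "x \<in> S"
    unfolding x_def using theta_in_U theta_in_S box_slice[OF v] by blast+
  have E: "E i = A i *\<^sub>R V x + B i *\<^sub>R W x" for i
    unfolding A_def B_def E_def x_def by (rule slice_expansion[OF v])
  note Xlin = linear_diff[OF linear_X[OF v]] linear_scale[OF linear_X[OF v]]
  have d: "d \<noteq> 0"
  proof
    assume d0: "d = 0"
    let ?w = "B 2 *\<^sub>R axis 1 1 - B 1 *\<^sub>R axis 2 1 :: real^2" and ?w' = "A 2 *\<^sub>R axis 1 1 - A 1 *\<^sub>R axis 2 1 :: real^2"
    have "X v ?w = d *\<^sub>R V x"
      unfolding Xlin E_def[symmetric] E by (simp add: d_def algebra_simps)
    then have "?w = 0"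
      using d0 by (intro X_zero[OF v]) simp
    then have B0: "B 1 = 0" "B 2 = 0"
      by (simp_all add: vec_eq_iff forall_2 axis_def)
    have "X v ?w' = (- d) *\<^sub>R W x"
      unfolding Xlin E_def[symmetric] E by (simp add: d_def algebra_simps)
    then have "?w' = 0"
      using d0 by (intro X_zero[OF v]) simp
    then have "A 1 = 0"
      by (simp add: vec_eq_iff forall_2 axis_def)
    then have "X v (axis 1 1) = 0"
      using E[of 1] B0 by (simp add: E_def)
    then have "axis 1 1 = (0 :: real^2)"
      by (rule X_zero[OF v])
    then show False
      by (simp add: axis_eq_0_iff)
  qed
  have g: "affine_metric \<sigma> \<xi>\<sigma> v (axis i 1) (axis j 1) = \<mu> * (A i * A j + B i * B j)" for i j
    unfolding sigma_metric[OF v] slice_metric[OF v] A_def B_def E_def x_def ..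
  have D: "det ((\<chi> i j. affine_metric \<sigma> \<xi>\<sigma> v (axis i 1) (axis j 1)) :: real^2^2) = (\<mu> * d)\<^sup>2"
    unfolding g by (simp add: det_2 d_def power2_eq_square algebra_simps)
  then show "det ((\<chi> i j. affine_metric \<sigma> \<xi>\<sigma> v (axis i 1) (axis j 1)) :: real^2^2) \<noteq> 0"
    using d mu_pos by simp
  have s: "dd \<sigma> v (axis i 1) = A i *\<^sub>R N (e 2 x) + B i *\<^sub>R N (e 3 x)" for i
    unfolding dsigma[OF v] x_def[symmetric] E_def[symmetric] E
    by (simp add: linear_add[OF linear_df[OF xU]] linear_scale[OF linear_df[OF xU]]
        linear_add[OF linear_N] linear_scale[OF linear_N])
  have sv: "\<xi>\<sigma> v = (1 / \<mu>) *\<^sub>R N (et x)"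
    using q0_nonzero slice_q[OF v] y_eq[OF xU] by (simp add: \<xi>\<sigma>_def \<sigma>_def x_def k_def)
  have "det (vector (map (\<lambda>k. dd \<sigma> v (axis (of_nat k) 1)) [1..<Suc CARD(2)] @ [\<xi>\<sigma> v]) :: real^3^3) =
    dd \<sigma> v (axis 1 1) \<bullet> cross3 (dd \<sigma> v (axis 2 1)) (\<xi>\<sigma> v)"
    unfolding dot_cross_det by (simp add: numeral_2_eq_2)
  also have "\<dots> = d * \<Delta> x / \<mu>"
    unfolding s sv \<Delta>_def d_def triple_product_plane by simp
  finally show "\<bar>det (vector (map (\<lambda>k. dd \<sigma> v (axis (of_nat k) 1)) [1..<Suc CARD(2)] @ [\<xi>\<sigma> v]) :: real^3^3)\<bar> =
    sqrt \<bar>det ((\<chi> i j. affine_metric \<sigma> \<xi>\<sigma> v (axis i 1) (axis j 1)) :: real^2^2)\<bar>"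
    unfolding D using mu_pos slice_Delta[OF v]
    by (simp add: x_def abs_mult real_sqrt_mult power_mult_distrib power2_eq_square)
qed

text \<open>The shape operator of \<open>\<sigma>\<close> is \<open>- k\<close> times the identity,
  and \<open>k\<close> has the sign of \<open>q0\<close>; hence the reversal.\<close>

lemma sigma_elliptic: "q0 < 0 \<Longrightarrow> elliptic_affine_sphere N0 \<sigma>"
  and sigma_hyperbolic: "q0 > 0 \<Longrightarrow> hyperbolic_affine_sphere N0 \<sigma>"
  unfolding elliptic_affine_sphere_def hyperbolic_affine_sphere_def k_def
  using sigma_affine_sphere sigma_positive_definite mu_pos
  by (intro exI[of _ \<xi>\<sigma>] exI[of _ "- k"]; simp add: k_def divide_neg_pos)+

text \<open>The columns are the projected \<open>V\<close>, \<open>W\<close> and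
  \<open>\<eta> / sqrt |q|\<close>; this scaling replaces the weight \<open>- 1 / q\<close> in
  \<open>quadric\<close> by a sign, so that \<open>signature\<close> is its own inverse.\<close>

definition "frame_matrix v = transpose (vector [N (e 2 (\<theta> (t0, v))), N (e 3 (\<theta> (t0, v))),
  (1 / sqrt \<bar>q0\<bar>) *\<^sub>R N (et (\<theta> (t0, v)))] :: real^3^3)"

definition "signature = ((\<chi> i j. if i = j then if i = 3 then - sgn q0 else 1 else 0) :: real^3^3)"

lemma det_frame_matrix: "det (frame_matrix v0) \<noteq> 0"
proof -
  have "det (frame_matrix v0) = (1 / sqrt \<bar>q0\<bar>) * \<Delta> (\<theta> (t0, v0))"
    unfolding frame_matrix_def det_transpose dot_cross_det[symmetric] \<Delta>_def
    by (simp add: cross_mult_right)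
  then show ?thesis
    using q0_nonzero Delta_nonzero[OF theta_in_S[OF box_base]] by simp
qed

lemma frame_matrix_quadric:
  assumes v: "v \<in> N0"
  shows "frame_matrix v ** signature ** transpose (frame_matrix v) =
    (\<chi> i j. quadric (\<theta> (t0, v)) (axis i 1) (axis j 1))"
proof -
  have "sgn q0 / \<bar>q0\<bar> = 1 / q0"
    using q0_nonzero by (simp add: sgn_if)
  then have sg: "sgn q0 * a / \<bar>q0\<bar> = a / q0" for a
    by (metis times_divide_eq_left mult.commute mult_1)
  show ?thesis
    unfolding vec_eq_iff
    by (simp add: frame_matrix_def signature_def quadric_def matrix_matrix_mult_def transpose_def sum_3 forall_3
        vector_3 inner_axis slice_q[OF v] algebra_simps) (simp add: sg)
qed

text \<open>Constancy of \<open>quadric\<close> on the slice makes the frame at \<open>v\<close> the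
  frame at \<open>v0\<close> times an isometry \<open>R\<close> of \<open>signature\<close>. The
  third column of \<open>R\<close>, on which that form takes the value \<open>- sgn q0\<close>,
  gives the coordinates of \<open>\<sigma>\<close>.\<close>

lemma sigma_quadric:
  assumes s0: "\<And>x. x \<in> S \<Longrightarrow> s x = 0" and v: "v \<in> N0"
  obtains r :: "real^3" where "\<sigma> v = (sqrt \<bar>q0\<bar> / q0) *\<^sub>R (frame_matrix v0 *v r)"
    "(r $ 1)\<^sup>2 + (r $ 2)\<^sup>2 - sgn q0 * (r $ 3)\<^sup>2 = - sgn q0"
proof -
  have "quadric (\<theta> (t0, v)) c d = quadric (\<theta> (t0, v0)) c d" for c d
    by (rule slice_constant[OF t0 v]) (metis quadric_slice s0)
  then have "frame_matrix v ** signature ** transpose (frame_matrix v) =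
      frame_matrix v0 ** signature ** transpose (frame_matrix v0)"
    by (simp add: frame_matrix_quadric v v0)
  moreover have "signature ** signature = mat 1"
    using q0_nonzero
    by (simp add: signature_def matrix_matrix_mult_def mat_def vec_eq_iff sum_3 forall_3 sgn_if)
  ultimately obtain R where R: "frame_matrix v = frame_matrix v0 ** R" "transpose R ** signature ** R = signature"
    using orthogonal_frames det_frame_matrix by metis
  define r where "r = R *v axis 3 1"
  have r: "r $ i = R $ i $ 3" for i
    by (simp add: r_def matrix_vector_mult_basis column_def)
  have "frame_matrix v *v axis 3 1 = (1 / sqrt \<bar>q0\<bar>) *\<^sub>R N (et (\<theta> (t0, v)))"
    by (simp add: frame_matrix_def matrix_vector_mult_basis column_def transpose_def vec_eq_iff vector_3)
  moreover have "frame_matrix v *v axis 3 1 = frame_matrix v0 *v r"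
    by (simp add: r_def R(1) matrix_vector_mul_assoc)
  ultimately have "frame_matrix v0 *v r = (1 / sqrt \<bar>q0\<bar>) *\<^sub>R N (et (\<theta> (t0, v)))"
    by simp
  moreover have "\<sigma> v = (1 / q0) *\<^sub>R N (et (\<theta> (t0, v)))"
    using y_eq[OF theta_in_U[OF box_slice[OF v]]] by (simp add: \<sigma>_def slice_q[OF v])
  ultimately have "\<sigma> v = (sqrt \<bar>q0\<bar> / q0) *\<^sub>R (frame_matrix v0 *v r)"
    using q0_nonzero by simp
  moreover have "(transpose R ** signature ** R) $ 3 $ 3 = signature $ 3 $ 3"
    by (simp add: R(2))
  then have "(r $ 1)\<^sup>2 + (r $ 2)\<^sup>2 - sgn q0 * (r $ 3)\<^sup>2 = - sgn q0"
    by (simp add: r signature_def matrix_matrix_mult_def transpose_def sum_3 power2_eq_square algebra_simps)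
  ultimately show ?thesis
    by (rule that)
qed

lemma sigma_ellipsoid:
  assumes s0: "\<And>x. x \<in> S \<Longrightarrow> s x = 0" and q: "q0 < 0"
  shows "\<exists>Q. is_ellipsoid Q \<and> \<sigma> ` N0 \<subseteq> Q"
proof -
  let ?A = "\<lambda>r. (sqrt \<bar>q0\<bar> / q0) *\<^sub>R (frame_matrix v0 *v r)"
  have "affine_transformation ?A"
    by (rule affine_transformation_matrix[OF det_frame_matrix]) (use q0_nonzero in simp)
  moreover have "\<sigma> ` N0 \<subseteq> ?A ` {x. (x $ 1)\<^sup>2 + (x $ 2)\<^sup>2 + (x $ 3)\<^sup>2 = 1}"
  proof
    fix z assume "z \<in> \<sigma> ` N0"
    then obtain v where v: "v \<in> N0" and z: "z = \<sigma> v" by blast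
    obtain r where "\<sigma> v = ?A r" "(r $ 1)\<^sup>2 + (r $ 2)\<^sup>2 - sgn q0 * (r $ 3)\<^sup>2 = - sgn q0"
      using sigma_quadric[OF s0 v] .
    then show "z \<in> ?A ` {x. (x $ 1)\<^sup>2 + (x $ 2)\<^sup>2 + (x $ 3)\<^sup>2 = 1}"
      unfolding z using q by (intro image_eqI[of _ ?A r]) simp_all
  qed
  ultimately show ?thesis
    unfolding is_ellipsoid_def by blast
qed

lemma sigma_hyperboloid:
  assumes s0: "\<And>x. x \<in> S \<Longrightarrow> s x = 0" and q: "q0 > 0"
  shows "\<exists>Q. is_two_sheeted_hyperboloid Q \<and> \<sigma> ` N0 \<subseteq> Q"
proof -
  let ?A = "\<lambda>r. (sqrt \<bar>q0\<bar> / q0) *\<^sub>R (frame_matrix v0 *v r)"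
  have "affine_transformation ?A"
    by (rule affine_transformation_matrix[OF det_frame_matrix]) (use q0_nonzero in simp)
  moreover have "\<sigma> ` N0 \<subseteq> ?A ` {x. (x $ 1)\<^sup>2 + (x $ 2)\<^sup>2 - (x $ 3)\<^sup>2 = - 1}"
  proof
    fix z assume "z \<in> \<sigma> ` N0"
    then obtain v where v: "v \<in> N0" and z: "z = \<sigma> v" by blast
    obtain r where "\<sigma> v = ?A r" "(r $ 1)\<^sup>2 + (r $ 2)\<^sup>2 - sgn q0 * (r $ 3)\<^sup>2 = - sgn q0"
      using sigma_quadric[OF s0 v] .
    then show "z \<in> ?A ` {x. (x $ 1)\<^sup>2 + (x $ 2)\<^sup>2 - (x $ 3)\<^sup>2 = - 1}"
      unfolding z using q by (intro image_eqI[of _ ?A r]) simp_all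
  qed
  ultimately show ?thesis
    unfolding is_two_sheeted_hyperboloid_def by blast
qed

end

section \<open>Gluing\<close>

lemma local_param_reparametrize:
  fixes \<theta> :: "'d::euclidean_space \<Rightarrow> 'e::euclidean_space"
  assumes c: "local_param X (U, \<psi>)" and B: "open B" "smooth_on B \<theta>" "\<theta> ` B \<subseteq> U"
    and im: "open (\<theta> ` B)" "smooth_on (\<theta> ` B) \<Theta>" and inv: "\<And>z. z \<in> B \<Longrightarrow> \<Theta> (\<theta> z) = z"
  shows "local_param X (B, \<psi> \<circ> \<theta>)"
proof -
  note p = local_paramD[OF c]
  have op: "openin X (\<psi> ` \<theta> ` B)"
    by (rule p(4)[OF im(1) B(3)])
  have "homeomorphic_maps (top_of_set B) (top_of_set (\<theta> ` B)) \<theta> \<Theta>"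
    using smooth_on_continuous[OF B(2)] smooth_on_continuous[OF im(2)] inv
    by (auto simp: homeomorphic_maps_def image_subset_iff)
  then have 1: "homeomorphic_map (top_of_set B) (top_of_set (\<theta> ` B)) \<theta>"
    by (rule homeomorphic_maps_imp_map)
  have "homeomorphic_map (top_of_set U) (subtopology X (\<psi> ` U)) \<psi>"
    using c by (simp add: local_param_def)
  then have "homeomorphic_map (subtopology (top_of_set U) (\<theta> ` B)) (subtopology (subtopology X (\<psi> ` U)) (\<psi> ` \<theta> ` B)) \<psi>"
    by (rule homeomorphic_map_subtopologies) (use B(3) openin_subset[OF op] in auto)
  moreover have "U \<inter> \<theta> ` B = \<theta> ` B" "\<psi> ` U \<inter> \<psi> ` \<theta> ` B = \<psi> ` \<theta> ` B"
    using B(3) by blast+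
  ultimately have "homeomorphic_map (top_of_set (\<theta> ` B)) (subtopology X (\<psi> ` \<theta> ` B)) \<psi>"
    by (simp add: subtopology_subtopology)
  from homeomorphic_map_compose[OF 1 this] show ?thesis
    using B(1) op by (simp add: local_param_def image_comp)
qed

text \<open>In one direction the transition map is composed with \<open>\<theta>\<close>, in the
  other with its inverse \<open>\<Theta>\<close>, whose smoothness on the open image enters
  here.\<close>

lemma compatible_reparametrize:
  fixes \<theta> :: "'d::euclidean_space \<Rightarrow> 'e::euclidean_space"
  assumes c: "local_param X (U, \<psi>)" and d: "local_param X d" and comp: "compatible (U, \<psi>) d"
    and B: "open B" "smooth_on B \<theta>" "\<theta> ` B \<subseteq> U"
    and im: "open (\<theta> ` B)" "smooth_on (\<theta> ` B) \<Theta>" and inv: "\<And>z. z \<in> B \<Longrightarrow> \<Theta> (\<theta> z) = z"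
  shows "compatible (B, \<psi> \<circ> \<theta>) d"
proof -
  have b: "local_param X (B, \<psi> \<circ> \<theta>)"
    by (rule local_param_reparametrize[OF c B im inv])
  have t: "\<theta> z \<in> U" if "z \<in> B" for z
    using that B(3) by blast
  have inj: "inj_on (\<psi> \<circ> \<theta>) B" "inj_on \<psi> U"
    using local_paramD(3)[OF b] local_paramD(3)[OF c] .
  have sm: "smooth_on (transition_dom (U, \<psi>) d) (transition (U, \<psi>) d)"
    "smooth_on (transition_dom d (U, \<psi>)) (transition d (U, \<psi>))"
    using comp by (simp_all add: compatible_def)
  have "smooth_on (transition_dom (B, \<psi> \<circ> \<theta>) d) (\<lambda>z. transition (U, \<psi>) d (\<theta> z))"
    by (rule smooth_on_compose[OF open_transition_dom[OF b d] open_transition_dom[OF c d] _ sm(1)])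
      (use t in \<open>auto intro: smooth_on_subset[OF B(2)]\<close>)
  then have 1: "smooth_on (transition_dom (B, \<psi> \<circ> \<theta>) d) (transition (B, \<psi> \<circ> \<theta>) d)"
    by (simp add: o_def)
  have D: "transition d (U, \<psi>) x \<in> \<theta> ` B \<and> transition d (B, \<psi> \<circ> \<theta>) x = \<Theta> (transition d (U, \<psi>) x)"
    if "x \<in> transition_dom d (B, \<psi> \<circ> \<theta>)" for x
  proof -
    have "snd d x \<in> (\<psi> \<circ> \<theta>) ` B"
      using that by simp
    then obtain z where z: "z \<in> B" "snd d x = \<psi> (\<theta> z)"
      unfolding o_def by blast
    have "inv_into B (\<psi> \<circ> \<theta>) ((\<psi> \<circ> \<theta>) z) = z" "inv_into U \<psi> (\<psi> (\<theta> z)) = \<theta> z"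
      by (rule inv_into_f_f[OF inj(1) z(1)], rule inv_into_f_f[OF inj(2) t[OF z(1)]])
    then show ?thesis
      using z inv by simp
  qed
  have sub: "transition_dom d (B, \<psi> \<circ> \<theta>) \<subseteq> transition_dom d (U, \<psi>)"
    using t by auto
  have "smooth_on (transition_dom d (B, \<psi> \<circ> \<theta>)) (\<lambda>x. \<Theta> (transition d (U, \<psi>) x))"
    by (rule smooth_on_compose[OF open_transition_dom[OF d b] im(1) _ im(2) smooth_on_subset[OF sm(2) sub]])
      (use D in blast)
  then have "smooth_on (transition_dom d (B, \<psi> \<circ> \<theta>)) (transition d (B, \<psi> \<circ> \<theta>))"
    by (rule smooth_on_cong[OF open_transition_dom[OF d b], rotated]) (metis D)
  with 1 show ?thesis
    by (simp add: compatible_def)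
qed

context symmetric_hypersphere
begin

text \<open>\<open>L\<close> inverts the basis \<open>\<nu>, V, W, \<eta>\<close> at one reference
  point, so that \<open>\<nu>\<close> becomes the first axis and the kernel of
  \<open>\<lambda>\<close> a coordinate hyperplane. By \<open>splitting_constant\<close> the same
  \<open>L\<close>, centre and \<open>n0\<close> fit every chart, so one affine transformation works
  for the whole manifold.\<close>

lemma adapted_charts:
  assumes q0: "\<And>c x. c \<in> \<A> \<Longrightarrow> x \<in> fst c \<Longrightarrow> q c x \<noteq> 0" and c0: "c0 \<in> \<A>" "x0 \<in> fst c0"
  shows "\<exists>L C n0. \<forall>c\<in>\<A>. adapted_chart (fst c) (\<phi> \<circ> snd c) (\<xi> \<circ> snd c) H L C n0"
proof -
  interpret A: symmetric_chart "fst c0" "\<phi> \<circ> snd c0" "\<xi> \<circ> snd c0" H by (rule symmetric_chart[OF c0(1)])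
  note x = c0(2)
  obtain V W s where "canonical_frame (\<phi> \<circ> snd c0) (\<xi> \<circ> snd c0) x0 (A.Tf x0) V W (A.af x0) s"
    using A.canonical_frame_exists[OF x] by blast
  note fr = A.lorentz_frameD[OF x A.canonical_frameD(1)[OF x this]]
  have qx: "A.qf x0 \<noteq> 0"
    using q0[OF c0] by (simp add: chart_defs)
  let ?f = "\<phi> \<circ> snd c0"
  define M where "M z = z $ 1 *\<^sub>R A.nu x0 + dd ?f x0 (z $ 2 *\<^sub>R V + z $ 3 *\<^sub>R W) + z $ 4 *\<^sub>R A.et x0" for z :: "real^4"
  have linM: "linear M"
    unfolding M_def[abs_def]
    by (rule linearI) (simp_all add: linear_add[OF A.linear_df[OF x]] linear_scale[OF A.linear_df[OF x]] algebra_simps)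
  have lamM: "A.lamf x0 (M z) = z $ 1 * A.qf x0" for z
    unfolding M_def linear_add[OF A.linear_lamf[OF x]] linear_scale[OF A.linear_lamf[OF x]]
      A.lamf_nu[OF x] A.lamf_et[OF x] A.lamf_tangent[OF x]
    by (simp add: A.metric_bilinear x fr)
  have injM: "inj M"
  proof (rule linear_injective_0[OF linM, THEN iffD2], intro allI impI)
    fix z assume z: "M z = 0"
    have z1: "z $ 1 = 0"
      using lamM[of z] qx unfolding z linear_0[OF A.linear_lamf[OF x]] by simp
    let ?u = "z $ 2 *\<^sub>R V + z $ 3 *\<^sub>R W"
    have "dd ?f x0 (?u + (z $ 4 * (A.nf x0 - A.af x0)) *\<^sub>R A.Tf x0) + z $ 4 *\<^sub>R (\<xi> \<circ> snd c0) x0 =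
        dd ?f x0 0 + 0 *\<^sub>R (\<xi> \<circ> snd c0) x0"
      using z unfolding M_def z1 A.et_def A.tt_def linear_add[OF A.linear_df[OF x]] linear_scale[OF A.linear_df[OF x]]
        linear_0[OF A.linear_df[OF x]]
      by (simp add: algebra_simps)
    from A.frame_unique[OF x this] have z4: "z $ 4 = 0" and u: "?u = 0"
      by simp_all
    have "affine_metric ?f (\<xi> \<circ> snd c0) x0 ?u V = 0" "affine_metric ?f (\<xi> \<circ> snd c0) x0 ?u W = 0"
      unfolding u by (simp_all add: bilinear_lzero[OF A.bilinear_metric[OF x]])
    then have "z $ 2 = 0" "z $ 3 = 0"
      unfolding bilinear_ladd[OF A.bilinear_metric[OF x]] bilinear_lmul[OF A.bilinear_metric[OF x]]
      by (simp_all add: fr)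
    with z1 z4 show "z = 0"
      by (simp add: vec_eq_iff forall_4)
  qed
  obtain L where L: "linear L" "\<And>z. L (M z) = z" "\<And>w. M (L w) = w"
    using linear_injective_isomorphism[OF linM injM] by blast
  have injL: "inj L"
    by (rule inj_on_inverseI[where g = M]) (rule L(3))
  have "M (axis 1 1) = A.nu x0"
    by (simp add: M_def axis_def linear_0[OF A.linear_df[OF x]])
  then have Ln: "L (n c0 x0) = axis 1 1"
    using L(2)[of "axis 1 1"] by (simp add: chart_defs)
  have proj0: "proj c0 x0 w = (L w $ 1) *\<^sub>R n c0 x0" for w
    using lamM[of "L w"] qx unfolding L(3) by (simp add: proj_def chart_defs)
  show ?thesis
  proof (intro exI ballI)
    fix c assume c: "c \<in> \<A>"
    interpret B: symmetric_chart "fst c" "\<phi> \<circ> snd c" "\<xi> \<circ> snd c" H by (rule symmetric_chart[OF c])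
    show "adapted_chart (fst c) (\<phi> \<circ> snd c) (\<xi> \<circ> snd c) H L (center c0 x0) (n c0 x0)"
    proof (intro adapted_chart.intro[OF symmetric_chart[OF c]] adapted_chart_axioms.intro)
      fix y assume y: "y \<in> fst c"
      have sp: "proj c y = proj c0 x0" "center c y = center c0 x0"
        using splitting_constant[OF q0 c y c0] by simp_all
      show "B.qf y \<noteq> 0"
        using q0[OF c y] by (simp add: chart_defs)
      show "(B.lamf y w / B.qf y) *\<^sub>R B.nu y = (L w $ 1) *\<^sub>R n c0 x0" for w
        using fun_cong[OF sp(1), of w] unfolding proj0 by (simp add: proj_def chart_defs)
      show "(\<phi> \<circ> snd c) y = center c0 x0 + (1 / B.qf y) *\<^sub>R B.et y + (B.lamf y ((\<phi> \<circ> snd c) y) / B.qf y) *\<^sub>R B.nu y"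
        unfolding sp(2)[symmetric] by (simp add: center_def chart_defs)
    qed (fact L(1) injL Ln)+
  qed
qed

lemma q_sign:
  assumes c: "c \<in> \<A>" "x \<in> fst c" and d: "d \<in> \<A>" "y \<in> fst d"
  shows "sgn (q c x) = sgn (q d y)"
proof -
  have "a c x > 0" if "c \<in> \<A>" "x \<in> fst c" for c x
    unfolding a_def by (rule symmetric_chart.af_pos[OF symmetric_chart[OF that(1)] that(2)])
  then have "sgn (1 / sqrt (a c x)) = 1" "sgn (1 / sqrt (a d y)) = 1"
    using c d by simp_all
  then show ?thesis
    using arg_cong[OF q_ratio_constant[OF c d], of sgn] by (simp add: sgn_mult)
qed

text \<open>The predicate \<open>P\<close> stays abstract, so that the elliptic and the hyperbolic
  case share one gluing argument. Which case occurs is decided by the sign of \<open>q\<close>, the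
  same at all points by \<open>q_sign\<close>.\<close>

lemma product:
  assumes c0: "c0 \<in> \<A>" "x0 \<in> fst c0" and q0: "q c0 x0 \<noteq> 0"
    and ell: "\<And>(N :: (real^2) set) \<sigma>. q c0 x0 < 0 \<Longrightarrow> elliptic_affine_sphere N \<sigma> \<Longrightarrow>
      (pointwise_SO2_symmetry \<A> \<phi> \<xi> \<longrightarrow> (\<exists>Q. is_ellipsoid Q \<and> \<sigma> ` N \<subseteq> Q)) \<Longrightarrow> P N \<sigma>"
    and hyp: "\<And>(N :: (real^2) set) \<sigma>. q c0 x0 > 0 \<Longrightarrow> hyperbolic_affine_sphere N \<sigma> \<Longrightarrow>
      (pointwise_SO2_symmetry \<A> \<phi> \<xi> \<longrightarrow> (\<exists>Q. is_two_sheeted_hyperboloid Q \<and> \<sigma> ` N \<subseteq> Q)) \<Longrightarrow> P N \<sigma>"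
  shows "\<exists>A. affine_transformation A \<and> locally_curve_times_surface X \<A> (A \<circ> \<phi>) P"
proof -
  have q: "q c x \<noteq> 0" if "c \<in> \<A>" "x \<in> fst c" for c x
    using q_sign[OF that c0] q0 by (metis sgn_zero_iff)
  have "\<exists>L C n0. \<forall>c\<in>\<A>. adapted_chart (fst c) (\<phi> \<circ> snd c) (\<xi> \<circ> snd c) H L C n0"
    by (rule adapted_charts[OF _ c0]) (rule q)
  then obtain L C n0 where L: "\<And>c. c \<in> \<A> \<Longrightarrow> adapted_chart (fst c) (\<phi> \<circ> snd c) (\<xi> \<circ> snd c) H L C n0"
    by blast
  interpret A0: adapted_chart "fst c0" "\<phi> \<circ> snd c0" "\<xi> \<circ> snd c0" H L C n0 by (rule L[OF c0(1)])
  define A where "A w = L (w - C)" for w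
  have "affine_transformation A"
  proof -
    have "A = (\<lambda>w. L w + - L C)"
      by (simp add: A_def fun_eq_iff linear_diff[OF A0.linear_L])
    moreover have "bij A"
    proof -
      have "bij L"
        using A0.inj_L linear_injective_imp_surjective[OF A0.linear_L A0.inj_L refl] by (simp add: bij_def)
      moreover have "bij (\<lambda>w. w - C)"
        by (rule o_bij[of "\<lambda>w. w + C"]) auto
      ultimately have "bij (L \<circ> (\<lambda>w. w - C))"
        by (rule bij_comp[rotated])
      then show ?thesis
        by (simp add: A_def[abs_def] o_def)
    qed
    ultimately show ?thesis
      unfolding affine_transformation_def using A0.linear_L by blast
  qed
  moreover have "locally_curve_times_surface X \<A> (A \<circ> \<phi>) P"
    unfolding locally_curve_times_surface_def
  proof
    fix p assume "p \<in> topspace X"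
    then obtain U \<psi> x where c: "(U, \<psi>) \<in> \<A>" and x: "x \<in> U" and p: "p = \<psi> x"
      unfolding covering by blast
    interpret B: adapted_chart U "\<phi> \<circ> \<psi>" "\<xi> \<circ> \<psi>" H L C n0
      using L[OF c] by simp
    obtain S V W s where S: "open S" "S \<subseteq> U" "x \<in> S" "smooth_on S V" "smooth_on S W" "smooth_on S s"
      and fr: "\<forall>x\<in>S. canonical_frame (\<phi> \<circ> \<psi>) (\<xi> \<circ> \<psi>) x (B.Tf x) (V x) (W x) (B.af x) (s x) \<and> s x \<ge> 0"
      and s0: "(\<forall>x\<in>U. \<exists>T V W a s. canonical_frame (\<phi> \<circ> \<psi>) (\<xi> \<circ> \<psi>) x T V W a s \<and> a > 0 \<and> s = 0) \<longrightarrow> s = (\<lambda>x. 0)"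
      using B.smooth_canonical_frame[OF x] by blast
    interpret F: adapted_frame_chart U "\<phi> \<circ> \<psi>" "\<xi> \<circ> \<psi>" H S V W s L C n0
      by unfold_locales (use S fr in auto)
    have SO2: "s = (\<lambda>x. 0)" if "pointwise_SO2_symmetry \<A> \<phi> \<xi>"
    proof -
      have "\<forall>x\<in>U. \<exists>T V W a s. canonical_frame (\<phi> \<circ> \<psi>) (\<xi> \<circ> \<psi>) x T V W a s \<and> a > 0 \<and> s = 0"
        using that c unfolding pointwise_SO2_symmetry_def by blast
      then show ?thesis
        using s0 by blast
    qed
    obtain I and N :: "(real^2) set" and \<theta> \<Theta> \<rho> sec where b: "open I" "is_interval I" "open N" "convex N" "smooth_on (I \<times> N) \<theta>"
      "\<theta> ` (I \<times> N) \<subseteq> S" "open (\<theta> ` (I \<times> N))" "x \<in> \<theta> ` (I \<times> N)" "smooth_on (\<theta> ` (I \<times> N)) \<Theta>"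
      and inv: "\<forall>z\<in>I \<times> N. \<Theta> (\<theta> z) = z" and rho: "smooth_on (I \<times> N) \<rho>"
      and gy: "\<forall>t\<in>I. \<forall>v\<in>N. B.g (\<theta> (t, v)) = t \<and> B.y (\<theta> (t, v)) = \<rho> (t, v) *\<^sub>R sec v \<and> \<rho> (t, v) > (0::real)"
      using F.box_exists[OF S(3)] by (elim exE conjE) (rule that)
    obtain t0 v0 where tv: "t0 \<in> I" "v0 \<in> N" "x = \<theta> (t0, v0)"
      using b(8) by blast
    interpret R: box U "\<phi> \<circ> \<psi>" "\<xi> \<circ> \<psi>" H S V W s L C n0 I N \<theta> \<Theta> \<rho> sec t0 v0
      by unfold_locales (use b inv rho gy tv in auto)
    have sg: "sgn R.q0 = sgn (q c0 x0)"
      using q_sign[OF c _ c0, of x] x by (simp add: R.q0_def tv(3) chart_defs)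
    have P: "P N R.\<sigma>"
    proof (cases "q c0 x0 < 0")
      case True
      then have "R.q0 < 0"
        using sg by (metis sgn_less)
      then show ?thesis
        using ell[OF True R.sigma_elliptic] R.sigma_ellipsoid SO2 by simp
    next
      case False
      then have "q c0 x0 > 0"
        using q0 by simp
      moreover from this have "R.q0 > 0"
        using sg by (metis sgn_greater)
      ultimately show ?thesis
        using hyp[OF _ R.sigma_hyperbolic] R.sigma_hyperboloid SO2 by simp
    qed
    have U: "\<theta> ` (I \<times> N) \<subseteq> U"
      using R.theta_in_U by blast
    have lp: "local_param X (I \<times> N, \<psi> \<circ> \<theta>)"
      by (rule local_param_reparametrize[OF chart[OF c] R.open_box b(5) U b(7,9) R.Theta_theta])
    have co: "\<forall>d\<in>\<A>. compatible (I \<times> N, \<psi> \<circ> \<theta>) d"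
      by (intro ballI compatible_reparametrize[OF chart[OF c] chart charts_compatible[OF c] R.open_box b(5) U b(7,9) R.Theta_theta])
    have pim: "p \<in> (\<psi> \<circ> \<theta>) ` (I \<times> N)"
      unfolding p tv(3) using tv by (simp add: image_iff) blast
    have eq: "\<forall>t\<in>I. \<forall>v\<in>N. (A \<circ> \<phi>) ((\<psi> \<circ> \<theta>) (t, v)) =
      vector [t, R.\<gamma> t * R.\<sigma> v $ 1, R.\<gamma> t * R.\<sigma> v $ 2, R.\<gamma> t * R.\<sigma> v $ 3]"
      using R.product_form by (simp add: A_def)
    show "\<exists>(I :: real set) N \<theta> \<gamma>1 \<gamma>2 \<sigma>.
        open I \<and> is_interval I \<and> open N \<and> connected N \<and>
        local_param X (I \<times> N, \<theta>) \<and> (\<forall>c\<in>\<A>. compatible (I \<times> N, \<theta>) c) \<and> p \<in> \<theta> ` (I \<times> N) \<and>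
        smooth_on I \<gamma>1 \<and> smooth_on I \<gamma>2 \<and> P N \<sigma> \<and>
        (\<forall>t\<in>I. \<forall>v\<in>N. (A \<circ> \<phi>) (\<theta> (t, v)) =
           vector [\<gamma>1 t, \<gamma>2 t * \<sigma> v $ 1, \<gamma>2 t * \<sigma> v $ 2, \<gamma>2 t * \<sigma> v $ 3])"
      by (rule exI[of _ I], rule exI[of _ N], rule exI[of _ "\<psi> \<circ> \<theta>"], rule exI[of _ "\<lambda>t. t"],
          rule exI[of _ R.\<gamma>], rule exI[of _ R.\<sigma>])
        (intro conjI b(1,2,3) convex_connected[OF b(4)] lp co pim smooth_on_id R.smooth_gamma P eq)
  qed
  ultimately show ?thesis
    by blast
qed

end

theorem theorem1:
  fixes X :: "'a topology"
    and \<A> :: "(real^3, 'a) param set"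
    and \<phi> \<xi> :: "'a \<Rightarrow> real^4"
    and H :: real
  assumes "smooth_manifold X \<A>" and "connected_space X" and "oriented_atlas \<A>"
    and "indefinite_affine_hypersphere \<A> \<phi> \<xi> H"
    and "pointwise_Z3_symmetry \<A> \<phi> \<xi> \<or> pointwise_SO2_symmetry \<A> \<phi> \<xi>"
    and "\<exists>(U, \<psi>)\<in>\<A>. \<exists>x\<in>U. \<exists>V.
           affine_metric (\<phi> \<circ> \<psi>) (\<xi> \<circ> \<psi>) x V V = 1 \<and>
           affine_metric (\<phi> \<circ> \<psi>) (\<xi> \<circ> \<psi>) x (T_field (\<phi> \<circ> \<psi>) (\<xi> \<circ> \<psi>) x) V = 0 \<and>
           (a22 (\<phi> \<circ> \<psi>) (\<xi> \<circ> \<psi>) x V)\<^sup>2 - (a4 (\<phi> \<circ> \<psi>) (\<xi> \<circ> \<psi>) x)\<^sup>2 \<noteq> H"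
  shows "\<exists>A. affine_transformation A \<and>
    (locally_curve_times_surface X \<A> (A \<circ> \<phi>)
       (\<lambda>N \<sigma>. elliptic_affine_sphere N \<sigma> \<and>
          (pointwise_SO2_symmetry \<A> \<phi> \<xi> \<longrightarrow> (\<exists>Q. is_ellipsoid Q \<and> \<sigma> ` N \<subseteq> Q))) \<or>
     locally_curve_times_surface X \<A> (A \<circ> \<phi>)
       (\<lambda>N \<sigma>. hyperbolic_affine_sphere N \<sigma> \<and>
          (pointwise_SO2_symmetry \<A> \<phi> \<xi> \<longrightarrow> (\<exists>Q. is_two_sheeted_hyperboloid Q \<and> \<sigma> ` N \<subseteq> Q))))"
proof -
  interpret symmetric_hypersphere X \<A> \<phi> \<xi> H
    by unfold_locales (fact assms)+
  obtain U \<psi> x V where c: "(U, \<psi>) \<in> \<A>" and x: "x \<in> U"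
    and V: "affine_metric (\<phi> \<circ> \<psi>) (\<xi> \<circ> \<psi>) x V V = 1"
      "affine_metric (\<phi> \<circ> \<psi>) (\<xi> \<circ> \<psi>) x (T_field (\<phi> \<circ> \<psi>) (\<xi> \<circ> \<psi>) x) V = 0"
    and ne: "(a22 (\<phi> \<circ> \<psi>) (\<xi> \<circ> \<psi>) x V)\<^sup>2 - (a4 (\<phi> \<circ> \<psi>) (\<xi> \<circ> \<psi>) x)\<^sup>2 \<noteq> H"
    using assms(6) by blast
  interpret B: symmetric_chart U "\<phi> \<circ> \<psi>" "\<xi> \<circ> \<psi>" H
    using symmetric_chart[OF c] by simp
  have "q (U, \<psi>) x \<noteq> 0"
    using ne unfolding B.a22_eq[OF x V] by (simp add: chart_defs B.qf_def)
  \<comment> \<open>The type is fixed here once for the whole hypersurface, since the disjunction in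
    the conclusion stands outside the local statements.\<close>
  then consider "q (U, \<psi>) x < 0" | "q (U, \<psi>) x > 0"
    by linarith
  then show ?thesis
  proof cases
    case 1
    have "\<exists>A. affine_transformation A \<and> locally_curve_times_surface X \<A> (A \<circ> \<phi>)
       (\<lambda>N \<sigma>. elliptic_affine_sphere N \<sigma> \<and>
          (pointwise_SO2_symmetry \<A> \<phi> \<xi> \<longrightarrow> (\<exists>Q. is_ellipsoid Q \<and> \<sigma> ` N \<subseteq> Q)))"
      by (rule product[OF c, of x]) (use x 1 in simp_all)
    then show ?thesis by blast
  next
    case 2
    have "\<exists>A. affine_transformation A \<and> locally_curve_times_surface X \<A> (A \<circ> \<phi>)
       (\<lambda>N \<sigma>. hyperbolic_affine_sphere N \<sigma> \<and>
          (pointwise_SO2_symmetry \<A> \<phi> \<xi> \<longrightarrow> (\<exists>Q. is_two_sheeted_hyperboloid Q \<and> \<sigma> ` N \<subseteq> Q)))"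
      by (rule product[OF c, of x]) (use x 2 in simp_all)
    then show ?thesis by blast
  qed
qed

end
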